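(* For any $K\geq 0$, there exist constants $p>1$, $C>0$, and $D>0$, and a sequence $\{(\Sigma_i,g_i)\}_{i\in\mathbb{N}}$ of closed connected $\mathcal{C}^\infty$ Riemannian surfaces (dimension $n=2$) such that $\operatorname{diam}(\Sigma_i)\leq D$ and $\bar k(p,K)_{\Sigma_i}\leq C$ for all $i\in\mathbb{N}$, and \[\lim_{i\to\infty}\lambda_1(\Sigma_i)=0.\]
   Context: For a closed (compact without boundary) connected Riemannian manifold $(M^n,g)$, the Laplace-Beltrami operator is $\Delta u=\operatorname{div}(\nabla u)$, and $\lambda_1(M)>0$ denotes the smallest non-zero eigenvalue of $-\Delta$, i.e. the smallest $\lambda>0$ such that $-\Delta u=\lambda u$ has a solution $u\not\equiv 0$. $\operatorname{diam}(M)$ is the diameter with respect to the Riemannian (intrinsic) distance. For $x\in M$, let $\rho(x)$ be the smallest eigenvalue of the Ricci tensor at $x$. For $K\in\mathbb{R}$ let \[\rho_K(x)=\max\{-\rho(x)+(n-1)K,\,0\},\] and for $p\ge 1$ let \[\bar k(p,K)_M=\left(\frac{1}{\operatorname{vol}(M)}\int_M\rho_K^p\,dv\right)^{1/p},\] where $dv$ is the Riemannian volume measure and $\operatorname{vol}(M)$ is the total volume. When $n=2$, $\rho$ is the Gaussian curvature $\kappa$, so $\rho_K=\max\{K-\kappa,0\}$. *)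

theory Defs
  imports "HOL-Analysis.Analysis"
begin

section \<open>Smooth maps between Euclidean spaces\<close>

primrec Ck_on :: "nat \<Rightarrow> 'a::real_normed_vector set \<Rightarrow> ('a \<Rightarrow> 'b::real_normed_vector) \<Rightarrow> bool" where
  "Ck_on 0 S f \<longleftrightarrow> continuous_on S f"
| "Ck_on (Suc k) S f \<longleftrightarrow> (\<forall>x\<in>S. f differentiable (at x)) \<and>
     (\<forall>v. Ck_on k S (\<lambda>x. frechet_derivative f (at x) v))"

text \<open>Only meaningful for open \<open>S\<close>, since the derivatives are two-sided.\<close>
definition smooth_on :: "'a::real_normed_vector set \<Rightarrow> ('a \<Rightarrow> 'b::real_normed_vector) \<Rightarrow> bool" where
  "smooth_on S f \<longleftrightarrow> (\<forall>k. Ck_on k S f)"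

definition partial :: "'n::finite \<Rightarrow> (real^'n \<Rightarrow> real) \<Rightarrow> real^'n \<Rightarrow> real" where
  "partial i f x = frechet_derivative f (at x) (axis i 1)"


section \<open>Closed Riemannian manifolds\<close>

text \<open>A chart is a pair \<open>(U, \<phi>)\<close>; only the values of \<open>\<phi>\<close> on \<open>U\<close> matter. The Riemannian metric is
  given by its coordinate matrices: \<open>metric M (U, \<phi>) x\<close>, for \<open>x \<in> \<phi> ` U\<close>, is the matrix
  \<open>(g\<^sub>i\<^sub>j)\<close> in the chart \<open>(U, \<phi>)\<close> at the point with coordinates \<open>x\<close>.\<close>

type_synonym ('a, 'n) chart = "'a set \<times> ('a \<Rightarrow> real^'n)"

record ('a, 'n::finite) riemannian =
  mtop :: "'a topology"
  atlas :: "('a, 'n::finite) chart set"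
  metric :: "('a, 'n::finite) chart \<Rightarrow> real^'n \<Rightarrow> real^'n^'n"

abbreviation points :: "('a, 'n::finite) riemannian \<Rightarrow> 'a set" where
  "points M \<equiv> topspace (mtop M)"

definition is_chart :: "'a topology \<Rightarrow> ('a, 'n::finite) chart \<Rightarrow> bool" where
  "is_chart X = (\<lambda>(U, \<phi>). openin X U \<and> open (\<phi> ` U) \<and>
     homeomorphic_map (subtopology X U) (top_of_set (\<phi> ` U)) \<phi>)"

definition transition :: "('a, 'n::finite) chart \<Rightarrow> ('a, 'n::finite) chart \<Rightarrow> real^'n \<Rightarrow> real^'n" where
  "transition c d = snd d \<circ> inv_into (fst c) (snd c)"

definition smooth_atlas :: "('a, 'n::finite) riemannian \<Rightarrow> bool" where
  "smooth_atlas M \<longleftrightarrow>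
     (\<forall>c\<in>atlas M. is_chart (mtop M) c) \<and>
     (\<Union>c\<in>atlas M. fst c) = points M \<and>
     (\<forall>c\<in>atlas M. \<forall>d\<in>atlas M. smooth_on (snd c ` (fst c \<inter> fst d)) (transition c d))"

definition smooth_metric :: "('a, 'n::finite) riemannian \<Rightarrow> bool" where
  "smooth_metric M \<longleftrightarrow>
     (\<forall>c\<in>atlas M. smooth_on (snd c ` fst c) (metric M c) \<and>
        (\<forall>x\<in>snd c ` fst c. transpose (metric M c x) = metric M c x \<and>
           (\<forall>v. v \<noteq> 0 \<longrightarrow> v \<bullet> (metric M c x *v v) > 0))) \<and>
     (\<forall>c\<in>atlas M. \<forall>d\<in>atlas M. \<forall>x\<in>snd c ` (fst c \<inter> fst d).
        let J = matrix (frechet_derivative (transition c d) (at x))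
        in metric M c x = transpose J ** metric M d (transition c d x) ** J)"

text \<open>Second countability is automatic for compact, locally Euclidean spaces, and there is no boundary
  because charts have open images.\<close>
definition closed_connected_riemannian :: "('a, 'n::finite) riemannian \<Rightarrow> bool" where
  "closed_connected_riemannian M \<longleftrightarrow>
     points M \<noteq> {} \<and> Hausdorff_space (mtop M) \<and> compact_space (mtop M) \<and>
     connected_space (mtop M) \<and> smooth_atlas M \<and> smooth_metric M"

text \<open>Objects whose coordinate expressions do not depend on the chart are evaluated in an arbitrary
  chart around the point.\<close>
definition chart_at :: "('a, 'n::finite) riemannian \<Rightarrow> 'a \<Rightarrow> ('a, 'n::finite) chart" where
  "chart_at M q = (SOME c. c \<in> atlas M \<and> q \<in> fst c)"

definition in_chart :: "('a, 'n::finite) chart \<Rightarrow> ('a \<Rightarrow> 'b) \<Rightarrow> real^'n \<Rightarrow> 'b" where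
  "in_chart c u = u \<circ> inv_into (fst c) (snd c)"

definition smooth_function :: "('a, 'n::finite) riemannian \<Rightarrow> ('a \<Rightarrow> real) \<Rightarrow> bool" where
  "smooth_function M u \<longleftrightarrow> (\<forall>c\<in>atlas M. smooth_on (snd c ` fst c) (in_chart c u))"


section \<open>Laplace-Beltrami operator and first eigenvalue\<close>

text \<open>For a coordinate metric \<open>g\<close>: \<open>(\<nabla>u)\<^sup>i = \<Sum>\<^sub>j g\<^sup>i\<^sup>j \<partial>\<^sub>j u\<close> and
  \<open>div X = (det g)\<^sup>-\<^sup>1\<^sup>/\<^sup>2 \<Sum>\<^sub>i \<partial>\<^sub>i ((det g)\<^sup>1\<^sup>/\<^sup>2 X\<^sup>i)\<close>.\<close>

definition coord_grad ::
  "(real^'n \<Rightarrow> real^'n^'n) \<Rightarrow> (real^'n \<Rightarrow> real) \<Rightarrow> real^'n::finite \<Rightarrow> real^'n" where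
  "coord_grad g u x = matrix_inv (g x) *v (\<chi> j. partial j u x)"

definition coord_div ::
  "(real^'n \<Rightarrow> real^'n^'n) \<Rightarrow> (real^'n \<Rightarrow> real^'n) \<Rightarrow> real^'n::finite \<Rightarrow> real" where
  "coord_div g X x =
     (\<Sum>i\<in>UNIV. partial i (\<lambda>y. sqrt (det (g y)) * X y $ i) x) / sqrt (det (g x))"

definition laplacian :: "('a, 'n::finite) riemannian \<Rightarrow> ('a \<Rightarrow> real) \<Rightarrow> 'a \<Rightarrow> real" where
  "laplacian M u q =
     (let c = chart_at M q; g = metric M c in coord_div g (coord_grad g (in_chart c u)) (snd c q))"

definition laplace_eigenvalue :: "('a, 'n::finite) riemannian \<Rightarrow> real \<Rightarrow> bool" where
  "laplace_eigenvalue M l \<longleftrightarrow>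
     (\<exists>u. smooth_function M u \<and> (\<exists>q\<in>points M. u q \<noteq> 0) \<and>
        (\<forall>q\<in>points M. - laplacian M u q = l * u q))"

definition lambda1 :: "('a, 'n::finite) riemannian \<Rightarrow> real" where
  "lambda1 M = (LEAST l. l > 0 \<and> laplace_eigenvalue M l)"


section \<open>Intrinsic diameter\<close>

text \<open>\<open>\<phi> \<circ> \<gamma>\<close> is only relevant near times \<open>t\<close> with \<open>\<gamma> t \<in> U\<close>, and the set of such times is
  open in \<open>{a..b}\<close>.\<close>
definition C1_curve_on :: "('a, 'n::finite) riemannian \<Rightarrow> real \<Rightarrow> real \<Rightarrow> (real \<Rightarrow> 'a) \<Rightarrow> bool" where
  "C1_curve_on M a b \<gamma> \<longleftrightarrow>
     continuous_map (top_of_set {a..b}) (mtop M) \<gamma> \<and>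
     (\<forall>(U, \<phi>)\<in>atlas M. \<exists>v. continuous_on {t\<in>{a..b}. \<gamma> t \<in> U} v \<and>
        (\<forall>t\<in>{a..b}. \<gamma> t \<in> U \<longrightarrow> ((\<phi> \<circ> \<gamma>) has_vector_derivative v t) (at t within {a..b})))"

definition piecewise_C1_curve :: "('a, 'n::finite) riemannian \<Rightarrow> (real \<Rightarrow> 'a) \<Rightarrow> bool" where
  "piecewise_C1_curve M \<gamma> \<longleftrightarrow>
     (\<exists>ts. ts \<noteq> [] \<and> sorted_wrt (<) ts \<and> hd ts = 0 \<and> last ts = 1 \<and>
        (\<forall>i. Suc i < length ts \<longrightarrow> C1_curve_on M (ts ! i) (ts ! Suc i) \<gamma>))"

text \<open>At the finitely many break points and at the end points the speed may be a meaningless value;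
  this does not affect the length.\<close>
definition speed :: "('a, 'n::finite) riemannian \<Rightarrow> (real \<Rightarrow> 'a) \<Rightarrow> real \<Rightarrow> real" where
  "speed M \<gamma> t =
     (let c = chart_at M (\<gamma> t); v = vector_derivative (snd c \<circ> \<gamma>) (at t)
      in sqrt (v \<bullet> (metric M c (snd c (\<gamma> t)) *v v)))"

definition curve_length :: "('a, 'n::finite) riemannian \<Rightarrow> (real \<Rightarrow> 'a) \<Rightarrow> ennreal" where
  "curve_length M \<gamma> = (\<integral>\<^sup>+t\<in>{0..1}. ennreal (speed M \<gamma> t) \<partial>lborel)"

definition riemannian_dist :: "('a, 'n::finite) riemannian \<Rightarrow> 'a \<Rightarrow> 'a \<Rightarrow> ennreal" where
  "riemannian_dist M q r =
     (INF \<gamma>\<in>{\<gamma>. piecewise_C1_curve M \<gamma> \<and> \<gamma> 0 = q \<and> \<gamma> 1 = r}. curve_length M \<gamma>)"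

definition riemannian_diam :: "('a, 'n::finite) riemannian \<Rightarrow> ennreal" where
  "riemannian_diam M = (SUP q\<in>points M. SUP r\<in>points M. riemannian_dist M q r)"


section \<open>Ricci curvature\<close>

definition christoffel ::
  "(real^'n \<Rightarrow> real^'n^'n) \<Rightarrow> real^'n::finite \<Rightarrow> 'n \<Rightarrow> 'n \<Rightarrow> 'n \<Rightarrow> real" where
  "christoffel g x k i j =
     (\<Sum>l\<in>UNIV. matrix_inv (g x) $ k $ l *
        (partial i (\<lambda>y. g y $ j $ l) x + partial j (\<lambda>y. g y $ i $ l) x
          - partial l (\<lambda>y. g y $ i $ j) x)) / 2"

text \<open>The \<open>l\<close>-th component of
  \<open>R(\<partial>\<^sub>i,\<partial>\<^sub>j)\<partial>\<^sub>k = \<nabla>\<^sub>i\<nabla>\<^sub>j\<partial>\<^sub>k - \<nabla>\<^sub>j\<nabla>\<^sub>i\<partial>\<^sub>k\<close>.\<close>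
definition riemann ::
  "(real^'n \<Rightarrow> real^'n^'n) \<Rightarrow> real^'n::finite \<Rightarrow> 'n \<Rightarrow> 'n \<Rightarrow> 'n \<Rightarrow> 'n \<Rightarrow> real" where
  "riemann g x l k i j =
     partial i (\<lambda>y. christoffel g y l j k) x - partial j (\<lambda>y. christoffel g y l i k) x
     + (\<Sum>m\<in>UNIV. christoffel g x l i m * christoffel g x m j k
                  - christoffel g x l j m * christoffel g x m i k)"

definition ricci :: "(real^'n \<Rightarrow> real^'n^'n) \<Rightarrow> real^'n::finite \<Rightarrow> real^'n^'n" where
  "ricci g x = (\<chi> j k. \<Sum>l\<in>UNIV. riemann g x l k l j)"

text \<open>Eigenvalues of the Ricci tensor are taken with respect to the metric: \<open>Ric(v, \<cdot>) = l g(v, \<cdot>)\<close>.\<close>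
definition ricci_eigenvalue :: "('a, 'n::finite) riemannian \<Rightarrow> 'a \<Rightarrow> real \<Rightarrow> bool" where
  "ricci_eigenvalue M q l \<longleftrightarrow>
     (let c = chart_at M q; g = metric M c; x = snd c q
      in \<exists>v. v \<noteq> 0 \<and> ricci g x *v v = l *\<^sub>R (g x *v v))"

definition rho :: "('a, 'n::finite) riemannian \<Rightarrow> 'a \<Rightarrow> real" where
  "rho M q = (LEAST l. ricci_eigenvalue M q l)"

definition rho_K :: "('a, 'n::finite) riemannian \<Rightarrow> real \<Rightarrow> 'a \<Rightarrow> real" where
  "rho_K M K q = max (- rho M q + (real CARD('n) - 1) * K) 0"


section \<open>Riemannian volume and integral curvature\<close>

text \<open>The Riemannian volume is the unique Borel measure given by \<open>(det g)\<^sup>1\<^sup>/\<^sup>2 dx\<close> in every chart.\<close>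

definition is_volume_measure :: "('a, 'n::finite) riemannian \<Rightarrow> 'a measure \<Rightarrow> bool" where
  "is_volume_measure M \<mu> \<longleftrightarrow>
     sets \<mu> = sets (sigma (points M) {U. openin (mtop M) U}) \<and>
     (\<forall>c\<in>atlas M. \<forall>A\<in>sets \<mu>. A \<subseteq> fst c \<longrightarrow>
        emeasure \<mu> A = (\<integral>\<^sup>+x\<in>snd c ` A. ennreal (sqrt (det (metric M c x))) \<partial>lborel))"

definition volume_measure :: "('a, 'n::finite) riemannian \<Rightarrow> 'a measure" where
  "volume_measure M = (THE \<mu>. is_volume_measure M \<mu>)"

definition riemannian_vol :: "('a, 'n::finite) riemannian \<Rightarrow> real" where
  "riemannian_vol M = measure (volume_measure M) (points M)"

definition kbar :: "real \<Rightarrow> real \<Rightarrow> ('a, 'n::finite) riemannian \<Rightarrow> real" where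
  "kbar p K M =
     (1 / riemannian_vol M * (\<integral>q. rho_K M K q powr p \<partial>volume_measure M)) powr (1 / p)"

text \<open>The topology and smooth structure are part of the data, so the type of points only has to be
  large enough: a surface has the cardinality of the continuum, and so does this type. Hence every
  closed connected surface is isometric to one whose points are of this type.\<close>
type_synonym surface = "(complex \<times> complex, 2) riemannian"

end

theory Submission imports Defs begin

text \<open>
  The surfaces are tori \<open>\<real>\<^sup>2 / (2\<pi>\<int>)\<^sup>2\<close> with a metric \<open>A(t) dt\<^sup>2 + B(t) dy\<^sup>2\<close>. For functions of \<open>t\<close>
  alone the eigenvalue equation is \<open>(T u')' = - l w u\<close> with \<open>T = sqrt (B / A)\<close> and \<open>w = sqrt (A B)\<close>.
  The metric is chosen such that \<open>sin t\<close> is an eigenfunction for a prescribed small \<open>e\<close> and such that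
  there are two bulges, at \<open>cos t = 0\<close>, joined by two necks, at \<open>sin t = 0\<close>, whose circumference at
  distance \<open>r\<close> from the middle is of order \<open>e\<^sup>3\<^sup>/\<^sup>2 + r\<^sup>3\<close>. These cusps have bounded length, and the
  negative part of the curvature, of order \<open>cos\<^sup>2 t / e\<close>, is bounded in \<open>L\<^sup>3\<^sup>/\<^sup>2\<close>.

  That \<open>lambda1\<close> is at most \<open>e\<close> needs the existence of a least positive eigenvalue. As \<open>B \<le> 1\<close>, an
  eigenfunction for a small \<open>l\<close> is constant on the circles \<open>t = const\<close>, which leaves a periodic
  Sturm-Liouville problem; it has finitely many eigenvalues in \<open>(0, e]\<close> by a Bessel inequality.
\<close>


section \<open>Smooth maps and partial derivatives\<close>

text \<open>Lengths and curvature are controlled by one and the same density. Put \<xi> = e + cos^2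
  t. The length element \<open>sqrt A\<close> is at most sqrt 2 * sqrt e / \<xi>. The curvature is
  bounded below by a multiple of - \<xi> / e, and the area density \<open>w\<close> is of order e^2
  / \<xi>^(5/2), so an exponent p leads to the integrand e^(2 - p) * \<xi>^(p - 5/2); the choice p =
  3/2 makes it sqrt e / \<xi> again. This density concentrates on a width of order sqrt e around cos
  t = 0 and has a total mass bounded independently of e, so one elementary primitive of a majorant
  bounds both the diameter and the curvature integral. The bulges also carry a fixed amount of area,
  which keeps the normalising volume away from 0. The surfaces do not depend on K: since \<xi> / e
  \<ge> 1, a constant K is absorbed into the factor in front of \<xi> / e and affects only the final
  bound.\<close>

lemma Ck_on_cong:
  assumes "open S" "\<And>x. x \<in> S \<Longrightarrow> f x = g x" "Ck_on k S f"
  shows "Ck_on k S g"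
  using assms(2,3)
proof (induction k arbitrary: f g)
  case 0
  then show ?case by (simp cong: continuous_on_cong)
next
  case (Suc k)
  have d: "(g has_derivative frechet_derivative f (at x)) (at x)" if "x \<in> S" for x
  proof (rule has_derivative_transform_within_open[OF _ assms(1) that])
    show "(f has_derivative frechet_derivative f (at x)) (at x)"
      using Suc.prems that by (simp add: frechet_derivative_works[symmetric])
  qed (use Suc.prems in auto)
  have "g differentiable at x" if "x \<in> S" for x
    using d[OF that] by (auto simp: differentiable_def)
  moreover have "Ck_on k S (\<lambda>x. frechet_derivative g (at x) v)" for v
  proof (rule Suc.IH)
    show "Ck_on k S (\<lambda>x. frechet_derivative f (at x) v)"
      using Suc.prems by simp
    show "frechet_derivative f (at x) v = frechet_derivative g (at x) v" if "x \<in> S" for x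
      using frechet_derivative_at[OF d[OF that]] by simp
  qed
  ultimately show ?case by simp
qed

text \<open>Each closure proof below supplies an explicit derivative; in a fixed direction it is
  again built from functions of lower order, to which the induction hypothesis applies.\<close>

lemma Ck_on_SucI:
  assumes "open S" "\<And>x. x \<in> S \<Longrightarrow> (f has_derivative f' x) (at x)"
    and "\<And>v. Ck_on k S (\<lambda>x. f' x v)"
  shows "Ck_on (Suc k) S f"
proof -
  have "Ck_on k S (\<lambda>x. frechet_derivative f (at x) v)" for v
    by (rule Ck_on_cong[OF assms(1) _ assms(3)[of v]])
       (simp add: frechet_derivative_at[OF assms(2), symmetric])
  moreover have "\<forall>x\<in>S. f differentiable at x"
    using assms(2) by (auto simp: differentiable_def)
  ultimately show ?thesis by simp
qed

lemma Ck_on_SucD: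
  assumes "Ck_on (Suc k) S f" "x \<in> S"
  shows "(f has_derivative frechet_derivative f (at x)) (at x)"
  using assms frechet_derivative_works by auto

lemma Ck_on_lower: "Ck_on (Suc k) S f \<Longrightarrow> Ck_on k S f"
proof (induction k arbitrary: f)
  case 0
  then show ?case
    by (auto intro!: continuous_at_imp_continuous_on differentiable_imp_continuous_within)
next
  case (Suc k)
  then show ?case by fastforce
qed

lemma Ck_on_subset: "Ck_on k S f \<Longrightarrow> T \<subseteq> S \<Longrightarrow> Ck_on k T f"
  by (induction k arbitrary: f) (auto intro: continuous_on_subset)

lemma Ck_on_local:
  assumes "\<And>x. x \<in> S \<Longrightarrow> \<exists>T. open T \<and> x \<in> T \<and> Ck_on k T f"
  shows "Ck_on k S f"
  using assms
proof (induction k arbitrary: f)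
  case 0
  then show ?case
    by (metis Ck_on.simps(1) continuous_at_imp_continuous_on continuous_on_eq_continuous_at)
next
  case (Suc k)
  have "\<forall>x\<in>S. f differentiable at x"
    using Suc.prems by fastforce
  moreover have "Ck_on k S (\<lambda>x. frechet_derivative f (at x) v)" for v
    by (rule Suc.IH) (use Suc.prems in fastforce)
  ultimately show ?case by simp
qed

lemma Ck_on_const: "open S \<Longrightarrow> Ck_on k S (\<lambda>x. c)"
proof (induction k arbitrary: c)
  case (Suc k)
  show ?case by (rule Ck_on_SucI[where f' = "\<lambda>x v. 0"]) (use Suc in auto)
qed simp

lemma Ck_on_bounded_linear:
  assumes "open S" "bounded_linear f"
  shows "Ck_on k S f"
proof (cases k)
  case 0
  then show ?thesis using linear_continuous_on[OF assms(2)] by simp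
next
  case (Suc m)
  show ?thesis unfolding Suc
    by (rule Ck_on_SucI[where f' = "\<lambda>x. f"])
       (use assms Ck_on_const in \<open>auto intro: bounded_linear_imp_has_derivative\<close>)
qed

lemma Ck_on_add:
  assumes "open S"
  shows "Ck_on k S f \<Longrightarrow> Ck_on k S g \<Longrightarrow> Ck_on k S (\<lambda>x. f x + g x)"
proof (induction k arbitrary: f g)
  case 0
  then show ?case by (simp add: continuous_on_add)
next
  case (Suc k)
  show ?case
    by (rule Ck_on_SucI[where f' = "\<lambda>x v. frechet_derivative f (at x) v + frechet_derivative g (at x) v"])
       (use assms Suc in \<open>auto intro!: has_derivative_add Ck_on_SucD\<close>)
qed

lemma Ck_on_scaleR:
  fixes f :: "'a::real_normed_vector \<Rightarrow> real"
  assumes "open S"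
  shows "Ck_on k S f \<Longrightarrow> Ck_on k S g \<Longrightarrow> Ck_on k S (\<lambda>x. f x *\<^sub>R g x)"
proof (induction k arbitrary: f g)
  case 0
  then show ?case by (simp add: continuous_on_scaleR)
next
  case (Suc k)
  show ?case
  proof (rule Ck_on_SucI[OF assms])
    show "((\<lambda>x. f x *\<^sub>R g x) has_derivative
      (\<lambda>v. f x *\<^sub>R frechet_derivative g (at x) v + frechet_derivative f (at x) v *\<^sub>R g x)) (at x)"
      if "x \<in> S" for x
      by (rule has_derivative_scaleR) (use Suc.prems that in \<open>auto intro!: Ck_on_SucD\<close>)
    show "Ck_on k S (\<lambda>x. f x *\<^sub>R frechet_derivative g (at x) v + frechet_derivative f (at x) v *\<^sub>R g x)" for v
    proof (intro Ck_on_add[OF assms] Suc.IH)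
      show "Ck_on k S f" "Ck_on k S g"
        using Suc.prems by (auto intro: Ck_on_lower simp del: Ck_on.simps)
    qed (use Suc.prems in auto)
  qed
qed

lemma Ck_on_mult:
  fixes f g :: "'a::real_normed_vector \<Rightarrow> real"
  shows "open S \<Longrightarrow> Ck_on k S f \<Longrightarrow> Ck_on k S g \<Longrightarrow> Ck_on k S (\<lambda>x. f x * g x)"
  using Ck_on_scaleR[of S k f g] by simp

lemma Ck_on_inverse:
  fixes f :: "'a::real_normed_vector \<Rightarrow> real"
  assumes "open S" "\<And>x. x \<in> S \<Longrightarrow> f x \<noteq> 0"
  shows "Ck_on k S f \<Longrightarrow> Ck_on k S (\<lambda>x. inverse (f x))"
proof (induction k)
  case 0
  then show ?case using assms by (simp add: continuous_on_inverse)
next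
  case (Suc k)
  show ?case
  proof (rule Ck_on_SucI[OF assms(1)])
    \<comment> \<open>The derivative is a product containing \<open>inverse (f x)\<close> itself
      rather than a quotient, so the induction hypothesis covers it.\<close>
    show "((\<lambda>x. inverse (f x)) has_derivative
        (\<lambda>v. (-1) * (inverse (f x) * frechet_derivative f (at x) v * inverse (f x)))) (at x)"
      if "x \<in> S" for x
      using Deriv.has_derivative_inverse[OF assms(2)[OF that] Ck_on_SucD[OF Suc.prems that]] by simp
    show "Ck_on k S (\<lambda>x. (-1) * (inverse (f x) * frechet_derivative f (at x) v * inverse (f x)))" for v
    proof (intro Ck_on_mult Ck_on_const)
      show "Ck_on k S (\<lambda>x. inverse (f x))" "Ck_on k S (\<lambda>x. inverse (f x))"
        using Suc.IH Ck_on_lower[OF Suc.prems] by blast+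
    qed (use Suc.prems assms in auto)
  qed
qed

text \<open>The two claims need a joint induction because differentiation exchanges them. For linear
  \<open>f\<close> the inner derivative \<open>f v\<close> is constant in x.\<close>

lemma Ck_on_cos_sin:
  fixes f :: "'a::real_normed_vector \<Rightarrow> real"
  assumes "open S" "bounded_linear f"
  shows "Ck_on k S (\<lambda>x. cos (f x)) \<and> Ck_on k S (\<lambda>x. sin (f x))"
proof (induction k)
  case 0
  show ?case using linear_continuous_on[OF assms(2)] by (simp add: continuous_intros)
next
  case (Suc k)
  have d: "(f has_derivative f) (at x)" for x
    by (rule bounded_linear_imp_has_derivative[OF assms(2)])
  have "Ck_on (Suc k) S (\<lambda>x. cos (f x))"
  proof (rule Ck_on_SucI[OF assms(1)])
    show "((\<lambda>x. cos (f x)) has_derivative (\<lambda>v. (- f v) * sin (f x))) (at x)" for x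
      by (rule derivative_eq_intros refl d | simp)+
    show "Ck_on k S (\<lambda>x. (- f v) * sin (f x))" for v
      using Suc assms by (intro Ck_on_mult Ck_on_const) auto
  qed
  moreover have "Ck_on (Suc k) S (\<lambda>x. sin (f x))"
  proof (rule Ck_on_SucI[OF assms(1)])
    show "((\<lambda>x. sin (f x)) has_derivative (\<lambda>v. f v * cos (f x))) (at x)" for x
      by (rule derivative_eq_intros refl d | simp)+
    show "Ck_on k S (\<lambda>x. f v * cos (f x))" for v
      using Suc assms by (intro Ck_on_mult Ck_on_const) auto
  qed
  ultimately show ?case by simp
qed

section \<open>Partial derivatives: locality, functions of one coordinate, periodicity\<close>

lemma has_derivative_imp_partial:
  "(f has_derivative f') (at x) \<Longrightarrow> partial i f x = f' (axis i 1)"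
  by (simp add: partial_def frechet_derivative_at[symmetric])

lemma partial_cong:
  assumes "open S" "x \<in> S" "\<And>y. y \<in> S \<Longrightarrow> f y = g y"
  shows "partial i f x = partial i g x"
proof -
  have "(f has_derivative F) (at x) \<longleftrightarrow> (g has_derivative F) (at x)" for F
    using has_derivative_transform_within_open[OF _ assms(1,2), of f F UNIV g]
      has_derivative_transform_within_open[OF _ assms(1,2), of g F UNIV f] assms(3) by auto
  then show ?thesis by (simp add: partial_def frechet_derivative_def)
qed

lemma has_derivative_component:
  fixes h :: "real \<Rightarrow> real"
  assumes "(h has_real_derivative h') (at (x $ j))"
  shows "((\<lambda>y. h (y $ j)) has_derivative (\<lambda>v. h' * (v $ j))) (at x)"
  by (rule has_derivative_compose[OF bounded_linear_imp_has_derivative[OF bounded_linear_vec_nth]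
        assms[unfolded has_field_derivative_def]])

lemma partial_component:
  fixes h :: "real \<Rightarrow> real"
  assumes "(h has_real_derivative h') (at (x $ j))"
  shows "partial i (\<lambda>y. h (y $ j)) x = (if i = j then h' else 0)"
  using has_derivative_imp_partial[OF has_derivative_component[OF assms]] by (auto simp: axis_def)

text \<open>Translation matches the derivatives at x with those at x + v, so the choice inside
  \<open>frechet_derivative\<close> picks the same map, also where f is not differentiable.\<close>

lemma partial_periodic:
  assumes "\<And>y. f (y + v) = f y"
  shows "partial i f (x + v) = partial i f x"
proof -
  have s: "((\<lambda>y. y + c) has_derivative (\<lambda>h. h)) (at z)" for c z :: "real^'n"
    by (auto intro!: derivative_eq_intros)
  have "(f has_derivative D) (at x)" if "(f has_derivative D) (at (x + v))" for D
    using has_derivative_compose[OF s that] assms by simp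
  moreover have "(f has_derivative D) (at (x + v))" if "(f has_derivative D) (at x)" for D
  proof -
    have "f (y + - v) = f y" for y
      using assms[of "y - v"] by simp
    then show ?thesis
      using has_derivative_compose[OF s, of f D "x + v" "- v"] that by simp
  qed
  ultimately show ?thesis
    unfolding partial_def frechet_derivative_def by metis
qed

lemma matrix_inv_unique:
  fixes A :: "'a::semiring_1^'n^'m"
  assumes "A ** B = mat 1" "B ** A = mat 1"
  shows "matrix_inv A = B"
proof -
  have "A ** matrix_inv A = mat 1 \<and> matrix_inv A ** A = mat 1"
    unfolding matrix_inv_def by (rule someI[of _ B]) (use assms in simp)
  then show ?thesis
    by (metis assms(2) matrix_mul_assoc matrix_mul_lid matrix_mul_rid)
qed

lemma periodic_int:
  fixes f :: "real \<Rightarrow> 'a"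
  assumes "\<And>t. f (t + 2 * pi) = f t"
  shows "f (t + 2 * pi * of_int k) = f t"
proof -
  have nat: "f (t + 2 * pi * real n) = f t" for n t
  proof (induction n)
    case (Suc n)
    then show ?case using assms[of "t + 2 * pi * real n"] by (simp add: algebra_simps)
  qed simp
  show ?thesis
  proof (cases k)
    case (nonneg n)
    then show ?thesis using nat by simp
  next
    case (neg n)
    have "t + 2 * pi * of_int k + 2 * pi * real (Suc n) = t"
      by (simp add: neg algebra_simps)
    then show ?thesis using nat[of "t + 2 * pi * of_int k" "Suc n"] by metis
  qed
qed

lemma derivative_periodic:
  fixes f :: "real \<Rightarrow> real"
  assumes "\<And>t. f (t + c) = f t" "\<And>t. (f has_real_derivative f' t) (at t)"
  shows "f' (t + c) = f' t"
proof -
  have "((\<lambda>s. f (s + c)) has_real_derivative f' (t + c)) (at t)"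
    using assms(2) DERIV_shift by blast
  then have "(f has_real_derivative f' (t + c)) (at t)"
    by (simp add: assms(1))
  then show ?thesis using assms(2) by (rule DERIV_unique)
qed

section \<open>Rotationally symmetric metrics on the torus\<close>

text \<open>The quotient of the plane by the lattice, realised inside the prescribed type of points
  as a product of two unit circles.\<close>

definition torus :: "(complex \<times> complex) set" where
  "torus = sphere 0 1 \<times> sphere 0 1"

definition angle_point :: "real^2 \<Rightarrow> complex \<times> complex" where
  "angle_point x = (cis (x $ 1), cis (x $ 2))"

definition square :: "real \<Rightarrow> real \<Rightarrow> (real^2) set" where
  "square a b = {x. \<bar>x $ 1 - a\<bar> < pi / 2 \<and> \<bar>x $ 2 - b\<bar> < pi / 2}"

text \<open>The half-plane conditions say that each angle is within pi / 2 of the centre. In this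
  form openness is immediate and \<open>Arg\<close> stays off its branch cut.\<close>

definition patch :: "real \<Rightarrow> real \<Rightarrow> (complex \<times> complex) set" where
  "patch a b = {q \<in> torus. Re (fst q * cis (- a)) > 0 \<and> Re (snd q * cis (- b)) > 0}"

definition angles :: "real \<Rightarrow> real \<Rightarrow> complex \<times> complex \<Rightarrow> real^2" where
  "angles a b q = vector [a + Arg (fst q * cis (- a)), b + Arg (snd q * cis (- b))]"

definition torus_atlas :: "(complex \<times> complex, 2) chart set" where
  "torus_atlas = range (\<lambda>(a, b). (patch a b, angles a b))"

definition lattice :: "int \<times> int \<Rightarrow> real^2" where
  "lattice k = vector [2 * pi * of_int (fst k), 2 * pi * of_int (snd k)]"

lemma lattice_nth [simp]:
  "lattice k $ 1 = 2 * pi * of_int (fst k)" "lattice k $ 2 = 2 * pi * of_int (snd k)"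
  by (simp_all add: lattice_def)

lemma eq_vec2_iff: "(x::'a^2) = y \<longleftrightarrow> x $ 1 = y $ 1 \<and> x $ 2 = y $ 2"
  by (simp add: vec_eq_iff forall_2)

lemma angle_point_in_torus [simp]: "angle_point x \<in> torus"
  by (simp add: angle_point_def torus_def)

section \<open>Angular coordinates and their ambiguity by lattice vectors\<close>

lemma cis_eq_iff: "cis x = cis y \<longleftrightarrow> (\<exists>k::int. x = y + 2 * pi * of_int k)"
proof -
  have "cis x = cis y \<longleftrightarrow> exp (\<i> * x) = exp (\<i> * y)"
    by (simp add: cis_conv_exp)
  also have "\<dots> \<longleftrightarrow> (\<exists>k::int. \<i> * x = \<i> * y + of_int (2 * k) * (of_real pi * \<i>))"
    by (simp add: exp_eq mult.assoc)
  also have "\<dots> \<longleftrightarrow> (\<exists>k::int. x = y + 2 * pi * of_int k)"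
    by (intro ex_cong1) (auto simp: complex_eq_iff)
  finally show ?thesis .
qed

lemma angle_point_eq_iff: "angle_point x = angle_point y \<longleftrightarrow> (\<exists>k. x = y + lattice k)"
  by (simp add: angle_point_def cis_eq_iff eq_vec2_iff split_paired_Ex)

lemma angle_point_lattice [simp]: "angle_point (x + lattice k) = angle_point x"
  using angle_point_eq_iff by blast

lemma continuous_on_angle_point: "continuous_on S angle_point"
  unfolding angle_point_def by (intro continuous_intros)

lemma open_square: "open (square a b)"
proof -
  have "square a b = (\<lambda>x. x $ 1) -` ball a (pi/2) \<inter> (\<lambda>x. x $ 2) -` ball b (pi/2)"
    by (auto simp: square_def dist_real_def abs_minus_commute)
  then show ?thesis
    by (auto intro!: open_Int continuous_open_vimage continuous_intros)
qed

lemma angles_angle_point: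
  assumes "x \<in> square a b"
  shows "angles a b (angle_point x) = x"
proof -
  have "Arg (cis s * cis (- c)) = s - c" if "\<bar>s - c\<bar> < pi / 2" for s c
  proof -
    have "s - c \<in> {-pi<..pi}" using that by (simp only: abs_less_iff) (use pi_gt_zero in \<open>simp; linarith\<close>)
    then show ?thesis by (simp add: cis_mult Arg_cis)
  qed
  then show ?thesis
    using assms by (simp add: angles_def angle_point_def square_def eq_vec2_iff)
qed

lemma angle_point_in_patch:
  assumes "x \<in> square a b"
  shows "angle_point x \<in> patch a b"
proof -
  have "Re (cis s * cis (- c)) > 0" if "\<bar>s - c\<bar> < pi / 2" for s c
  proof -
    have "0 < cos (s - c)" using that by (intro cos_gt_zero_pi) linarith+
    then show ?thesis by (simp add: cis_mult)
  qed
  then show ?thesis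
    using assms by (auto simp: patch_def square_def) (auto simp: angle_point_def)
qed

lemma angles_in_square:
  assumes "q \<in> patch a b"
  shows "angles a b q \<in> square a b" "angle_point (angles a b q) = q"
proof -
  have 1: "\<bar>Arg (z * cis (- c))\<bar> < pi / 2" if "Re (z * cis (- c)) > 0" for z c
    using that Arg_Re_pos by blast
  show "angles a b q \<in> square a b"
    using assms 1[of "fst q" a] 1[of "snd q" b] by (simp add: angles_def square_def patch_def)
  have 2: "cis (c + Arg (z * cis (- c))) = z" if "norm z = 1" for z c
  proof -
    have "z * cis (- c) \<noteq> 0" using that by auto
    then have "cis (Arg (z * cis (- c))) = z * cis (- c)"
      using that by (simp add: cis_Arg sgn_div_norm norm_mult)
    then have "cis (c + Arg (z * cis (- c))) = cis c * (z * cis (- c))"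
      by (simp add: cis_mult[symmetric])
    also have "\<dots> = z" by (simp add: cis_mult mult.left_commute)
    finally show ?thesis .
  qed
  show "angle_point (angles a b q) = q"
    using assms by (auto simp: angle_point_def angles_def patch_def torus_def 2)
qed

lemma angles_image_patch: "angles a b ` patch a b = square a b"
  using angles_in_square angles_angle_point angle_point_in_patch
  by (auto simp: image_iff) metis

lemma inj_on_angles: "inj_on (angles a b) (patch a b)"
  by (metis angles_in_square(2) inj_onI)

lemma inv_into_angles:
  "x \<in> square a b \<Longrightarrow> inv_into (patch a b) (angles a b) x = angle_point x"
  by (metis angle_point_in_patch angles_angle_point inj_on_angles inv_into_f_f)

lemma openin_patch: "openin (top_of_set torus) (patch a b)"
proof -
  have "open {q::complex \<times> complex. Re (fst q * cis (- a)) > 0 \<and> Re (snd q * cis (- b)) > 0}"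
    by (intro open_Collect_conj open_Collect_less continuous_intros)
  then show ?thesis
    by (auto simp: openin_open patch_def)
qed

lemma continuous_on_angles: "continuous_on (patch a b) (angles a b)"
proof -
  have 1: "z * cis (- c) \<notin> \<real>\<^sub>\<le>\<^sub>0" if "Re (z * cis (- c)) > 0" for z c
    using that by (auto simp: complex_nonpos_Reals_iff)
  have eq: "angles a b = (\<lambda>q. \<chi> i. if i = 1 then a + Arg (fst q * cis (- a))
      else b + Arg (snd q * cis (- b)))"
    by (rule ext) (simp add: angles_def eq_vec2_iff)
  have "continuous_on (patch a b) (\<lambda>q. if i = 1 then a + Arg (fst q * cis (- a))
      else b + Arg (snd q * cis (- b)))" for i :: 2
    by (cases "i = 1") (auto intro!: continuous_intros simp: patch_def 1)
  then show ?thesis unfolding eq by (intro continuous_on_vec_lambda)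
qed

lemma is_chart_angles: "is_chart (top_of_set torus) (patch a b, angles a b)"
proof -
  have "homeomorphic_maps (top_of_set (patch a b)) (top_of_set (square a b)) (angles a b) angle_point"
    by (auto simp: homeomorphic_maps_def continuous_on_angles continuous_on_angle_point
        angles_in_square angles_angle_point angle_point_in_patch)
  then have "homeomorphic_map (top_of_set (patch a b)) (top_of_set (square a b)) (angles a b)"
    by (rule homeomorphic_maps_imp_map)
  moreover have "torus \<inter> patch a b = patch a b"
    by (auto simp: patch_def)
  ultimately show ?thesis
    by (simp add: is_chart_def openin_patch open_square angles_image_patch subtopology_subtopology)
qed

lemma torus_point_angle:
  assumes "q \<in> torus"
  obtains x where "q = angle_point x" "0 \<le> x $ 1" "x $ 1 < 2 * pi" "0 \<le> x $ 2" "x $ 2 < 2 * pi"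
proof -
  have 1: "cis (Arg2pi z) = z" if "norm z = 1" for z
    using that complex_norm_eq_1_exp[of z] by (simp add: cis_conv_exp)
  show ?thesis
    by (rule that[of "vector [Arg2pi (fst q), Arg2pi (snd q)]"])
       (use assms Arg2pi 1 in \<open>auto simp: angle_point_def torus_def\<close>)
qed

text \<open>Rounding moves a coordinate by at most 1/2 < pi / 2, so integer centres suffice. The
  countable cover obtained this way later determines the volume measure.\<close>

lemma torus_covered:
  assumes "q \<in> torus"
  obtains m n :: int where "q \<in> patch (of_int m) (of_int n)"
proof -
  obtain x where x: "q = angle_point x"
    using torus_point_angle[OF assms] by blast
  have "\<bar>s - of_int (round s)\<bar> < pi / 2" for s :: real
    using of_int_round_abs_le[of s] pi_gt3 by (simp add: abs_minus_commute)
  then have "x \<in> square (of_int (round (x $ 1))) (of_int (round (x $ 2)))"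
    by (simp add: square_def)
  then show ?thesis
    using angle_point_in_patch that x by blast
qed

lemma Un_patch: "(\<Union>c\<in>torus_atlas. fst c) = torus"
proof
  show "torus \<subseteq> (\<Union>c\<in>torus_atlas. fst c)"
    by (rule subsetI, erule torus_covered) (auto simp: torus_atlas_def)
qed (auto simp: torus_atlas_def patch_def)

text \<open>Passing from one translate to the other costs four half sides, in total less than 2 * pi
  in each coordinate, hence less than one period.\<close>

lemma square_lattice_unique:
  assumes "x \<in> square a b" "x + lattice k \<in> square a' b'"
    and "y \<in> square a b" "y + lattice l \<in> square a' b'"
  shows "k = l"
proof -
  have 1: "m = n" if "\<bar>s - a\<bar> < pi / 2" "\<bar>s + 2 * pi * of_int m - a'\<bar> < pi / 2"
    "\<bar>t - a\<bar> < pi / 2" "\<bar>t + 2 * pi * of_int n - a'\<bar> < pi / 2" for s t a a' :: real and m n :: int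
  proof -
    have "\<bar>2 * pi * of_int m - 2 * pi * of_int n\<bar> < 2 * pi"
      using that by linarith
    then have "2 * pi * \<bar>of_int m - of_int n\<bar> < 2 * pi * 1"
      by (simp add: abs_mult right_diff_distrib[symmetric])
    then have "\<bar>of_int (m - n)\<bar> < (1::real)"
      by simp
    then have "\<bar>m - n\<bar> < 1" by linarith
    then show ?thesis by simp
  qed
  show ?thesis
    using 1[of "x $ 1" a _ a' "y $ 1"] 1[of "x $ 2" b _ b' "y $ 2"] assms
    by (auto simp: square_def prod_eq_iff)
qed

lemma patch_Int_image:
  assumes "x \<in> angles a b ` (patch a b \<inter> patch a' b')"
  shows "x \<in> square a b" "angle_point x \<in> patch a' b'"
  using assms angles_in_square by auto

text \<open>The squares have side \<open>pi\<close>, half a period, so the lattice vector is the same on the whole overlap.\<close>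
lemma transition_eq_translation:
  assumes "angles a b ` (patch a b \<inter> patch a' b') \<noteq> {}"
  obtains k where "\<And>x. x \<in> angles a b ` (patch a b \<inter> patch a' b') \<Longrightarrow>
    transition (patch a b, angles a b) (patch a' b', angles a' b') x = x + lattice k"
proof -
  have ex: "\<exists>k. x + lattice k \<in> square a' b' \<and>
      transition (patch a b, angles a b) (patch a' b', angles a' b') x = x + lattice k"
    if "x \<in> angles a b ` (patch a b \<inter> patch a' b')" for x
  proof -
    note x = patch_Int_image[OF that]
    obtain k where "angles a' b' (angle_point x) = x + lattice k"
      using angles_in_square(2)[OF x(2)] angle_point_eq_iff by blast
    then show ?thesis
      using x angles_in_square(1)[OF x(2)]
      by (intro exI[of _ k]) (simp add: transition_def inv_into_angles)
  qed
  obtain x0 k where x0: "x0 \<in> angles a b ` (patch a b \<inter> patch a' b')"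
    and k: "x0 + lattice k \<in> square a' b'"
    using assms ex by blast
  show ?thesis
  proof
    fix x assume x: "x \<in> angles a b ` (patch a b \<inter> patch a' b')"
    then obtain l where "x + lattice l \<in> square a' b'"
      "transition (patch a b, angles a b) (patch a' b', angles a' b') x = x + lattice l"
      using ex by blast
    then show "transition (patch a b, angles a b) (patch a' b', angles a' b') x = x + lattice k"
      using square_lattice_unique[of x a b l a' b' x0 k] patch_Int_image x x0 k by metis
  qed
qed

lemma open_angles_image: "open (angles a b ` (patch a b \<inter> patch a' b'))"
proof -
  have "angles a b ` (patch a b \<inter> patch a' b') = square a b \<inter> angle_point -` patch a' b'"
    by (auto simp: angles_in_square image_iff)
       (metis IntI angle_point_in_patch angles_angle_point)
  also have "open \<dots>"
  proof -
    have "\<exists>T. open T \<and> patch a' b' = torus \<inter> T"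
      using openin_patch by (simp add: openin_open)
    then obtain T where T: "open T" "patch a' b' = torus \<inter> T" by blast
    then have "angle_point -` patch a' b' = angle_point -` T"
      by (simp add: vimage_def)
    then show ?thesis
      using T(1) continuous_on_angle_point[of UNIV] open_square
      by (auto intro!: open_Int continuous_open_vimage simp: continuous_on_eq_continuous_at)
  qed
  finally show ?thesis .
qed

section \<open>Metrics whose coefficients depend on the first angle only\<close>

definition diagonal_metric :: "(real \<Rightarrow> real) \<Rightarrow> (real \<Rightarrow> real) \<Rightarrow> real^2 \<Rightarrow> real^2^2" where
  "diagonal_metric A B x = (\<chi> i j. if i \<noteq> j then 0 else if i = 1 then A (x $ 1) else B (x $ 1))"

text \<open>One matrix function can serve all charts: the transition maps are lattice translations,
  which preserve it when \<open>A\<close> and \<open>B\<close> have period 2 * pi.\<close>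

definition warped_torus :: "(real \<Rightarrow> real) \<Rightarrow> (real \<Rightarrow> real) \<Rightarrow> surface" where
  "warped_torus A B =
     \<lparr>mtop = top_of_set torus, atlas = torus_atlas, metric = (\<lambda>c. diagonal_metric A B)\<rparr>"

lemma warped_torus_simps [simp]:
  "mtop (warped_torus A B) = top_of_set torus"
  "atlas (warped_torus A B) = torus_atlas"
  "metric (warped_torus A B) c = diagonal_metric A B"
  by (simp_all add: warped_torus_def)

lemma diagonal_metric_nth [simp]:
  "diagonal_metric A B x $ 1 $ 1 = A (x $ 1)" "diagonal_metric A B x $ 2 $ 2 = B (x $ 1)"
  "diagonal_metric A B x $ 1 $ 2 = 0" "diagonal_metric A B x $ 2 $ 1 = 0"
  by (simp_all add: diagonal_metric_def)

lemma smooth_atlas_warped_torus: "smooth_atlas (warped_torus A B)"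
proof -
  have "smooth_on (angles a b ` (patch a b \<inter> patch a' b'))
      (transition (patch a b, angles a b) (patch a' b', angles a' b'))" for a b a' b'
  proof (cases "angles a b ` (patch a b \<inter> patch a' b') = {}")
    \<comment> \<open>Disjoint patches provide no lattice vector, but smoothness on the empty set is
      vacuous.\<close>
    case True
    have "Ck_on k {} f" for k and f :: "real^2 \<Rightarrow> real^2"
      by (induction k arbitrary: f) auto
    then show ?thesis unfolding smooth_on_def True by blast
  next
    case False
    note op = open_angles_image[of a b a' b']
    obtain k where k: "\<And>x. x \<in> angles a b ` (patch a b \<inter> patch a' b') \<Longrightarrow>
      transition (patch a b, angles a b) (patch a' b', angles a' b') x = x + lattice k"
      using transition_eq_translation[OF False] by blast
    have "Ck_on n (angles a b ` (patch a b \<inter> patch a' b')) (\<lambda>x. x + lattice k)" for n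
      by (intro Ck_on_add op Ck_on_const Ck_on_bounded_linear) simp
    then show ?thesis
      unfolding smooth_on_def using Ck_on_cong[OF op] k by metis
  qed
  then show ?thesis
    using is_chart_angles by (simp add: smooth_atlas_def Un_patch) (auto simp: torus_atlas_def)
qed

lemma torus_topology:
  "torus \<noteq> {}" "compact torus" "connected torus"
proof -
  show "torus \<noteq> {}" by (auto simp: torus_def)
  show "compact torus" by (simp add: torus_def compact_Times)
  show "connected torus"
    unfolding torus_def by (intro connected_Times connected_sphere) simp_all
qed

locale smooth_warped_torus =
  fixes A B :: "real \<Rightarrow> real"
  assumes smooth_A: "smooth_on UNIV (\<lambda>x::real^2. A (x $ 1))"
    and smooth_B: "smooth_on UNIV (\<lambda>x::real^2. B (x $ 1))"
    and A_pos: "A t > 0" and B_pos: "B t > 0"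
    and A_periodic: "A (t + 2 * pi) = A t" and B_periodic: "B (t + 2 * pi) = B t"
begin

abbreviation M :: surface where "M \<equiv> warped_torus A B"

lemma metric_lattice: "diagonal_metric A B (x + lattice k) = diagonal_metric A B x"
  using periodic_int[of A] periodic_int[of B] A_periodic B_periodic
  by (simp add: vec_eq_iff forall_2)

lemma smooth_on_diagonal_metric: 
  assumes "open S"
  shows "smooth_on S (diagonal_metric A B)"
proof -
  define E :: "2 \<Rightarrow> real^2^2" where "E k = (\<chi> i j. if i = k \<and> j = k then 1 else 0)" for k
  have eq: "diagonal_metric A B = (\<lambda>x. A (x $ 1) *\<^sub>R E 1 + B (x $ 1) *\<^sub>R E 2)"
    by (rule ext) (simp add: vec_eq_iff forall_2 E_def)
  have "Ck_on k S (\<lambda>x. A (x $ 1))" "Ck_on k S (\<lambda>x. B (x $ 1))" for k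
    using smooth_A smooth_B by (auto simp: smooth_on_def intro: Ck_on_subset[OF _ subset_UNIV])
  then show ?thesis
    unfolding smooth_on_def eq using assms
    by (intro allI Ck_on_add Ck_on_scaleR Ck_on_const) auto
qed

lemma smooth_metric_warped_torus: "smooth_metric M"
proof -
  have pos: "v \<bullet> (diagonal_metric A B x *v v) > 0" if "v \<noteq> 0" for x v
  proof -
    have "v \<bullet> (diagonal_metric A B x *v v) = A (x $ 1) * (v $ 1)\<^sup>2 + B (x $ 1) * (v $ 2)\<^sup>2"
      by (simp add: inner_vec_def matrix_vector_mult_def sum_2 power2_eq_square)
    moreover have "v $ 1 \<noteq> 0 \<or> v $ 2 \<noteq> 0"
      using that by (auto simp: eq_vec2_iff)
    ultimately show ?thesis
      using A_pos[of "x $ 1"] B_pos[of "x $ 1"]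
      by (metis add_nonneg_pos add_pos_nonneg less_imp_le mult_nonneg_nonneg mult_pos_pos
          zero_le_power2 zero_less_power2)
  qed
  have sym: "transpose (diagonal_metric A B x) = diagonal_metric A B x" for x
    by (auto simp: transpose_def diagonal_metric_def vec_eq_iff)
  have comp: "let J = matrix (frechet_derivative (transition (patch a b, angles a b) (patch a' b', angles a' b')) (at x))
        in diagonal_metric A B x = transpose J ** diagonal_metric A B (transition (patch a b, angles a b) (patch a' b', angles a' b') x) ** J"
    if x: "x \<in> angles a b ` (patch a b \<inter> patch a' b')" for a b a' b' x
  proof -
    obtain k where k: "\<And>x. x \<in> angles a b ` (patch a b \<inter> patch a' b') \<Longrightarrow>
      transition (patch a b, angles a b) (patch a' b', angles a' b') x = x + lattice k"
      using transition_eq_translation x by (metis empty_iff)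
    have "((\<lambda>x. x + lattice k) has_derivative (\<lambda>v. v)) (at x)"
      by (auto intro!: derivative_eq_intros)
    then have "(transition (patch a b, angles a b) (patch a' b', angles a' b') has_derivative (\<lambda>v. v)) (at x)"
      by (rule has_derivative_transform_within_open[OF _ open_angles_image x]) (simp add: k)
    moreover have "matrix (\<lambda>v::real^2. v) = mat 1"
      using matrix_id_mat_1 by (simp add: id_def)
    ultimately show ?thesis
      by (simp add: frechet_derivative_at[symmetric] k[OF x] metric_lattice transpose_mat Let_def)
  qed
  show ?thesis
    unfolding smooth_metric_def
    using comp by (auto simp: torus_atlas_def angles_image_patch sym pos
        intro!: smooth_on_diagonal_metric open_square)
qed

lemma closed_connected_warped_torus: "closed_connected_riemannian M"
  using torus_topology smooth_metric_warped_torus smooth_atlas_warped_torus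
  by (auto simp: closed_connected_riemannian_def compact_space_subtopology
      connected_space_subtopology Hausdorff_space_subtopology)

text \<open>\<open>chart_at\<close> is an unspecified choice, so only the shape of the chart is
  known. Later computations take place in a chart with unknown centre and are carried back by a
  lattice translation.\<close>

lemma chart_at_torus:
  assumes "q \<in> torus"
  obtains a b where "chart_at M q = (patch a b, angles a b)" "q \<in> patch a b"
proof -
  have "\<exists>c. c \<in> torus_atlas \<and> q \<in> fst c"
    using assms Un_patch by blast
  then have "chart_at M q \<in> torus_atlas \<and> q \<in> fst (chart_at M q)"
    unfolding chart_at_def warped_torus_simps by (rule someI_ex)
  then show ?thesis
    using that by (auto simp: torus_atlas_def)
qed

end

section \<open>Laplacian and curvature\<close>

context smooth_warped_torus
begin

text \<open>Writing (g^11, g^22) for the inverse metric, \<open>T\<close> is sqrt (det g) * g^11 and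
  \<open>1 / T\<close> is sqrt (det g) * g^22. That these are reciprocal reflects the conformal
  invariance of the Dirichlet energy in dimension two.\<close>

definition T :: "real \<Rightarrow> real" where "T t = sqrt (B t / A t)"

definition w :: "real \<Rightarrow> real" where "w t = sqrt (A t * B t)"

lemma T_pos: "T t > 0" and w_pos: "w t > 0"
  using A_pos[of t] B_pos[of t] by (auto simp: T_def w_def)

lemma T_periodic: "T (t + 2 * pi) = T t" and w_periodic: "w (t + 2 * pi) = w t"
  by (simp_all add: T_def w_def A_periodic B_periodic)

lemma w_div_A: "w t / A t = T t" and w_div_B: "w t / B t = 1 / T t"
proof -
  have "w t = sqrt (B t / A t * (A t)\<^sup>2)"
    using A_pos[of t] by (simp add: w_def power2_eq_square mult.commute)
  then have "w t = T t * A t"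
    unfolding T_def real_sqrt_mult using A_pos[of t] by simp
  then show "w t / A t = T t" using A_pos[of t] by simp
  have "w t * T t = B t"
    using A_pos[of t] B_pos[of t]
    by (simp add: w_def T_def real_sqrt_divide real_sqrt_mult)
  then show "w t / B t = 1 / T t"
    using B_pos[of t] T_pos[of t] by (simp add: field_simps)
qed

lemma matrix_inv_diagonal:
  "matrix_inv (diagonal_metric A B x) = diagonal_metric (\<lambda>t. inverse (A t)) (\<lambda>t. inverse (B t)) x"
proof (rule matrix_inv_unique)
  show "diagonal_metric A B x ** diagonal_metric (\<lambda>t. inverse (A t)) (\<lambda>t. inverse (B t)) x = mat 1"
    "diagonal_metric (\<lambda>t. inverse (A t)) (\<lambda>t. inverse (B t)) x ** diagonal_metric A B x = mat 1"
    using A_pos[of "x $ 1"] B_pos[of "x $ 1"]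
    by (simp_all add: vec_eq_iff forall_2 matrix_matrix_mult_def sum_2 mat_def)
qed

lemma sqrt_det_diagonal: "sqrt (det (diagonal_metric A B x)) = w (x $ 1)"
  by (simp add: det_2 w_def)

lemma in_chart_angles: "x \<in> square a b \<Longrightarrow> in_chart (patch a b, angles a b) u x = u (angle_point x)"
  by (simp add: in_chart_def inv_into_angles)

text \<open>Transfers the analysis to doubly periodic functions on the plane: in the chart centred
  at a given point, \<open>u\<close> is represented by \<open>u \<circ> angle_point\<close>.\<close>

lemma smooth_function_iff:
  "smooth_function M u \<longleftrightarrow> smooth_on UNIV (u \<circ> angle_point)"
proof
  assume u: "smooth_function M u"
  have "Ck_on k UNIV (u \<circ> angle_point)" for k
  proof (rule Ck_on_local)
    fix x :: "real^2"
    let ?S = "square (x $ 1) (x $ 2)"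
    have "Ck_on k ?S (in_chart (patch (x $ 1) (x $ 2), angles (x $ 1) (x $ 2)) u)"
      using u by (force simp: smooth_function_def torus_atlas_def smooth_on_def angles_image_patch)
    then have "Ck_on k ?S (u \<circ> angle_point)"
      by (rule Ck_on_cong[OF open_square, rotated]) (simp_all add: in_chart_angles)
    then show "\<exists>S. open S \<and> x \<in> S \<and> Ck_on k S (u \<circ> angle_point)"
      using open_square by (intro exI[of _ ?S]) (auto simp: square_def)
  qed
  then show "smooth_on UNIV (u \<circ> angle_point)"
    by (simp add: smooth_on_def)
next
  assume "smooth_on UNIV (u \<circ> angle_point)"
  then have "Ck_on k (square a b) (u \<circ> angle_point)" for k a b
    by (auto simp: smooth_on_def intro: Ck_on_subset[OF _ subset_UNIV])
  then have "Ck_on k (square a b) (in_chart (patch a b, angles a b) u)" for k a b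
    by (rule Ck_on_cong[OF open_square, rotated]) (simp_all add: in_chart_angles)
  then show "smooth_function M u"
    by (auto simp: smooth_function_def torus_atlas_def smooth_on_def angles_image_patch)
qed

text \<open>The chosen chart shows the point at \<open>x + lattice k\<close>. All functions involved
  are lattice periodic, so their derivatives there equal those at x.\<close>

lemma laplacian_angle_point:
  fixes u
  defines "U \<equiv> u \<circ> angle_point"
  shows "laplacian M u (angle_point x) =
    (partial 1 (\<lambda>y. T (y $ 1) * partial 1 U y) x + partial 2 (\<lambda>y. partial 2 U y / T (y $ 1)) x)
      / w (x $ 1)"
proof -
  obtain a b where ch: "chart_at M (angle_point x) = (patch a b, angles a b)"
    and q: "angle_point x \<in> patch a b"
    using chart_at_torus angle_point_in_torus by blast
  define x' where "x' = angles a b (angle_point x)"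
  let ?u = "in_chart (patch a b, angles a b) u"
  have x': "x' \<in> square a b" "angle_point x' = angle_point x"
    using angles_in_square[OF q] by (auto simp: x'_def)
  obtain k where k: "x' = x + lattice k"
    using x'(2) angle_point_eq_iff by blast
  \<comment> \<open>Agreement on the whole open square, not just at the point, allows a second
    differentiation.\<close>
  have p: "partial i ?u y = partial i U y" if "y \<in> square a b" for i y
    by (rule partial_cong[OF open_square that]) (simp add: U_def in_chart_angles)
  have grad: "coord_grad (diagonal_metric A B) ?u y $ 1 = inverse (A (y $ 1)) * partial 1 U y"
    "coord_grad (diagonal_metric A B) ?u y $ 2 = inverse (B (y $ 1)) * partial 2 U y"
    if "y \<in> square a b" for y
    by (simp_all add: coord_grad_def matrix_inv_diagonal matrix_vector_mult_def sum_2 p[OF that])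
  have "laplacian M u (angle_point x) =
     (partial 1 (\<lambda>y. w (y $ 1) * coord_grad (diagonal_metric A B) ?u y $ 1) x' +
      partial 2 (\<lambda>y. w (y $ 1) * coord_grad (diagonal_metric A B) ?u y $ 2) x') / w (x' $ 1)"
    by (simp add: laplacian_def ch x'_def Let_def coord_div_def sqrt_det_diagonal sum_2)
  also have "partial 1 (\<lambda>y. w (y $ 1) * coord_grad (diagonal_metric A B) ?u y $ 1) x' =
      partial 1 (\<lambda>y. T (y $ 1) * partial 1 U y) x'"
    by (rule partial_cong[OF open_square x'(1)])
       (simp add: grad w_div_A[symmetric] divide_inverse)
  also have "partial 2 (\<lambda>y. w (y $ 1) * coord_grad (diagonal_metric A B) ?u y $ 2) x' =
      partial 2 (\<lambda>y. partial 2 U y / T (y $ 1)) x'"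
  proof (rule partial_cong[OF open_square x'(1)])
    show "w (y $ 1) * coord_grad (diagonal_metric A B) ?u y $ 2 = partial 2 U y / T (y $ 1)"
      if "y \<in> square a b" for y
    proof -
      have "w (y $ 1) * coord_grad (diagonal_metric A B) ?u y $ 2 = w (y $ 1) / B (y $ 1) * partial 2 U y"
        by (simp add: grad[OF that] divide_inverse)
      then show ?thesis by (simp add: w_div_B)
    qed
  qed
  also have "w (x' $ 1) = w (x $ 1)"
    using periodic_int[of w] w_periodic by (simp add: k)
  finally have "laplacian M u (angle_point x) = (partial 1 (\<lambda>y. T (y $ 1) * partial 1 U y) x' +
      partial 2 (\<lambda>y. partial 2 U y / T (y $ 1)) x') / w (x $ 1)" .
  moreover have U: "U (y + lattice k) = U y" and T: "T ((y + lattice k) $ 1) = T (y $ 1)" for y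
    using periodic_int[of T] T_periodic by (simp_all add: U_def)
  have "partial i U (y + lattice k) = partial i U y" for i y
    by (rule partial_periodic) (rule U)
  then have "partial 1 (\<lambda>y. T (y $ 1) * partial 1 U y) x' = partial 1 (\<lambda>y. T (y $ 1) * partial 1 U y) x"
    "partial 2 (\<lambda>y. partial 2 U y / T (y $ 1)) x' = partial 2 (\<lambda>y. partial 2 U y / T (y $ 1)) x"
    unfolding k by (intro partial_periodic; simp only: T)+
  ultimately show ?thesis by simp
qed

end

locale warped_torus_derivs = smooth_warped_torus +
  fixes A' A'' B' B'' :: "real \<Rightarrow> real"
  assumes A_deriv: "(A has_real_derivative A' t) (at t)"
    and B_deriv: "(B has_real_derivative B' t) (at t)"
    and B'_deriv: "(B' has_real_derivative B'' t) (at t)"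
    and A'_deriv: "(A' has_real_derivative A'' t) (at t)"
begin

definition T' :: "real \<Rightarrow> real" where
  "T' t = (B' t * A t - B t * A' t) / (A t * A t) * (inverse (T t) / 2)"

lemma T_deriv: "(T has_real_derivative T' t) (at t)"
proof -
  have "B t / A t > 0" using A_pos B_pos by simp
  then show ?thesis
    unfolding T_def[abs_def] T'_def using A_pos[of t]
    by (auto intro!: derivative_eq_intros A_deriv B_deriv simp: mult_ac)
qed

lemma continuous_coeffs:
  "continuous_on S A" "continuous_on S B" "continuous_on S T" "continuous_on S w" "continuous_on S T'"
proof -
  have d: "isCont A t" "isCont B t" "isCont A' t" "isCont B' t" "isCont T t" for t
    using A_deriv B_deriv A'_deriv B'_deriv T_deriv DERIV_isCont by blast+
  then show A: "continuous_on S A" and B: "continuous_on S B" and T: "continuous_on S T"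
    by (simp_all add: continuous_at_imp_continuous_on)
  show "continuous_on S w" 
    unfolding w_def[abs_def] by (intro continuous_intros A B)
  have A': "continuous_on S A'" and B': "continuous_on S B'"
    using d by (simp_all add: continuous_at_imp_continuous_on)
  show "continuous_on S T'"
    unfolding T'_def[abs_def] using A_pos T_pos
    by (intro continuous_intros A B A' B' T) (auto simp: less_imp_neq[symmetric])
qed

text \<open>The product rule applied to the divergence form yields the pointwise equation required
  by \<open>fibre_constant_solution\<close>.\<close>

lemma laplacian_smooth:
  assumes "smooth_function M u"
  defines "U \<equiv> u \<circ> angle_point"
  shows "laplacian M u (angle_point x) * w (x $ 1) =
    T' (x $ 1) * partial 1 U x + T (x $ 1) * partial 1 (partial 1 U) x
      + partial 2 (partial 2 U) x / T (x $ 1)"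
proof -
  have U: "Ck_on k UNIV U" for k
    using assms by (simp add: smooth_function_iff smooth_on_def U_def)
  have d: "(partial i U has_derivative frechet_derivative (partial i U) (at x)) (at x)" for i
    using U[of "Suc (Suc 0)"] by (simp add: partial_def[abs_def] frechet_derivative_works[symmetric])
  have "partial 1 (\<lambda>y. T (y $ 1) * partial 1 U y) x =
     T (x $ 1) * partial 1 (partial 1 U) x + T' (x $ 1) * partial 1 U x"
    using has_derivative_imp_partial[OF has_derivative_mult[OF has_derivative_component[OF T_deriv] d[of 1]], of 1]
    by (simp add: partial_def[of 1 "partial 1 U"])
  moreover
  have "((\<lambda>t. inverse (T t)) has_real_derivative - (inverse (T (x $ 1)) * T' (x $ 1) * inverse (T (x $ 1)))) (at (x $ 1))"
    using T_pos[of "x $ 1"] by (auto intro!: DERIV_inverse' T_deriv)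
  note has_derivative_imp_partial[OF has_derivative_mult[OF d[of 2] has_derivative_component[OF this]], of 2]
  then have "partial 2 (\<lambda>y. partial 2 U y / T (y $ 1)) x = partial 2 (partial 2 U) x / T (x $ 1)"
    by (simp add: partial_def[of 2 "partial 2 U"] divide_inverse axis_def)
  ultimately show ?thesis
    using w_pos[of "x $ 1"] unfolding U_def by (simp add: laplacian_angle_point)
qed

text \<open>The classical formula - (B' / w)' / (2 w) for the Gauss curvature of A dt^2 + B dy^2,
  expanded so that no square root remains.\<close>

definition gauss_curvature :: "real \<Rightarrow> real" where
  "gauss_curvature t =
     - (B'' t - (B' t)\<^sup>2 / (2 * B t) - A' t * B' t / (2 * A t)) / (2 * A t * B t)"

lemma partial_metric:
  "partial i (\<lambda>y. A (y $ 1)) x = (if i = 1 then A' (x $ 1) else 0)"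
  "partial i (\<lambda>y. B (y $ 1)) x = (if i = 1 then B' (x $ 1) else 0)"
  "partial i (\<lambda>y. 0) x = 0"
  by (rule partial_component A_deriv B_deriv has_derivative_imp_partial[OF has_derivative_const])+

lemma christoffel_diagonal:
  "christoffel (diagonal_metric A B) x 1 1 1 = A' (x $ 1) / (2 * A (x $ 1))"
  "christoffel (diagonal_metric A B) x 1 1 2 = 0"
  "christoffel (diagonal_metric A B) x 1 2 1 = 0"
  "christoffel (diagonal_metric A B) x 1 2 2 = - B' (x $ 1) / (2 * A (x $ 1))"
  "christoffel (diagonal_metric A B) x 2 1 1 = 0"
  "christoffel (diagonal_metric A B) x 2 1 2 = B' (x $ 1) / (2 * B (x $ 1))"
  "christoffel (diagonal_metric A B) x 2 2 1 = B' (x $ 1) / (2 * B (x $ 1))"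
  "christoffel (diagonal_metric A B) x 2 2 2 = 0"
  by (simp_all add: christoffel_def sum_2 partial_metric matrix_inv_diagonal inverse_eq_divide)

lemma ricci_diagonal:
  "ricci (diagonal_metric A B) x = gauss_curvature (x $ 1) *\<^sub>R diagonal_metric A B x"
proof -
  define t where "t = x $ 1"
  have pos: "A t > 0" "B t > 0" using A_pos B_pos by auto
  have "((\<lambda>t. B' t / (2 * B t)) has_real_derivative
      (B'' t * (2 * B t) - B' t * (2 * B' t)) / ((2 * B t) * (2 * B t))) (at t)"
    using pos by (auto intro!: derivative_eq_intros B_deriv B'_deriv)
  then have p1: "partial i (\<lambda>y. B' (y $ 1) / (2 * B (y $ 1))) x =
    (if i = 1 then (B'' t * (2 * B t) - B' t * (2 * B' t)) / ((2 * B t) * (2 * B t)) else 0)" for i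
    unfolding t_def by (rule partial_component)
  have "((\<lambda>t. - B' t / (2 * A t)) has_real_derivative
      (- B'' t * (2 * A t) + B' t * (2 * A' t)) / ((2 * A t) * (2 * A t))) (at t)"
    using pos by (auto intro!: derivative_eq_intros A_deriv B'_deriv simp: field_simps)
  then have p2: "partial i (\<lambda>y. - (B' (y $ 1) / (2 * A (y $ 1)))) x =
    (if i = 1 then (- B'' t * (2 * A t) + B' t * (2 * A' t)) / ((2 * A t) * (2 * A t)) else 0)" for i
    unfolding t_def minus_divide_left by (rule partial_component)
  have "((\<lambda>t. A' t / (2 * A t)) has_real_derivative
      (A'' t * (2 * A t) - A' t * (2 * A' t)) / ((2 * A t) * (2 * A t))) (at t)"
    using pos by (auto intro!: derivative_eq_intros A_deriv A'_deriv)
  from partial_component[OF this[unfolded t_def], of 2]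
  have p2': "partial 2 (\<lambda>y. A' (y $ 1) / (2 * A (y $ 1))) x = 0"
    by simp
  note defs = ricci_def riemann_def sum_2 christoffel_diagonal partial_metric(3) p1 p2 p2' t_def[symmetric] gauss_curvature_def
  have "ricci (diagonal_metric A B) x $ 1 $ 1 = gauss_curvature t * A t"
    using pos by (simp add: defs) (simp add: field_simps power2_eq_square)
  moreover have "ricci (diagonal_metric A B) x $ 2 $ 2 = gauss_curvature t * B t"
    using pos by (simp add: defs) (simp add: field_simps power2_eq_square)
  moreover have "ricci (diagonal_metric A B) x $ 1 $ 2 = 0"
    by (simp add: defs)
  moreover have "ricci (diagonal_metric A B) x $ 2 $ 1 = 0"
    by (simp add: defs)
  ultimately show ?thesis by (simp add: vec_eq_iff forall_2 t_def)
qed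

text \<open>By \<open>ricci_diagonal\<close> every nonzero vector is an eigenvector with the Gauss
  curvature as eigenvalue, and since g is injective there is no other; the \<open>LEAST\<close>
  ranges over a single number.\<close>

lemma rho_angle_point: "rho M (angle_point x) = gauss_curvature (x $ 1)"
proof -
  obtain a b where ch: "chart_at M (angle_point x) = (patch a b, angles a b)"
    and q: "angle_point x \<in> patch a b"
    using chart_at_torus angle_point_in_torus by blast
  obtain k where k: "angles a b (angle_point x) = x + lattice k"
    using angles_in_square(2)[OF q] angle_point_eq_iff by blast
  let ?g = "diagonal_metric A B (x + lattice k)"
  have curv: "gauss_curvature ((x + lattice k) $ 1) = gauss_curvature (x $ 1)"
  proof -
    note A' = derivative_periodic[OF A_periodic A_deriv] and B' = derivative_periodic[OF B_periodic B_deriv]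
    note B'' = derivative_periodic[OF B' B'_deriv]
    have "gauss_curvature (t + 2 * pi) = gauss_curvature t" for t
      by (simp add: gauss_curvature_def A_periodic B_periodic A' B' B'')
    then show ?thesis using periodic_int[of gauss_curvature] by simp
  qed
  have "ricci_eigenvalue M (angle_point x) l \<longleftrightarrow> l = gauss_curvature (x $ 1)" for l
  proof -
    have "?g *v v \<noteq> 0" if "v \<noteq> 0" for v
    proof -
      have "(?g *v v) $ 1 = A ((x + lattice k) $ 1) * v $ 1" "(?g *v v) $ 2 = B ((x + lattice k) $ 1) * v $ 2"
        by (simp_all add: matrix_vector_mult_def sum_2)
      then show ?thesis
        using that A_pos B_pos by (metis eq_vec2_iff less_irrefl mult_eq_0_iff zero_index)
    qed
    moreover have "axis 1 1 \<noteq> (0::real^2)" by simp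
    ultimately show ?thesis
      unfolding ricci_eigenvalue_def
      by (simp add: ch Let_def k ricci_diagonal curv scaleR_matrix_vector_assoc[symmetric] del: vector_add_component)
         blast
  qed
  then have "rho M (angle_point x) = (LEAST l. l = gauss_curvature (x $ 1))"
    by (simp add: rho_def)
  also have "\<dots> = gauss_curvature (x $ 1)"
    by (rule Least_equality) auto
  finally show ?thesis .
qed

end

section \<open>Periodic Sturm-Liouville problems\<close>

text \<open>Cauchy-Schwarz against the constant 1, from the nonnegative integral of (f - m)^2 with m
  the mean of f.\<close>

lemma integral_square_le:
  fixes f :: "real \<Rightarrow> real"
  assumes "a \<le> b" "continuous_on {a..b} f"
  shows "(integral {a..b} f)\<^sup>2 \<le> (b - a) * integral {a..b} (\<lambda>x. (f x)\<^sup>2)"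
proof (cases "a = b")
  case False
  then have ab: "b - a > 0" using assms by simp
  let ?I = "integral {a..b} f"
  define m where "m = ?I / (b - a)"
  have int: "f integrable_on {a..b}" "(\<lambda>x. (f x)\<^sup>2) integrable_on {a..b}"
    "(\<lambda>x. m\<^sup>2 - 2 * m * f x) integrable_on {a..b}" "(\<lambda>x. 2 * m * f x) integrable_on {a..b}"
    using assms(2) by (auto intro!: integrable_continuous_interval continuous_intros)
  have "0 \<le> integral {a..b} (\<lambda>x. (f x - m)\<^sup>2)"
    using assms(2) by (intro integral_nonneg integrable_continuous_interval continuous_intros) auto
  also have "\<dots> = integral {a..b} (\<lambda>x. (f x)\<^sup>2 + (m\<^sup>2 - 2 * m * f x))"
    by (rule integral_cong) (simp add: power2_eq_square algebra_simps)
  also have "\<dots> = integral {a..b} (\<lambda>x. (f x)\<^sup>2) + (m\<^sup>2 * (b - a) - 2 * m * ?I)"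
  proof -
    have "integral {a..b} (\<lambda>x. m\<^sup>2 - 2 * m * f x) = m\<^sup>2 * (b - a) - 2 * m * ?I"
      using integral_diff[OF integrable_const_ivl int(4), of "m\<^sup>2"] assms(1) by simp
    then show ?thesis
      using integral_add[OF int(2,3)] by simp
  qed
  also have "m\<^sup>2 * (b - a) - 2 * m * ?I = - (?I\<^sup>2 / (b - a))"
  proof -
    have "m * (b - a) = ?I" using ab by (simp add: m_def)
    then have "m\<^sup>2 * (b - a) - 2 * m * ?I = - (m * ?I)"
      by (simp add: power2_eq_square mult.assoc)
    then show ?thesis by (simp add: m_def power2_eq_square)
  qed
  finally show ?thesis using ab by (simp add: field_simps)
qed simp

text \<open>A one-dimensional Sobolev estimate: the fundamental theorem followed by Cauchy-Schwarz
  on the interval between the two points.\<close>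

lemma increment_square_le:
  fixes f :: "real \<Rightarrow> real"
  assumes "\<And>t. t \<in> {a..b} \<Longrightarrow> (f has_real_derivative f' t) (at t)"
    and "continuous_on {a..b} f'" "x \<in> {a..b}" "y \<in> {a..b}"
  shows "(f x - f y)\<^sup>2 \<le> (b - a) * integral {a..b} (\<lambda>t. (f' t)\<^sup>2)"
proof -
  have main: "(f x - f y)\<^sup>2 \<le> (b - a) * integral {a..b} (\<lambda>t. (f' t)\<^sup>2)"
    if "x \<in> {a..b}" "y \<in> {a..b}" "y \<le> x" for x y
  proof -
    have sub: "{y..x} \<subseteq> {a..b}" using that by auto
    have c: "continuous_on {y..x} f'"
      using assms(2) sub continuous_on_subset by blast
    have i: "(\<lambda>t. (f' t)\<^sup>2) integrable_on {a..b}" "(\<lambda>t. (f' t)\<^sup>2) integrable_on {y..x}"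
      using assms(2) c by (auto intro!: integrable_continuous_interval continuous_intros)
    have "(f' has_integral f x - f y) {y..x}"
      using that(3) sub assms(1)
      by (intro fundamental_theorem_of_calculus)
         (auto simp: has_real_derivative_iff_has_vector_derivative[symmetric] intro: has_field_derivative_at_within)
    then have "(f x - f y)\<^sup>2 = (integral {y..x} f')\<^sup>2"
      by (simp add: integral_unique)
    also have "\<dots> \<le> (x - y) * integral {y..x} (\<lambda>t. (f' t)\<^sup>2)"
      by (rule integral_square_le[OF that(3) c])
    also have "\<dots> \<le> (b - a) * integral {a..b} (\<lambda>t. (f' t)\<^sup>2)"
      using that i sub by (intro mult_mono integral_subset_le integral_nonneg) auto
    finally show ?thesis .
  qed
  show ?thesis
    using main[OF assms(3,4)] main[OF assms(4,3)] by (cases "y \<le> x") (auto simp: power2_commute)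
qed

text \<open>The primitive of f vanishes at both ends, so by Rolle f has a zero, and the increments
  of f from that zero are under control. The constant is not sharp; it is the source of the factor
  (2 * pi)^2 in the smallness conditions below.\<close>

lemma poincare_mean_zero:
  fixes f :: "real \<Rightarrow> real"
  assumes "a < b" "\<And>t. t \<in> {a..b} \<Longrightarrow> (f has_real_derivative f' t) (at t)"
    and "continuous_on {a..b} f'" "integral {a..b} f = 0"
  shows "integral {a..b} (\<lambda>t. (f t)\<^sup>2) \<le> (b - a)\<^sup>2 * integral {a..b} (\<lambda>t. (f' t)\<^sup>2)"
proof -
  have cf: "continuous_on {a..b} f"
    using assms(2) by (meson DERIV_isCont continuous_at_imp_continuous_on)
  obtain c where c: "c \<in> {a..b}" "f c = 0"
  proof -
    let ?F = "\<lambda>x. integral {a..x} f"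
    have d: "(?F has_real_derivative f x) (at x within {a..b})" if "x \<in> {a..b}" for x
      by (rule integral_has_real_derivative[OF cf that])
    have "\<exists>z. a < z \<and> z < b \<and> (*) (f z) = (\<lambda>v. 0)"
    proof (rule Rolle_deriv[OF assms(1)])
      show "continuous_on {a..b} ?F"
        using d DERIV_continuous by (force simp: continuous_on_eq_continuous_within)
      show "(?F has_derivative (*) (f x)) (at x)" if "a < x" "x < b" for x
        using d[of x] that at_within_Icc_at[of a x b] by (simp add: has_field_derivative_def)
    qed (use assms(4) in simp)
    then show ?thesis using that by (metis atLeastAtMost_iff less_imp_le mult.right_neutral)
  qed
  have "(f t)\<^sup>2 \<le> (b - a) * integral {a..b} (\<lambda>t. (f' t)\<^sup>2)" if "t \<in> {a..b}" for t
    using increment_square_le[OF assms(2,3) that c(1)] c by simp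
  then have "integral {a..b} (\<lambda>t. (f t)\<^sup>2) \<le> integral {a..b} (\<lambda>_. (b - a) * integral {a..b} (\<lambda>t. (f' t)\<^sup>2))"
    using cf by (intro integral_le integrable_continuous_interval continuous_intros) auto
  then show ?thesis using assms(1) by (simp add: power2_eq_square)
qed

text \<open>A first-order system for v and the flux T v', so no derivative of T occurs and the
  natural boundary condition matches the fluxes.\<close>

definition periodic_sl_solution ::
  "(real \<Rightarrow> real) \<Rightarrow> (real \<Rightarrow> real) \<Rightarrow> real \<Rightarrow> real \<Rightarrow> real \<Rightarrow> (real \<Rightarrow> real) \<Rightarrow> (real \<Rightarrow> real) \<Rightarrow> bool" where
  "periodic_sl_solution T w a b l v v' \<longleftrightarrow>
     (\<forall>t. (v has_real_derivative v' t) (at t)) \<and>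
     (\<forall>t. ((\<lambda>t. T t * v' t) has_real_derivative - l * w t * v t) (at t)) \<and>
     v b = v a \<and> T b * v' b = T a * v' a \<and> (\<exists>t\<in>{a..b}. v t \<noteq> 0)"

text \<open>A Bessel inequality: for eigenfunctions \<open>v\<^sub>l\<close> normalised in \<open>L\<^sup>2(w)\<close>, the Sobolev inequality
  applied at \<open>s\<close> to \<open>\<Sum>\<^sub>l v\<^sub>l(s) v\<^sub>l\<close> bounds \<open>\<Sum>\<^sub>l v\<^sub>l(s)\<^sup>2\<close>, and integrating over \<open>s\<close> bounds the
  number of eigenvalues.\<close>
lemma finite_periodic_sl_eigenvalues:
  fixes T w :: "real \<Rightarrow> real"
  assumes ab: "a < b" and T: "continuous_on {a..b} T" "\<And>t. T t > 0"
    and w: "continuous_on {a..b} w" "\<And>t. w t > 0"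
  shows "finite {l. 0 < l \<and> l \<le> m \<and> (\<exists>v v'. periodic_sl_solution T w a b l v v')}" (is "finite ?S")
proof -
  let ?i = "integral {a..b}"
  have "\<forall>l\<in>?S. \<exists>p. periodic_sl_solution T w a b l (fst p) (snd p)"
    by simp
  then obtain p where p: "\<forall>l\<in>?S. periodic_sl_solution T w a b l (fst (p l)) (snd (p l))"
    by (rule bchoice[THEN exE])
  define v where "v l = fst (p l)" for l
  define v' where "v' l = snd (p l)" for l
  have v: "(v l has_real_derivative v' l t) (at t)"
    and v': "((\<lambda>t. T t * v' l t) has_real_derivative - l * w t * v l t) (at t)"
    and bd: "v l b = v l a" "T b * v' l b = T a * v' l a"
    and nz: "\<exists>t\<in>{a..b}. v l t \<noteq> 0" if "l \<in> ?S" for l t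
    using p[rule_format, OF that] by (simp_all add: periodic_sl_solution_def v_def v'_def)
  have cv: "continuous_on {a..b} (v l)" if "l \<in> ?S" for l
    using v[OF that] by (meson DERIV_isCont continuous_at_imp_continuous_on)
  have cv': "continuous_on {a..b} (v' l)" if "l \<in> ?S" for l
  proof -
    \<comment> \<open>Only the flux is known to be differentiable; \<open>v'\<close> inherits
      continuity after division by T.\<close>
    have "continuous_on {a..b} (\<lambda>t. T t * v' l t / T t)"
      using v'[OF that] T
      by (intro continuous_on_divide T)
         (auto intro!: continuous_at_imp_continuous_on DERIV_isCont simp: less_imp_neq[symmetric])
    then show ?thesis using T(2) by (simp add: less_imp_neq[symmetric])
  qed
  have ints: "(\<lambda>t. w t * v l t * v k t) integrable_on {a..b}" 
    "(\<lambda>t. T t * v' l t * v' k t) integrable_on {a..b}" if "l \<in> ?S" "k \<in> ?S" for l k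
    using that cv cv' T w by (auto intro!: integrable_continuous_interval continuous_intros)
  \<comment> \<open>Integrate the derivative of T v_l' v_k; the boundary terms cancel by
    periodicity.\<close>
  have green: "?i (\<lambda>t. T t * v' l t * v' k t) = l * ?i (\<lambda>t. w t * v l t * v k t)"
    if "l \<in> ?S" "k \<in> ?S" for l k
  proof -
    have "((\<lambda>t. T t * v' l t * v' k t - l * (w t * v l t * v k t)) has_integral
        T b * v' l b * v k b - T a * v' l a * v k a) {a..b}"
    proof (rule fundamental_theorem_of_calculus)
      fix t
      have "((\<lambda>t. T t * v' l t * v k t) has_real_derivative
          T t * v' l t * v' k t - l * (w t * v l t * v k t)) (at t)"
        using DERIV_mult[OF v'[OF that(1)] v[OF that(2)], of t] by (simp add: algebra_simps)
      then show "((\<lambda>t. T t * v' l t * v k t) has_vector_derivative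
          T t * v' l t * v' k t - l * (w t * v l t * v k t)) (at t within {a..b})"
        by (simp add: has_real_derivative_iff_has_vector_derivative[symmetric] has_field_derivative_at_within)
    qed (use ab in simp)
    then have "?i (\<lambda>t. T t * v' l t * v' k t - l * (w t * v l t * v k t)) = 0"
      using bd that by (simp add: integral_unique)
    then show ?thesis
      using integral_diff[OF ints(2)[OF that] integrable_on_mult_right[OF ints(1)[OF that]], of l]
      by simp
  qed
  have orth: "?i (\<lambda>t. w t * v l t * v k t) = 0" if "l \<in> ?S" "k \<in> ?S" "l \<noteq> k" for l k
  proof -
    \<comment> \<open>The energy form is symmetric in l and k, so Green's identity can be read with
      either factor.\<close>
    have "l * ?i (\<lambda>t. w t * v l t * v k t) = k * ?i (\<lambda>t. w t * v k t * v l t)"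
      using green[OF that(1,2)] green[OF that(2,1)] by (simp add: mult.commute mult.left_commute)
    then have "(l - k) * ?i (\<lambda>t. w t * v l t * v k t) = 0"
      by (simp add: mult.commute mult.left_commute algebra_simps)
    then show ?thesis using that(3) by simp
  qed
  define N where "N l = ?i (\<lambda>t. w t * v l t * v l t)" for l
  have N: "N l > 0" if "l \<in> ?S" for l
  proof -
    have c: "continuous_on {a..b} (\<lambda>t. w t * v l t * v l t)"
      using cv[OF that] w by (intro continuous_intros)
    have "N l \<ge> 0"
      unfolding N_def using c w(2)
      by (intro integral_nonneg integrable_continuous_interval)
         (auto simp: mult.assoc less_imp_le)
    moreover have "N l \<noteq> 0"
    proof
      assume "N l = 0"
      then have "\<forall>t\<in>{a..b}. w t * v l t * v l t = 0"
        using integral_eq_0_iff[OF c ab] w(2) unfolding N_def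
        by (auto simp: mult.assoc less_imp_le)
      then show False using nz[OF that] w(2) by (auto simp: less_imp_neq[symmetric])
    qed
    ultimately show ?thesis by simp
  qed
  \<comment> \<open>A positive lower bound of T turns the weighted energy into a bound for the plain
    integral of the squared derivative.\<close>
  obtain \<tau> where \<tau>: "\<tau> > 0" "\<And>t. t \<in> {a..b} \<Longrightarrow> \<tau> \<le> T t"
  proof -
    have "\<exists>x\<in>{a..b}. \<forall>t\<in>{a..b}. T x \<le> T t"
      using ab by (intro continuous_attains_inf T) auto
    then show ?thesis using that T(2) by blast
  qed
  define \<Omega> where "\<Omega> = ?i w"
  have wint: "w integrable_on {a..b}" using w by (intro integrable_continuous_interval)
  have \<Omega>: "\<Omega> > 0"
  proof -
    have "\<Omega> \<ge> 0" unfolding \<Omega>_def using w by (intro integral_nonneg wint) (auto simp: less_imp_le)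
    moreover have "\<Omega> \<noteq> 0"
    proof
      assume "\<Omega> = 0"
      then have "\<forall>x\<in>{a..b}. w x = 0"
        using integral_eq_0_iff[OF w(1) ab] w(2) by (auto simp: \<Omega>_def less_imp_le)
      then show False using w(2)[of a] ab by auto
    qed
    ultimately show ?thesis by simp
  qed
  \<comment> \<open>Read off from the final inequality \<Omega> * R^2 \<le> R * (2 + 2 * \<Omega> *
    (b - a) * m / \<tau>); the point is that it does not depend on the finite set L.\<close>
  define C where "C = (2 + 2 * \<Omega> * (b - a) * m / \<tau>) / \<Omega>"
  have bessel: "(\<Sum>l\<in>L. (v l s)\<^sup>2 / N l) \<le> C" if L: "finite L" "L \<subseteq> ?S" "L \<noteq> {}" and s: "s \<in> {a..b}" for L s
  proof -
    define R where "R = (\<Sum>l\<in>L. (v l s)\<^sup>2 / N l)"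
    define c where "c l = v l s / N l" for l
    \<comment> \<open>The reproducing kernel, centred at s, of the span of the chosen
      eigenfunctions: its value at s and its squared norm in L^2(w) are both R.\<close>
    define V where "V t = (\<Sum>l\<in>L. c l * v l t)" for t
    define V' where "V' t = (\<Sum>l\<in>L. c l * v' l t)" for t
    have LS: "l \<in> ?S" if "l \<in> L" for l using L that by blast
    have R0: "R \<ge> 0" unfolding R_def using N LS by (intro sum_nonneg) (simp add: less_imp_le)
    \<comment> \<open>L has an element, which lies in (0, m]; this makes C nonnegative and settles
      the case R = 0 at the end.\<close>
    have m0: "m > 0" using L by fastforce
    have Vd: "(V has_real_derivative V' t) (at t)" for t
      unfolding V_def[abs_def] V'_def by (intro DERIV_sum DERIV_cmult v LS)
    have cV: "continuous_on {a..b} V" and cV': "continuous_on {a..b} V'"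
      unfolding V_def[abs_def] V'_def[abs_def]
      by (intro continuous_intros cv cv' LS; assumption)+
    have Vs: "V s = R"
      by (simp add: V_def R_def c_def power2_eq_square)
    \<comment> \<open>Pythagoras for a general weight, used with w for the functions and with T for
      their derivatives.\<close>
    have quad: "?i (\<lambda>t. \<rho> t * (\<Sum>l\<in>L. c l * f l t)\<^sup>2) = (\<Sum>l\<in>L. (c l)\<^sup>2 * ?i (\<lambda>t. \<rho> t * f l t * f l t))"
      if int: "\<And>l k. l \<in> L \<Longrightarrow> k \<in> L \<Longrightarrow> (\<lambda>t. \<rho> t * f l t * f k t) integrable_on {a..b}"
        and orth: "\<And>l k. l \<in> L \<Longrightarrow> k \<in> L \<Longrightarrow> l \<noteq> k \<Longrightarrow> ?i (\<lambda>t. \<rho> t * f l t * f k t) = 0"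
      for f :: "real \<Rightarrow> real \<Rightarrow> real" and \<rho>
    proof -
      have "?i (\<lambda>t. \<rho> t * (\<Sum>l\<in>L. c l * f l t)\<^sup>2)
          = ?i (\<lambda>t. \<Sum>l\<in>L. \<Sum>k\<in>L. c l * c k * (\<rho> t * f l t * f k t))"
        by (rule integral_cong) (simp add: power2_eq_square sum_product sum_distrib_left mult_ac)
      also have "\<dots> = (\<Sum>l\<in>L. \<Sum>k\<in>L. c l * c k * ?i (\<lambda>t. \<rho> t * f l t * f k t))"
        by (simp only: integral_sum[OF L(1)] integrable_sum[OF L(1)] integrable_on_mult_right int
            integral_mult_right cong: sum.cong)
      also have "\<dots> = (\<Sum>l\<in>L. \<Sum>k\<in>L. if k = l then (c l)\<^sup>2 * ?i (\<lambda>t. \<rho> t * f l t * f l t) else 0)"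
        using orth by (intro sum.cong refl) (auto simp: power2_eq_square)
      finally show ?thesis using L(1) by simp
    qed
    have e1: "?i (\<lambda>t. w t * (V t)\<^sup>2) = R"
    proof -
      have "?i (\<lambda>t. w t * (V t)\<^sup>2) = (\<Sum>l\<in>L. (c l)\<^sup>2 * N l)"
        unfolding V_def N_def by (rule quad) (use LS ints orth in auto)
      also have "\<dots> = R"
        unfolding R_def using N LS by (intro sum.cong refl) (simp add: c_def power2_eq_square less_imp_neq[symmetric])
      finally show ?thesis .
    qed
    have e2: "?i (\<lambda>t. T t * (V' t)\<^sup>2) \<le> m * R"
    proof -
      have "?i (\<lambda>t. T t * (V' t)\<^sup>2) = (\<Sum>l\<in>L. (c l)\<^sup>2 * ?i (\<lambda>t. T t * v' l t * v' l t))"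
        unfolding V'_def by (rule quad) (use LS ints orth green in auto)
      also have "\<dots> = (\<Sum>l\<in>L. l * ((v l s)\<^sup>2 / N l))"
        using green LS N
        by (intro sum.cong refl) (simp add: c_def N_def[symmetric] power2_eq_square less_imp_neq[symmetric])
      also have "\<dots> \<le> (\<Sum>l\<in>L. m * ((v l s)\<^sup>2 / N l))"
        using N LS by (intro sum_mono mult_right_mono) (auto simp: less_imp_le)
      finally show ?thesis by (simp add: R_def sum_distrib_left)
    qed
    have "\<tau> * ?i (\<lambda>t. (V' t)\<^sup>2) = ?i (\<lambda>t. \<tau> * (V' t)\<^sup>2)"
      by simp
    also have "\<dots> \<le> ?i (\<lambda>t. T t * (V' t)\<^sup>2)"
      using cV' T \<tau> by (intro integral_le integrable_continuous_interval continuous_intros mult_right_mono) auto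
    finally have e3: "?i (\<lambda>t. (V' t)\<^sup>2) \<le> m * R / \<tau>"
      using e2 \<tau>(1) by (simp add: field_simps)
    have "(V s)\<^sup>2 \<le> 2 * (V t)\<^sup>2 + 2 * ((b - a) * (m * R / \<tau>))" if t: "t \<in> {a..b}" for t
    proof -
      have "(V s - V t)\<^sup>2 \<le> (b - a) * ?i (\<lambda>t. (V' t)\<^sup>2)"
        by (rule increment_square_le) (use Vd cV' s t in auto)
      also have "\<dots> \<le> (b - a) * (m * R / \<tau>)"
        using e3 ab by (intro mult_left_mono) auto
      finally have "(V s - V t)\<^sup>2 \<le> (b - a) * (m * R / \<tau>)" .
      moreover have "(V s)\<^sup>2 \<le> 2 * (V t)\<^sup>2 + 2 * (V s - V t)\<^sup>2"
        using zero_le_power2[of "2 * V t - V s"] by (simp add: power2_eq_square algebra_simps)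
      ultimately show ?thesis by linarith
    qed
    \<comment> \<open>Averaging the pointwise estimate over t with weight w replaces the unknown
      values V t by the norm R.\<close>
    then have "?i (\<lambda>t. w t * (V s)\<^sup>2) \<le> ?i (\<lambda>t. w t * (2 * (V t)\<^sup>2 + 2 * ((b - a) * (m * R / \<tau>))))"
      using w cV by (intro integral_le integrable_continuous_interval continuous_intros mult_left_mono)
        (auto simp: less_imp_le)
    also have "\<dots> = ?i (\<lambda>t. 2 * (w t * (V t)\<^sup>2) + 2 * ((b - a) * (m * R / \<tau>)) * w t)"
      by (simp add: algebra_simps)
    also have "\<dots> = 2 * R + 2 * ((b - a) * (m * R / \<tau>)) * \<Omega>"
    proof -
      have "(\<lambda>t. 2 * (w t * (V t)\<^sup>2)) integrable_on {a..b}"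
        using w cV by (intro integrable_continuous_interval continuous_intros)
      from integral_add[OF this integrable_on_mult_right[OF wint], of "2 * ((b - a) * (m * R / \<tau>))"]
      show ?thesis by (simp add: e1 \<Omega>_def del: times_divide_eq_right)
    qed
    also have "?i (\<lambda>t. w t * (V s)\<^sup>2) = \<Omega> * R\<^sup>2"
      by (simp add: \<Omega>_def Vs)
    also have "2 * R + 2 * ((b - a) * (m * R / \<tau>)) * \<Omega> = R * (C * \<Omega>)"
    proof -
      have "C * \<Omega> = 2 + 2 * \<Omega> * (b - a) * m / \<tau>" using \<Omega> by (simp add: C_def)
      then show ?thesis by (simp add: algebra_simps)
    qed
    finally have "R * (\<Omega> * R) \<le> R * (C * \<Omega>)"
      by (simp add: power2_eq_square mult.left_commute)
    then have "R = 0 \<or> \<Omega> * R \<le> C * \<Omega>"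
      using R0 by (auto simp: mult_le_cancel_left)
    moreover have "C \<ge> 0" unfolding C_def using \<Omega> ab m0 \<tau> by simp
    ultimately show ?thesis using \<Omega> R_def by (auto simp: mult.commute)
  qed
  have "card L \<le> nat \<lceil>C * \<Omega>\<rceil>" if L: "finite L" "L \<subseteq> ?S" for L
  proof (cases "L = {}")
    case False
    have LS: "l \<in> ?S" if "l \<in> L" for l using L that by blast
    have "real (card L) = (\<Sum>l\<in>L. ?i (\<lambda>s. w s * v l s * v l s) / N l)"
      using N LS by (simp add: N_def[symmetric] less_imp_neq[symmetric])
    also have "\<dots> = ?i (\<lambda>s. \<Sum>l\<in>L. w s * v l s * v l s / N l)"
      using L(1) ints LS by (subst integral_sum) (auto intro: integrable_on_divide)
    also have "\<dots> = ?i (\<lambda>s. w s * (\<Sum>l\<in>L. (v l s)\<^sup>2 / N l))"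
      by (simp add: sum_distrib_left power2_eq_square mult.assoc)
    also have "\<dots> \<le> ?i (\<lambda>s. w s * C)"
      using bessel[OF L False] w
      by (intro integral_le integrable_continuous_interval continuous_intros mult_left_mono cv LS)
         (use N LS in \<open>auto simp: less_imp_le less_imp_neq[symmetric]\<close>)
    also have "\<dots> = C * \<Omega>" by (simp add: \<Omega>_def)
    finally show ?thesis by linarith
  qed simp
  then show ?thesis
    using finite_if_finite_subsets_card_bdd[of ?S] by blast
qed

section \<open>Reduction of the eigenvalue problem to the profile\<close>

lemma continuous_on_slice:
  assumes "continuous_on UNIV (\<lambda>p. f (fst p) (snd p))"
  shows "continuous_on S (f t)"
  using continuous_on_compose2[OF assms, of S "\<lambda>y. (t, y)"] by (simp add: continuous_on_Pair)

lemma leibniz_interval: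
  fixes f g :: "real \<Rightarrow> real \<Rightarrow> real"
  assumes "\<And>t y. ((\<lambda>t. f t y) has_real_derivative g t y) (at t)"
    and "continuous_on UNIV (\<lambda>p. f (fst p) (snd p))"
    and "continuous_on UNIV (\<lambda>p. g (fst p) (snd p))"
  shows "((\<lambda>t. integral {a..b} (f t)) has_real_derivative integral {a..b} (g t)) (at t)"
proof -
  have "((\<lambda>t. integral (cbox a b) (f t)) has_field_derivative integral (cbox a b) (g t)) (at t within UNIV)"
  proof (rule leibniz_rule_field_derivative)
    show "continuous_on (UNIV \<times> cbox a b) (\<lambda>(x, t). g x t)"
      using assms(3) continuous_on_subset by (auto simp: split_beta)
    show "f t integrable_on cbox a b" for t
      using continuous_on_slice[OF assms(2)] integrable_continuous by blast
  qed (use assms(1) in auto)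
  then show ?thesis by (simp add: cbox_interval)
qed

text \<open>Differentiating in h under the integral gives f (c + h) - f h = 0, so the integral does
  not depend on the shift.\<close>

lemma integral_periodic_shift:
  fixes f :: "real \<Rightarrow> real"
  assumes "\<And>t. f (t + c) = f t" "\<And>t. (f has_real_derivative f' t) (at t)" "continuous_on UNIV f'"
    "c \<ge> 0"
  shows "integral {0..c} (\<lambda>t. f (t + h)) = integral {0..c} f"
proof -
  have cf: "continuous_on UNIV f"
    using assms(2) by (meson DERIV_isCont continuous_at_imp_continuous_on)
  have c2: "continuous_on UNIV (\<lambda>p. g (snd p + fst p))" if "continuous_on UNIV g" for g :: "real \<Rightarrow> real"
    by (rule continuous_on_compose2[OF that]) (auto intro!: continuous_intros)
  have "((\<lambda>h. f (t + h)) has_real_derivative f' (t + h)) (at h)" for t h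
    using iffD1[OF DERIV_shift[of f "f' (h + t)" h t] assms(2)] by (simp add: add.commute[of t])
  then have deriv: "((\<lambda>h. integral {0..c} (\<lambda>t. f (t + h))) has_real_derivative integral {0..c} (\<lambda>t. f' (t + h))) (at h)" for h
    by (rule leibniz_interval[where f = "\<lambda>h t. f (t + h)" and g = "\<lambda>h t. f' (t + h)"])
       (use assms(2) c2 cf assms(3) in auto)
  have "((\<lambda>t. f' (t + h)) has_integral f (c + h) - f (0 + h)) {0..c}" for h
    using iffD1[OF DERIV_shift assms(2)]
    by (intro fundamental_theorem_of_calculus assms)
       (auto simp: has_real_derivative_iff_has_vector_derivative[symmetric] intro: has_field_derivative_at_within)
  moreover have "f (c + h) - f (0 + h) = 0" for h
    using assms(1)[of h] by (simp add: add.commute)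
  ultimately have "integral {0..c} (\<lambda>t. f' (t + h)) = 0" for h
    by (metis integral_unique)
  then have "((\<lambda>h. integral {0..c} (\<lambda>t. f (t + h))) has_real_derivative 0) (at h)" for h
    using deriv by simp
  then have "integral {0..c} (\<lambda>t. f (t + h)) = integral {0..c} (\<lambda>t. f (t + 0))"
    by (rule DERIV_isconst_all[rule_format, of "\<lambda>h. integral {0..c} (\<lambda>t. f (t + h))"]) 
  then show ?thesis by simp
qed

text \<open>For the fibrewise increment \<open>D\<close> of a solution and \<open>E t = \<integral> D\<^sup>2 dy\<close>, the fibrewise Poincare
  inequality makes the periodic function \<open>T E'\<close> nondecreasing when \<open>l\<close> is small.\<close>
lemma fibre_constant_solution:
  fixes F :: "real \<Rightarrow> real \<Rightarrow> real" and c :: real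
  assumes F1: "\<And>t y. ((\<lambda>t. F t y) has_real_derivative F1 t y) (at t)"
    and F11: "\<And>t y. ((\<lambda>t. F1 t y) has_real_derivative F11 t y) (at t)"
    and F2: "\<And>t y. ((\<lambda>y. F t y) has_real_derivative F2 t y) (at y)"
    and F22: "\<And>t y. ((\<lambda>y. F2 t y) has_real_derivative F22 t y) (at y)"
    and cont: "continuous_on UNIV (\<lambda>p. F (fst p) (snd p))"
      "continuous_on UNIV (\<lambda>p. F1 (fst p) (snd p))" "continuous_on UNIV (\<lambda>p. F11 (fst p) (snd p))"
      "continuous_on UNIV (\<lambda>p. F2 (fst p) (snd p))" "continuous_on UNIV (\<lambda>p. F22 (fst p) (snd p))"
    and c: "c > 0" and per: "\<And>t y. F (t + c) y = F t y" "\<And>t y. F t (y + c) = F t y"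
    and T: "\<And>t. (T has_real_derivative T' t) (at t)" "\<And>t. T t > 0" "\<And>t. T (t + c) = T t"
    and pde: "\<And>t y. T' t * F1 t y + T t * F11 t y + F22 t y / T t = - l * w t * F t y"
    and small: "\<And>t. c\<^sup>2 * (l * w t * T t) < 1"
  shows "F t y = F t 0"
proof -
  \<comment> \<open>The target y is frozen as a shift. The coefficients do not depend on y, so the
    increment D solves the same equation; it has mean zero on each fibre, and D t 0 is the
    difference to be shown to vanish.\<close>
  define h where "h = y"
  define D where "D t y = F t (y + h) - F t y" for t y
  define D1 where "D1 t y = F1 t (y + h) - F1 t y" for t y
  define D11 where "D11 t y = F11 t (y + h) - F11 t y" for t y
  define D2 where "D2 t y = F2 t (y + h) - F2 t y" for t y
  define D22 where "D22 t y = F22 t (y + h) - F22 t y" for t y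
  note defs = D_def D1_def D11_def D2_def D22_def
  have d: "((\<lambda>t. D t y) has_real_derivative D1 t y) (at t)"
    "((\<lambda>t. D1 t y) has_real_derivative D11 t y) (at t)"
    "((\<lambda>y. D t y) has_real_derivative D2 t y) (at y)"
    "((\<lambda>y. D2 t y) has_real_derivative D22 t y) (at y)" for t y
    unfolding defs by (intro DERIV_diff F1 F11 F2 F22 iffD1[OF DERIV_shift])+
  have sh: "continuous_on UNIV (\<lambda>p. f (fst p) (snd p + h) - f (fst p) (snd p))"
    if "continuous_on UNIV (\<lambda>p. f (fst p) (snd p))" for f :: "real \<Rightarrow> real \<Rightarrow> real"
  proof -
    have "continuous_on UNIV (\<lambda>p::real \<times> real. (fst p, snd p + h))"
      by (intro continuous_intros)
    then show ?thesis
      using continuous_on_compose2[OF that, of UNIV "\<lambda>p. (fst p, snd p + h)"] that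
      by (auto intro: continuous_on_diff)
  qed
  have cD: "continuous_on UNIV (\<lambda>p. D (fst p) (snd p))" "continuous_on UNIV (\<lambda>p. D1 (fst p) (snd p))"
    "continuous_on UNIV (\<lambda>p. D11 (fst p) (snd p))" "continuous_on UNIV (\<lambda>p. D2 (fst p) (snd p))"
    "continuous_on UNIV (\<lambda>p. D22 (fst p) (snd p))"
    unfolding defs using cont by (auto intro: sh)
  note sl = cD[THEN continuous_on_slice]
  have perD: "D (t + c) y = D t y" "D t (y + c) = D t y" for t y
    using per(2)[of t "y + h"] by (simp_all add: D_def per add.assoc add.commute[of c h])
  have perD1: "D1 (t + c) y = D1 t y" for t y
    by (rule derivative_periodic[of "\<lambda>t. D t y"]) (use perD d in auto)
  have perD2: "D2 t (y + c) = D2 t y" for t y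
    by (rule derivative_periodic[of "D t"]) (use perD d in auto)
  have mean: "integral {0..c} (D t) = 0" for t
  proof -
    have "continuous_on {0..c} (F t)"
      by (rule continuous_on_slice[OF cont(1)])
    moreover have "continuous_on {0..c} (\<lambda>y. F t (y + h))"
      using iffD1[OF DERIV_shift F2]
      by (meson DERIV_isCont continuous_at_imp_continuous_on)
    ultimately have "integral {0..c} (D t) = integral {0..c} (\<lambda>y. F t (y + h)) - integral {0..c} (F t)"
      unfolding D_def by (intro integral_diff integrable_continuous_interval)
    also have "integral {0..c} (\<lambda>y. F t (y + h)) = integral {0..c} (F t)"
      using per F2 c continuous_on_slice[OF cont(4)]
      by (intro integral_periodic_shift[of _ _ "F2 t"]) auto
    finally show ?thesis by simp
  qed
  define E where "E t = integral {0..c} (\<lambda>y. (D t y)\<^sup>2)" for t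
  define E1 where "E1 t = integral {0..c} (\<lambda>y. 2 * D t y * D1 t y)" for t
  define E11 where "E11 t = integral {0..c} (\<lambda>y. 2 * (D1 t y)\<^sup>2 + 2 * D t y * D11 t y)" for t
  have dE1: "(E1 has_real_derivative E11 t) (at t)" for t
    unfolding E1_def[abs_def] E11_def
  proof (rule leibniz_interval)
    show "((\<lambda>t. 2 * D t y * D1 t y) has_real_derivative 2 * (D1 t y)\<^sup>2 + 2 * D t y * D11 t y) (at t)" for t y
      by (auto intro!: derivative_eq_intros d simp: power2_eq_square)
  qed (auto intro!: continuous_intros cD)
  have E1_per: "E1 (t + c) = E1 t" for t
    by (simp add: E1_def perD perD1)
  define I1 where "I1 t = integral {0..c} (\<lambda>y. (D1 t y)\<^sup>2)" for t
  define I2 where "I2 t = integral {0..c} (\<lambda>y. (D2 t y)\<^sup>2)" for t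
  have parts: "integral {0..c} (\<lambda>y. D t y * D22 t y) = - I2 t" for t
  proof -
    have "((\<lambda>y. (D2 t y)\<^sup>2 + D t y * D22 t y) has_integral D t c * D2 t c - D t 0 * D2 t 0) {0..c}"
    proof (rule fundamental_theorem_of_calculus)
      fix y
      have "((\<lambda>y. D t y * D2 t y) has_real_derivative (D2 t y)\<^sup>2 + D t y * D22 t y) (at y)"
        by (auto intro!: derivative_eq_intros d simp: power2_eq_square)
      then show "((\<lambda>y. D t y * D2 t y) has_vector_derivative (D2 t y)\<^sup>2 + D t y * D22 t y) (at y within {0..c})"
        by (simp add: has_real_derivative_iff_has_vector_derivative[symmetric] has_field_derivative_at_within)
    qed (use c in simp)
    moreover have "D t c = D t 0" "D2 t c = D2 t 0"
      using perD(2)[of t 0] perD2[of t 0] by simp_all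
    ultimately have "integral {0..c} (\<lambda>y. (D2 t y)\<^sup>2 + D t y * D22 t y) = 0"
      by (simp add: integral_unique)
    moreover have "integral {0..c} (\<lambda>y. (D2 t y)\<^sup>2 + D t y * D22 t y) = I2 t + integral {0..c} (\<lambda>y. D t y * D22 t y)"
      unfolding I2_def by (intro integral_add integrable_continuous_interval continuous_intros sl)
    ultimately show ?thesis by simp
  qed
  \<comment> \<open>(T E')' is the integral of 2 T D1^2 + 2 D (T D1)'. The equation replaces (T
    D1)', and integration by parts along the fibre turns D D22 into - D2^2.\<close>
  have dP: "((\<lambda>t. T t * E1 t) has_real_derivative 2 * T t * I1 t + 2 / T t * (I2 t - l * w t * T t * E t)) (at t)" for t
  proof -
    have "T' t * D1 t y + T t * D11 t y = - l * w t * D t y - D22 t y / T t" for y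
      using pde[of t y] pde[of t "y + h"] unfolding defs
      by (simp add: algebra_simps diff_divide_distrib)
    moreover have "T' t * (2 * D t y * D1 t y) + T t * (2 * (D1 t y)\<^sup>2 + 2 * D t y * D11 t y) =
        2 * T t * (D1 t y)\<^sup>2 + (2 * D t y) * (T' t * D1 t y + T t * D11 t y)" for y
      by (simp add: algebra_simps)
    ultimately have eq: "T' t * (2 * D t y * D1 t y) + T t * (2 * (D1 t y)\<^sup>2 + 2 * D t y * D11 t y) =
        2 * T t * (D1 t y)\<^sup>2 + (2 * D t y) * (- l * w t * D t y - D22 t y / T t)" for y
      by simp
    have "T' t * E1 t + T t * E11 t =
        integral {0..c} (\<lambda>y. T' t * (2 * D t y * D1 t y) + T t * (2 * (D1 t y)\<^sup>2 + 2 * D t y * D11 t y))"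
    proof -
      have "integral {0..c} (\<lambda>y. T' t * (2 * D t y * D1 t y) + T t * (2 * (D1 t y)\<^sup>2 + 2 * D t y * D11 t y)) =
        integral {0..c} (\<lambda>y. T' t * (2 * D t y * D1 t y)) + integral {0..c} (\<lambda>y. T t * (2 * (D1 t y)\<^sup>2 + 2 * D t y * D11 t y))"
        by (intro integral_add integrable_continuous_interval continuous_intros sl)
      then show ?thesis unfolding E1_def E11_def by (simp only: integral_mult_right)
    qed
    also have "\<dots> = integral {0..c} (\<lambda>y. (2 * T t * (D1 t y)\<^sup>2 + (- 2 * l * w t) * (D t y)\<^sup>2)
        + (- 2 / T t) * (D t y * D22 t y))"
      unfolding eq by (rule integral_cong) (simp add: power2_eq_square algebra_simps)
    also have "\<dots> = integral {0..c} (\<lambda>y. 2 * T t * (D1 t y)\<^sup>2) + integral {0..c} (\<lambda>y. (- 2 * l * w t) * (D t y)\<^sup>2)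
        + integral {0..c} (\<lambda>y. (- 2 / T t) * (D t y * D22 t y))"
    proof -
      have 1: "(\<lambda>y. 2 * T t * (D1 t y)\<^sup>2) integrable_on {0..c}"
        "(\<lambda>y. (- 2 * l * w t) * (D t y)\<^sup>2) integrable_on {0..c}"
        "(\<lambda>y. (- 2 / T t) * (D t y * D22 t y)) integrable_on {0..c}"
        by (intro integrable_continuous_interval continuous_intros sl)+
      show ?thesis
        using integral_add[OF integrable_add[OF 1(1,2)] 1(3)] integral_add[OF 1(1,2)] by simp
    qed
    also have "\<dots> = 2 * T t * I1 t + 2 / T t * (I2 t - l * w t * T t * E t)"
      unfolding integral_mult_right parts I1_def[symmetric] E_def[symmetric]
      using T(2)[of t] by (simp add: field_simps)
    finally show ?thesis
      using DERIV_mult[OF T(1) dE1, of t] by (simp add: add.commute mult.commute)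
  qed
  have nonneg: "I1 t \<ge> 0" "E t \<ge> 0" for t
    unfolding I1_def E_def by (intro integral_nonneg integrable_continuous_interval continuous_intros sl; simp)+
  have poincare: "E t \<le> c\<^sup>2 * I2 t" for t
    using poincare_mean_zero[OF c d(3) sl(4) mean, of t] by (simp add: E_def I2_def)
  \<comment> \<open>By the Poincare inequality the bracket in the derivative of T E' dominates a
    multiple of E, and smallness makes that multiple positive.\<close>
  have gap: "(1 - c\<^sup>2 * (l * w t * T t)) * E t \<le> c\<^sup>2 * (I2 t - l * w t * T t * E t)" for t
    using poincare[of t] by (simp add: algebra_simps)
  have gap0: "0 \<le> I2 t - l * w t * T t * E t" for t
  proof -
    have "0 \<le> c\<^sup>2 * (I2 t - l * w t * T t * E t)"
      using gap[of t] small[of t] nonneg(2)[of t]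
      by (meson diff_ge_0_iff_ge less_imp_le mult_nonneg_nonneg order_trans)
    then show ?thesis using c by (simp add: zero_le_mult_iff)
  qed
  have mono: "T s * E1 s \<le> T t * E1 t" if "s \<le> t" for s t
    by (rule DERIV_nonneg_imp_nondecreasing[OF that])
       (use dP nonneg T(2) gap0 in \<open>force simp: less_imp_le\<close>)
  have const: "T t * E1 t = T 0 * E1 0" for t
  proof -
    obtain n :: nat where n: "\<bar>t\<bar> \<le> n * c"
      using reals_Archimedean3[OF c] less_imp_le by blast
    have shift: "T (s + n * c) * E1 (s + n * c) = T s * E1 s" for s and n :: nat
    proof (induction n)
      case (Suc n)
      then show ?case
        using T(3)[of "s + n * c"] E1_per[of "s + n * c"] by (simp add: algebra_simps)
    qed simp
    \<comment> \<open>A nondecreasing periodic function is constant: shifting by n periods places t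
      to the right of 0 and 0 to the right of t.\<close>
    have "T 0 * E1 0 \<le> T (t + n * c) * E1 (t + n * c)" "T t * E1 t \<le> T (0 + n * c) * E1 (0 + n * c)"
      using n by (intro mono; linarith)+
    then show ?thesis by (simp only: shift)
  qed
  have "E t \<le> 0" for t
  proof -
    have "(\<lambda>t. T t * E1 t) = (\<lambda>t. T 0 * E1 0)"
      using const by (rule ext)
    then have "((\<lambda>t. T t * E1 t) has_real_derivative 0) (at t)"
      by simp
    \<comment> \<open>With T E' constant, both nonnegative parts of its derivative vanish, and
      \<open>gap\<close> forces E = 0.\<close>
    then have "2 * T t * I1 t + 2 / T t * (I2 t - l * w t * T t * E t) = 0"
      using dP by (intro DERIV_unique)
    moreover have "2 * T t * I1 t \<ge> 0" "2 / T t * (I2 t - l * w t * T t * E t) \<ge> 0"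
      using nonneg gap0 T(2)[of t] by simp_all
    ultimately have "2 / T t * (I2 t - l * w t * T t * E t) = 0" by linarith
    then have "I2 t - l * w t * T t * E t = 0" using T(2)[of t] by simp
    then have "(1 - c\<^sup>2 * (l * w t * T t)) * E t \<le> 0"
      using gap[of t] by simp
    then show ?thesis using small[of t] by (simp add: mult_le_0_iff)
  qed
  then have "E t = 0" for t
    using nonneg order_antisym by blast
  then have "\<forall>y\<in>{0..c}. (D t y)\<^sup>2 = 0" for t
    unfolding E_def using integral_eq_0_iff[of 0 c "\<lambda>y. (D t y)\<^sup>2"] c sl(1)
    by (auto intro!: continuous_intros)
  then have "D t 0 = 0"
    using c by simp
  then show "F t y = F t 0" by (simp add: D_def h_def)
qed

section \<open>From eigenfunctions on the torus to Sturm-Liouville solutions\<close>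

lemma vector_2_eq_axis: "(vector [t, y] :: real^2) = t *\<^sub>R axis 1 1 + y *\<^sub>R axis 2 1"
  by (simp add: eq_vec2_iff axis_def)

lemma Ck_on_partial: "Ck_on (Suc k) S f \<Longrightarrow> Ck_on k S (partial i f)"
  by (simp add: partial_def[abs_def])

lemma partial_has_real_derivative:
  fixes f :: "real^2 \<Rightarrow> real"
  assumes "Ck_on (Suc k) UNIV f"
  shows "((\<lambda>t. f (vector [t, y])) has_real_derivative partial 1 f (vector [t, y])) (at t)"
    and "((\<lambda>y. f (vector [t, y])) has_real_derivative partial 2 f (vector [t, y])) (at y)"
proof -
  let ?D = "frechet_derivative f (at (vector [t, y]))"
  have D: "(f has_derivative ?D) (at (vector [t, y]))"
    by (rule Ck_on_SucD[OF assms]) simp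
  have lin: "?D (h *\<^sub>R axis i 1) = partial i f (vector [t, y]) * h" for h i
    using has_derivative_linear[OF D] by (simp add: partial_def linear_cmul)
  have 1: "((\<lambda>t. vector [t, y]) has_derivative (\<lambda>h. h *\<^sub>R axis 1 1 :: real^2)) (at t)"
    and 2: "((\<lambda>y. vector [t, y]) has_derivative (\<lambda>h. h *\<^sub>R axis 2 1 :: real^2)) (at y)"
    unfolding vector_2_eq_axis by (auto intro!: derivative_eq_intros)
  show "((\<lambda>t. f (vector [t, y])) has_real_derivative partial 1 f (vector [t, y])) (at t)"
    and "((\<lambda>y. f (vector [t, y])) has_real_derivative partial 2 f (vector [t, y])) (at y)"
    using has_derivative_compose[OF 1 D] has_derivative_compose[OF 2 D]
    by (simp_all add: has_field_derivative_def lin)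
qed

lemma Ck_on_continuous_pair:
  fixes f :: "real^2 \<Rightarrow> real"
  assumes "Ck_on 0 UNIV f"
  shows "continuous_on UNIV (\<lambda>p. f (vector [fst p, snd p]))"
proof -
  have "continuous_on UNIV (\<lambda>p::real \<times> real. vector [fst p, snd p] :: real^2)"
    unfolding vector_2_eq_axis by (intro continuous_intros)
  then show ?thesis
    using assms by (auto intro: continuous_on_compose2)
qed

context warped_torus_derivs
begin

text \<open>Because w T = B, the hypothesis is the smallness condition of the fibre argument with
  period 2 * pi. The restriction of the eigenfunction to y = 0 is then the solution sought.\<close>

lemma small_laplace_eigenvalue:
  assumes "laplace_eigenvalue M l" and small: "\<And>t. (2 * pi)\<^sup>2 * (l * B t) < 1"
  shows "\<exists>v v'. periodic_sl_solution T w 0 (2 * pi) l v v'"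
proof -
  obtain u q where u: "smooth_function M u" and q: "q \<in> torus" "u q \<noteq> 0"
    and eig: "\<And>q. q \<in> torus \<Longrightarrow> - laplacian M u q = l * u q"
    using assms(1) by (auto simp: laplace_eigenvalue_def)
  define U where "U = u \<circ> angle_point"
  have U: "Ck_on k UNIV U" for k
    using u by (simp add: smooth_function_iff smooth_on_def U_def)
  note Ui = Ck_on_partial[OF U]
  note Uij = Ck_on_partial[OF Ui]
  have per: "U (vector [t + 2 * pi, y]) = U (vector [t, y])" "U (vector [t, y + 2 * pi]) = U (vector [t, y])" for t y
    by (simp_all add: U_def angle_point_def cis_eq_iff)
       (metis add.commute add.left_neutral cis_2pi cis_mult mult.right_neutral)+
  have wT: "w t * T t = B t" for t
    using w_div_B[of t] B_pos[of t] T_pos[of t] by (simp add: field_simps)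
  have pde: "T' t * partial 1 U (vector [t, y]) + T t * partial 1 (partial 1 U) (vector [t, y])
      + partial 2 (partial 2 U) (vector [t, y]) / T t = - l * w t * U (vector [t, y])" for t y
  proof -
    have "laplacian M u (angle_point (vector [t, y])) = - (l * U (vector [t, y]))"
      using eig[of "angle_point (vector [t, y])"] by (simp add: U_def)
    then show ?thesis
      using laplacian_smooth[OF u, of "vector [t, y]"] by (simp add: U_def[symmetric] mult_ac)
  qed
  have fibre: "U (vector [t, y]) = U (vector [t, 0])" for t y
  proof (rule fibre_constant_solution[where F = "\<lambda>t y. U (vector [t, y])"])
    show "T (t + 2 * pi) = T t" for t by (rule T_periodic)
    show "(2 * pi)\<^sup>2 * (l * w t * T t) < 1" for t
      using small[of t] by (simp add: wT mult.assoc)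
  qed (rule partial_has_real_derivative Ck_on_continuous_pair U Ui Uij per T_deriv T_pos pde | simp)+
  have "partial 2 U (vector [t, y]) = 0" for t y
  proof (rule DERIV_unique[OF partial_has_real_derivative(2)[OF U]])
    show "((\<lambda>y. U (vector [t, y])) has_real_derivative 0) (at y)"
      by (subst fibre) simp
  qed
  then have "partial 2 (partial 2 U) (vector [t, y]) = 0" for t y
    by (intro DERIV_unique[OF partial_has_real_derivative(2)[OF Ui]]) simp
  then have ode: "T' t * partial 1 U (vector [t, 0]) + T t * partial 1 (partial 1 U) (vector [t, 0])
      = - l * w t * U (vector [t, 0])" for t
    using pde[of t 0] by simp
  define v where "v t = U (vector [t, 0])" for t
  define v' where "v' t = partial 1 U (vector [t, 0])" for t
  have v: "(v has_real_derivative v' t) (at t)" for t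
    unfolding v_def[abs_def] v'_def by (rule partial_has_real_derivative[OF U])
  have "periodic_sl_solution T w 0 (2 * pi) l v v'"
    unfolding periodic_sl_solution_def
  proof (intro conjI allI v)
    show "((\<lambda>t. T t * v' t) has_real_derivative - l * w t * v t) (at t)" for t
      using DERIV_mult[OF T_deriv partial_has_real_derivative(1)[OF Ui[of _ 1]], of 0 t] ode[of t]
      by (simp add: v'_def v_def mult.commute add.commute)
    have v_per: "v (t + 2 * pi) = v t" for t
      by (simp add: v_def per)
    then show "v (2 * pi) = v 0"
      by (metis add_0)
    show "T (2 * pi) * v' (2 * pi) = T 0 * v' 0"
      using derivative_periodic[OF v_per v, of 0] T_periodic[of 0] by simp
    \<comment> \<open>The point with u q \<noteq> 0 may lie over any y; constancy along fibres moves
      it to y = 0 at the same t in [0, 2 * pi].\<close>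
    obtain x where x: "q = angle_point x" "0 \<le> x $ 1" "x $ 1 < 2 * pi"
      using torus_point_angle[OF q(1)] by metis
    have "vector [x $ 1, x $ 2] = x"
      by (simp add: eq_vec2_iff)
    then have "v (x $ 1) = U x"
      using fibre[of "x $ 1" "x $ 2"] by (simp add: v_def)
    then show "\<exists>t\<in>{0..2 * pi}. v t \<noteq> 0"
      using x q by (intro bexI[of _ "x $ 1"]) (auto simp: U_def)
  qed
  then show ?thesis by blast
qed

text \<open>A \<open>LEAST\<close> over the reals is informative only if attained. Every eigenvalue
  in (0, e] satisfies the smallness condition as well, so these form a finite set containing e, and
  its minimum also lies below every eigenvalue above e.\<close>

lemma lambda1_le:
  assumes "laplace_eigenvalue M e" "e > 0" "\<And>t. (2 * pi)\<^sup>2 * (e * B t) < 1"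
  shows "0 < lambda1 M" "lambda1 M \<le> e"
proof -
  define S where "S = {l. 0 < l \<and> l \<le> e \<and> laplace_eigenvalue M l}"
  have "S \<subseteq> {l. 0 < l \<and> l \<le> e \<and> (\<exists>v v'. periodic_sl_solution T w 0 (2 * pi) l v v')}"
  proof
    fix l assume l: "l \<in> S"
    have "(2 * pi)\<^sup>2 * (l * B t) < 1" for t
    proof -
      have "(2 * pi)\<^sup>2 * (l * B t) \<le> (2 * pi)\<^sup>2 * (e * B t)"
        using l B_pos[of t] by (intro mult_left_mono mult_right_mono) (auto simp: S_def)
      then show ?thesis using assms(3)[of t] by linarith
    qed
    then show "l \<in> {l. 0 < l \<and> l \<le> e \<and> (\<exists>v v'. periodic_sl_solution T w 0 (2 * pi) l v v')}"
      using small_laplace_eigenvalue l by (simp add: S_def)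
  qed
  moreover have "finite {l. 0 < l \<and> l \<le> e \<and> (\<exists>v v'. periodic_sl_solution T w 0 (2 * pi) l v v')}"
    by (rule finite_periodic_sl_eigenvalues) (auto intro: continuous_coeffs T_pos w_pos)
  ultimately have fin: "finite S" by (rule finite_subset)
  have e: "e \<in> S" using assms by (simp add: S_def)
  have "lambda1 M = Min S"
    unfolding lambda1_def
  proof (rule Least_equality)
    show "0 < Min S \<and> laplace_eigenvalue M (Min S)"
      using Min_in[OF fin] e by (auto simp: S_def)
    show "Min S \<le> l" if "0 < l \<and> laplace_eigenvalue M l" for l
    proof (cases "l \<le> e")
      case True
      then show ?thesis using that fin by (intro Min_le) (auto simp: S_def)
    next
      case False
      then show ?thesis using Min_le[OF fin e] by linarith
    qed
  qed
  then show "0 < lambda1 M" "lambda1 M \<le> e"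
    using Min_in[OF fin] e Min_le[OF fin e] by (auto simp: S_def)
qed

end

section \<open>Volume\<close>

definition torus_borel :: "(complex \<times> complex) measure" where
  "torus_borel = sigma torus {U. openin (top_of_set torus) U}"

text \<open>Half open, so that its lattice translates partition the plane.\<close>

definition period_cell :: "(real^2) set" where
  "period_cell = {x. 0 \<le> x $ 1 \<and> x $ 1 < 2 * pi \<and> 0 \<le> x $ 2 \<and> x $ 2 < 2 * pi}"

lemma space_torus_borel [simp]: "space torus_borel = torus"
  and sets_torus_borel: "sets torus_borel = sigma_sets torus {U. openin (top_of_set torus) U}"
proof -
  have "{U. openin (top_of_set torus) U} \<subseteq> Pow torus"
    using openin_imp_subset by blast
  then show "space torus_borel = torus"
    "sets torus_borel = sigma_sets torus {U. openin (top_of_set torus) U}"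
    unfolding torus_borel_def by (rule space_measure_of sets_measure_of)+
qed

lemma patch_in_torus_borel: "patch a b \<in> sets torus_borel"
  using openin_patch by (auto simp: sets_torus_borel)

lemma measurable_angle_point [measurable]: "angle_point \<in> borel \<rightarrow>\<^sub>M torus_borel"
  unfolding torus_borel_def
proof (rule measurable_measure_of)
  fix U assume "U \<in> {U. openin (top_of_set torus) U}"
  then obtain V where "open V" "U = torus \<inter> V"
    by (auto simp: openin_open)
  then have "open (angle_point -` V)" "angle_point -` U = angle_point -` V"
    using open_vimage[OF _ continuous_on_angle_point] by (blast, simp add: vimage_def)
  then show "angle_point -` U \<inter> space borel \<in> sets borel"
    by simp
qed (auto dest: openin_imp_subset)

lemma square_borel [measurable]: "square a b \<in> sets borel"
  using open_square by simp

lemma period_cell_borel [measurable]: "period_cell \<in> sets borel"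
  unfolding period_cell_def by measurable

lemma period_cell_lattice:
  obtains k where "x - lattice k \<in> period_cell"
proof
  have "0 \<le> s - 2 * pi * of_int \<lfloor>s / (2 * pi)\<rfloor> \<and> s - 2 * pi * of_int \<lfloor>s / (2 * pi)\<rfloor> < 2 * pi" for s :: real
  proof -
    have "of_int \<lfloor>s / (2 * pi)\<rfloor> * (2 * pi) \<le> s" "s < (of_int \<lfloor>s / (2 * pi)\<rfloor> + 1) * (2 * pi)"
      using floor_correct[of "s / (2 * pi)"]
        pos_le_divide_eq[of "2 * pi" "of_int \<lfloor>s / (2 * pi)\<rfloor>" s]
        pos_divide_less_eq[of "2 * pi" s "of_int \<lfloor>s / (2 * pi)\<rfloor> + 1"] by simp_all
    then show ?thesis by (simp add: algebra_simps)
  qed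
  then show "x - lattice (\<lfloor>x $ 1 / (2 * pi)\<rfloor>, \<lfloor>x $ 2 / (2 * pi)\<rfloor>) \<in> period_cell"
    by (simp add: period_cell_def)
qed

lemma period_cell_lattice_unique:
  assumes "x - lattice k \<in> period_cell" "x - lattice l \<in> period_cell"
  shows "k = l"
proof -
  have "m = n" if "0 \<le> s - 2 * pi * of_int m" "s - 2 * pi * of_int m < 2 * pi"
    "0 \<le> s - 2 * pi * of_int n" "s - 2 * pi * of_int n < 2 * pi" for s :: real and m n :: int
  proof -
    have "2 * pi * of_int (m - n) < 2 * pi * 1" "2 * pi * of_int (n - m) < 2 * pi * 1"
      using that by (simp_all add: algebra_simps)
    then have "of_int (m - n) < (1::real)" "of_int (n - m) < (1::real)"
      by simp_all
    then show ?thesis by linarith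
  qed
  then show ?thesis
    using assms unfolding period_cell_def by (auto simp: prod_eq_iff)
qed

lemma measurable_torus_continuous:
  fixes f :: "complex \<times> complex \<Rightarrow> real"
  assumes "continuous_on UNIV f"
  shows "f \<in> borel_measurable torus_borel"
proof (rule borel_measurableI)
  fix S :: "real set" assume "open S"
  then have "open (f -` S)" using assms by (rule open_vimage)
  then have "openin (top_of_set torus) (torus \<inter> f -` S)"
    by (auto simp: openin_open)
  then show "f -` S \<inter> space torus_borel \<in> sets torus_borel"
    by (auto simp: sets_torus_borel Int_commute)
qed

lemma nn_integral_period_cell:
  assumes [measurable]: "h \<in> borel_measurable borel"
  shows "(\<integral>\<^sup>+x. h (x $ 1) * indicator period_cell x \<partial>lborel) =
    (\<integral>\<^sup>+t. h t * indicator {0..<2 * pi} t \<partial>lborel) * ennreal (2 * pi)"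
proof -
  define f :: "real^2 \<Rightarrow> real \<Rightarrow> ennreal" where
    "f b t = (if b = axis 1 1 then h t else 1) * indicator {0..<2 * pi} t" for b t
  have [measurable]: "f b \<in> borel_measurable borel" for b
    unfolding f_def by measurable
  have ne: "axis 1 1 \<noteq> (axis 2 1 :: real^2)"
    by (simp add: axis_eq_axis)
  have Basis: "(Basis :: (real^2) set) = {axis 1 1, axis 2 1}"
    by (auto simp: Basis_vec_def UNIV_2)
  \<comment> \<open>The integrand is a product over the two coordinate directions, so Fubini applies
    in its product form; the second factor contributes the length 2 * pi.\<close>
  have "h (x $ 1) * indicator period_cell x = (\<Prod>b\<in>Basis. f b (x \<bullet> b))" for x
    using ne by (simp add: Basis inner_axis f_def period_cell_def mult.assoc split: split_indicator)
  then have "(\<integral>\<^sup>+x. h (x $ 1) * indicator period_cell x \<partial>lborel) = (\<Prod>b\<in>Basis. \<integral>\<^sup>+t. f b t \<partial>lborel)"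
    by (simp add: nn_integral_lborel_prod)
  also have "\<dots> = (\<integral>\<^sup>+t. f (axis 1 1) t \<partial>lborel) * (\<integral>\<^sup>+t. f (axis 2 1) t \<partial>lborel)"
    using ne by (simp add: Basis)
  also have "(\<integral>\<^sup>+t. f (axis 2 1) t \<partial>lborel) = ennreal (2 * pi)"
    using ne by (simp add: f_def)
  finally show ?thesis by (simp add: f_def)
qed

context warped_torus_derivs
begin

definition torus_volume :: "(complex \<times> complex) measure" where
  "torus_volume = distr (density lborel (\<lambda>x. ennreal (w (x $ 1)) * indicator period_cell x))
     torus_borel angle_point"

lemma measurable_w [measurable]: "w \<in> borel_measurable borel"
  using continuous_coeffs by (intro borel_measurable_continuous_onI)

lemma nn_integral_torus_volume:
  assumes [measurable]: "f \<in> borel_measurable torus_borel"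
  shows "(\<integral>\<^sup>+q. f q \<partial>torus_volume) =
    (\<integral>\<^sup>+x. ennreal (w (x $ 1)) * indicator period_cell x * f (angle_point x) \<partial>lborel)"
  unfolding torus_volume_def by (simp add: nn_integral_distr nn_integral_density)

text \<open>Translation invariance of Lebesgue measure combined with the periodicity of the
  density.\<close>

lemma emeasure_lattice_shift:
  assumes [measurable]: "S \<in> sets borel"
  shows "(\<integral>\<^sup>+x. ennreal (w (x $ 1)) * indicator S x \<partial>lborel) =
    (\<integral>\<^sup>+x. ennreal (w (x $ 1)) * indicator S (x + lattice k) \<partial>lborel)"
proof -
  have "(\<integral>\<^sup>+x. ennreal (w (x $ 1)) * indicator S x \<partial>lborel) =
    (\<integral>\<^sup>+x. ennreal (w (x $ 1)) * indicator S x \<partial>distr lborel borel ((+) (lattice k)))"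
    by (simp add: lborel_distr_plus)
  also have "\<dots> = (\<integral>\<^sup>+x. ennreal (w ((lattice k + x) $ 1)) * indicator S (lattice k + x) \<partial>lborel)"
    by (rule nn_integral_distr) measurable
  also have "\<dots> = (\<integral>\<^sup>+x. ennreal (w (x $ 1)) * indicator S (x + lattice k) \<partial>lborel)"
    using periodic_int[of w] w_periodic by (simp add: add.commute)
  finally show ?thesis .
qed

text \<open>The preimage P of S is lattice invariant. Its parts in the period cell and in the chart
  square are both cut into pieces indexed by lattice vectors, and translation by
  \<open>lattice k\<close> carries the k-th piece of the first onto the k-th piece of the second,
  preserving mass.\<close>

lemma is_volume_measure_torus_volume: "is_volume_measure M torus_volume"
proof -
  have "emeasure torus_volume S =
      (\<integral>\<^sup>+x\<in>angles a b ` S. ennreal (sqrt (det (diagonal_metric A B x))) \<partial>lborel)"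
    if S: "S \<in> sets torus_borel" "S \<subseteq> patch a b" for S a b
  proof -
    define P where "P = angle_point -` S"
    have [measurable]: "P \<in> sets borel"
      using measurable_sets[OF measurable_angle_point S(1)] by (simp add: P_def)
    define \<nu> where "\<nu> = density lborel (\<lambda>x::real^2. ennreal (w (x $ 1)))"
    have \<nu>: "emeasure \<nu> Z = (\<integral>\<^sup>+x. ennreal (w (x $ 1)) * indicator Z x \<partial>lborel)" if "Z \<in> sets borel" for Z
      unfolding \<nu>_def using that by (simp add: emeasure_density)
    have img: "angles a b ` S = square a b \<inter> P"
    proof
      show "angles a b ` S \<subseteq> square a b \<inter> P"
        using S(2) angles_in_square by (auto simp: P_def)
      show "square a b \<inter> P \<subseteq> angles a b ` S"
        using angles_angle_point by (force simp: P_def)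
    qed
    have disj: "disjoint_family (\<lambda>k. period_cell \<inter> P \<inter> {x. x + lattice k \<in> square a b})"
      "disjoint_family (\<lambda>k. {x. x - lattice k \<in> period_cell} \<inter> (square a b \<inter> P))"
    proof -
      show "disjoint_family (\<lambda>k. period_cell \<inter> P \<inter> {x. x + lattice k \<in> square a b})"
      proof -
        have "k = l" if "x + lattice k \<in> square a b" "x + lattice l \<in> square a b" for x k l
        proof -
          \<comment> \<open>The square translated back by \<open>lattice k\<close> contains x and
            serves as the first square of the uniqueness lemma.\<close>
          have "x \<in> square (a - lattice k $ 1) (b - lattice k $ 2)"
            using that(1) by (simp add: square_def algebra_simps)
          then show ?thesis using square_lattice_unique that by blast
        qed
        then show ?thesis by (auto simp: disjoint_family_on_def)
      qed
      show "disjoint_family (\<lambda>k. {x. x - lattice k \<in> period_cell} \<inter> (square a b \<inter> P))"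
        using period_cell_lattice_unique by (auto simp: disjoint_family_on_def)
    qed
    have Un1: "(\<Union>k. period_cell \<inter> P \<inter> {x. x + lattice k \<in> square a b}) = period_cell \<inter> P"
    proof -
      have "\<exists>k. x + lattice k \<in> square a b" if "x \<in> P" for x
      proof -
        have "angle_point x \<in> patch a b" using that S(2) by (auto simp: P_def)
        then show ?thesis
          using angles_in_square angle_point_eq_iff by metis
      qed
      then show ?thesis by blast
    qed
    have Un2: "(\<Union>k. {x. x - lattice k \<in> period_cell} \<inter> (square a b \<inter> P)) = square a b \<inter> P"
    proof -
      have "\<exists>k. x - lattice k \<in> period_cell" for x
        using period_cell_lattice by blast
      then show ?thesis by blast
    qed
    have "emeasure torus_volume S = emeasure \<nu> (period_cell \<inter> P)"
    proof -
      have "emeasure torus_volume S = (\<integral>\<^sup>+q. indicator S q \<partial>torus_volume)"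
        using S(1) by (simp add: torus_volume_def)
      also have "\<dots> = (\<integral>\<^sup>+x. ennreal (w (x $ 1)) * indicator (period_cell \<inter> P) x \<partial>lborel)"
        using S(1) by (subst nn_integral_torus_volume)
          (auto intro!: nn_integral_cong simp: P_def split: split_indicator)
      finally show ?thesis by (simp add: \<nu>)
    qed
    also have "\<dots> = (\<integral>\<^sup>+k. emeasure \<nu> (period_cell \<inter> P \<inter> {x. x + lattice k \<in> square a b}) \<partial>count_space UNIV)"
    proof -
      have "emeasure \<nu> (\<Union>k. period_cell \<inter> P \<inter> {x. x + lattice k \<in> square a b}) =
        (\<integral>\<^sup>+k. emeasure \<nu> (period_cell \<inter> P \<inter> {x. x + lattice k \<in> square a b}) \<partial>count_space UNIV)"
        by (rule emeasure_UN_countable) (auto simp: \<nu>_def disj)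
      then show ?thesis by (simp only: Un1)
    qed
    also have "\<dots> = (\<integral>\<^sup>+k. emeasure \<nu> ({x. x - lattice k \<in> period_cell} \<inter> (square a b \<inter> P)) \<partial>count_space UNIV)"
    proof (rule nn_integral_cong)
      fix k
      have "emeasure \<nu> ({x. x - lattice k \<in> period_cell} \<inter> (square a b \<inter> P)) =
        (\<integral>\<^sup>+x. ennreal (w (x $ 1)) * indicator ({x. x - lattice k \<in> period_cell} \<inter> (square a b \<inter> P)) (x + lattice k) \<partial>lborel)"
        by (subst \<nu>) (auto intro!: emeasure_lattice_shift)
      also have "\<dots> = (\<integral>\<^sup>+x. ennreal (w (x $ 1)) * indicator (period_cell \<inter> P \<inter> {x. x + lattice k \<in> square a b}) x \<partial>lborel)"
        by (intro nn_integral_cong) (auto simp: P_def split: split_indicator)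
      finally show "emeasure \<nu> (period_cell \<inter> P \<inter> {x. x + lattice k \<in> square a b}) =
          emeasure \<nu> ({x. x - lattice k \<in> period_cell} \<inter> (square a b \<inter> P))"
        by (simp add: \<nu>)
    qed
    also have "\<dots> = emeasure \<nu> (square a b \<inter> P)"
    proof -
      have "emeasure \<nu> (\<Union>k. {x. x - lattice k \<in> period_cell} \<inter> (square a b \<inter> P)) =
        (\<integral>\<^sup>+k. emeasure \<nu> ({x. x - lattice k \<in> period_cell} \<inter> (square a b \<inter> P)) \<partial>count_space UNIV)"
        by (rule emeasure_UN_countable) (auto simp: \<nu>_def disj)
      then show ?thesis by (simp only: Un2)
    qed
    also have "\<dots> = (\<integral>\<^sup>+x\<in>angles a b ` S. ennreal (sqrt (det (diagonal_metric A B x))) \<partial>lborel)"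
      by (simp add: \<nu> img sqrt_det_diagonal)
    finally show ?thesis .
  qed
  moreover have "sets torus_volume = sets torus_borel"
    by (simp add: torus_volume_def)
  ultimately show ?thesis
    by (auto simp: is_volume_measure_def torus_borel_def[symmetric] torus_atlas_def)
qed

text \<open>Uniqueness, as \<open>THE\<close> requires: the chart formula fixes the measure on Borel
  subsets of each patch, and countably many patches, made disjoint, exhaust the torus.\<close>

lemma volume_measure_warped_torus: "volume_measure M = torus_volume"
  unfolding volume_measure_def
proof (rule the_equality)
  fix \<mu> assume \<mu>: "is_volume_measure M \<mu>"
  have s: "sets \<mu> = sets torus_borel" "sets torus_volume = sets torus_borel"
    using \<mu> is_volume_measure_torus_volume by (auto simp: is_volume_measure_def torus_borel_def[symmetric])
  define Q where "Q n = (let p = from_nat n :: int \<times> int in patch (of_int (fst p)) (of_int (snd p)))" for n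
  have Q: "range Q \<subseteq> sets torus_borel"
    using patch_in_torus_borel by (auto simp: Q_def Let_def)
  have UQ: "(\<Union>n. Q n) = torus"
  proof
    show "torus \<subseteq> (\<Union>n. Q n)"
    proof
      fix q assume "q \<in> torus"
      then obtain m n :: int where "q \<in> patch (of_int m) (of_int n)"
        by (rule torus_covered)
      then have "q \<in> Q (to_nat (m, n))" by (simp add: Q_def)
      then show "q \<in> (\<Union>n. Q n)" by blast
    qed
  qed (auto simp: Q_def Let_def patch_def)
  have eq: "emeasure \<mu> S = emeasure torus_volume S" if "S \<in> sets torus_borel" "S \<subseteq> Q n" for S n
  proof -
    let ?p = "from_nat n :: int \<times> int"
    let ?c = "(patch (of_int (fst ?p)) (of_int (snd ?p)), angles (of_int (fst ?p)) (of_int (snd ?p)))"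
    have "?c \<in> torus_atlas"
      by (auto simp: torus_atlas_def)
    moreover have "S \<subseteq> fst ?c"
      using that by (simp add: Q_def Let_def)
    ultimately have "emeasure \<nu> S =
        (\<integral>\<^sup>+x\<in>snd ?c ` S. ennreal (sqrt (det (metric M ?c x))) \<partial>lborel)"
      if "is_volume_measure M \<nu>" "sets \<nu> = sets torus_borel" for \<nu>
      using that \<open>S \<in> sets torus_borel\<close> unfolding is_volume_measure_def by fastforce
    then show ?thesis
      using \<mu> is_volume_measure_torus_volume s by simp
  qed
  show "\<mu> = torus_volume"
  proof (rule measure_eqI)
    fix S assume "S \<in> sets \<mu>"
    then have S: "S \<in> sets torus_borel" by (simp add: s)
    have dj: "S \<inter> disjointed Q n \<in> sets torus_borel" "S \<inter> disjointed Q n \<subseteq> Q n" for n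
      using S sets.range_disjointed_sets[OF Q] disjointed_subset[of Q n] by (auto intro!: sets.Int)
    have df: "disjoint_family (\<lambda>n. S \<inter> disjointed Q n)"
      using disjoint_family_disjointed[of Q] by (auto simp: disjoint_family_on_def)
    have "S \<subseteq> torus"
      using S sets.sets_into_space by fastforce
    then have SU: "(\<Union>n. S \<inter> disjointed Q n) = S"
      using UQ by (simp add: UN_disjointed_eq Int_UN_distrib[symmetric] Int_absorb2)
    have "emeasure \<mu> S = (\<Sum>n. emeasure \<mu> (S \<inter> disjointed Q n))"
      using suminf_emeasure[OF _ df, of \<mu>, unfolded SU] dj(1) by (simp add: s image_subset_iff)
    also have "\<dots> = (\<Sum>n. emeasure torus_volume (S \<inter> disjointed Q n))"
      by (rule suminf_cong) (rule eq[OF dj])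
    also have "\<dots> = emeasure torus_volume S"
      using suminf_emeasure[OF _ df, of torus_volume, unfolded SU] dj(1) by (simp add: s image_subset_iff)
    finally show "emeasure \<mu> S = emeasure torus_volume S" .
  qed (simp add: s)
qed (rule is_volume_measure_torus_volume)

end

section \<open>Bounds for volume and integral curvature of densities in t\<close>

context warped_torus_derivs
begin

text \<open>Functions of t enter through cos t = Re (fst q), which is continuous on the ambient
  space, so measurability on the torus needs no charts.\<close>

lemma nn_integral_fibre_constant:
  fixes g :: "real \<Rightarrow> real"
  assumes g: "continuous_on UNIV g"
  shows "(\<integral>\<^sup>+q. ennreal (g (Re (fst q))) \<partial>torus_volume) =
    (\<integral>\<^sup>+t. ennreal (w t) * ennreal (g (cos t)) * indicator {0..<2 * pi} t \<partial>lborel) * ennreal (2 * pi)"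
proof -
  have [measurable]: "g \<in> borel_measurable borel"
    using g by (rule borel_measurable_continuous_onI)
  have "continuous_on UNIV (\<lambda>q::complex \<times> complex. g (Re (fst q)))"
    by (intro continuous_on_compose2[OF g] continuous_intros) auto
  then have "(\<lambda>q. ennreal (g (Re (fst q)))) \<in> borel_measurable torus_borel"
    using measurable_torus_continuous by measurable
  from nn_integral_torus_volume[OF this] show ?thesis
    using nn_integral_period_cell[of "\<lambda>t. ennreal (w t) * ennreal (g (cos t))"]
    by (simp add: angle_point_def mult_ac)
qed

lemma integral_rho_K_le:
  assumes g: "continuous_on UNIV g" "\<And>t. 0 \<le> g (cos t)"
    and rho: "\<And>t. max (K - gauss_curvature t) 0 powr p \<le> g (cos t)"
    and \<psi>: "\<And>t. g (cos t) * w t \<le> \<psi> t" "continuous_on UNIV \<psi>" "\<And>t. (\<Theta> has_real_derivative \<psi> t) (at t)"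
  shows "(\<integral>q. rho_K M K q powr p \<partial>volume_measure M) \<le> (\<Theta> (2 * pi) - \<Theta> 0) * (2 * pi)"
proof -
  define G where "G q = g (Re (fst q))" for q :: "complex \<times> complex"
  have \<psi>0: "0 \<le> \<psi> t" for t
    using \<psi>(1)[of t] g(2)[of t] w_pos[of t] by (meson less_imp_le mult_nonneg_nonneg order_trans)
  have \<Theta>: "0 \<le> \<Theta> (2 * pi) - \<Theta> 0"
    using DERIV_nonneg_imp_nondecreasing[of 0 "2 * pi" \<Theta>] \<psi>(3) \<psi>0 by fastforce
  have "(\<integral>\<^sup>+q. ennreal (G q) \<partial>torus_volume) =
     (\<integral>\<^sup>+t. ennreal (w t) * ennreal (g (cos t)) * indicator {0..<2 * pi} t \<partial>lborel) * ennreal (2 * pi)"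
    unfolding G_def by (rule nn_integral_fibre_constant[OF g(1)])
  also have "\<dots> \<le> (\<integral>\<^sup>+t. ennreal (\<psi> t) * indicator {0..2 * pi} t \<partial>lborel) * ennreal (2 * pi)"
    using \<psi>(1) g(2) w_pos
    by (intro mult_right_mono nn_integral_mono)
       (auto split: split_indicator simp: ennreal_mult'[symmetric] mult.commute less_imp_le intro!: ennreal_leI)
  also have "\<dots> = ennreal (\<Theta> (2 * pi) - \<Theta> 0) * ennreal (2 * pi)"
    using \<psi> \<psi>0 by (subst nn_integral_FTC_Icc) (auto intro: borel_measurable_continuous_onI)
  also have "\<dots> = ennreal ((\<Theta> (2 * pi) - \<Theta> 0) * (2 * pi))"
    using \<Theta> by (simp add: ennreal_mult)
  finally have nn: "(\<integral>\<^sup>+q. ennreal (G q) \<partial>torus_volume) \<le> ennreal ((\<Theta> (2 * pi) - \<Theta> 0) * (2 * pi))" .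
  have sp: "space torus_volume = torus" by (simp add: torus_volume_def)
  have G0: "0 \<le> G q" if q: "q \<in> torus" for q
  proof -
    obtain x where "q = angle_point x" by (rule torus_point_angle[OF q])
    then show ?thesis using g(2) by (simp add: G_def angle_point_def)
  qed
  have meas: "G \<in> borel_measurable torus_volume"
  proof -
    have "continuous_on UNIV G"
      unfolding G_def by (intro continuous_on_compose2[OF g(1)] continuous_intros) auto
    then show ?thesis
      using measurable_torus_continuous by (simp add: torus_volume_def)
  qed
  have int: "integrable torus_volume G"
    using meas nn G0 by (intro integrableI_nonneg) (auto simp: sp intro: le_less_trans)
  have "(\<integral>q. rho_K M K q powr p \<partial>torus_volume) \<le> (\<integral>q. G q \<partial>torus_volume)"
  \<comment> \<open>Integrability is asked of the majorant only: if the left integrand were not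
    integrable, its integral would be 0 by convention.\<close>
  proof (rule integral_mono'[OF int])
    fix q assume q: "q \<in> space torus_volume"
    then obtain x where x: "q = angle_point x" unfolding sp by (rule torus_point_angle)
    show "rho_K M K q powr p \<le> G q"
      using rho[of "x $ 1"] by (simp add: rho_K_def x rho_angle_point G_def) (simp add: angle_point_def)
    show "0 \<le> G q" using q G0 sp by simp
  qed
  also have "\<dots> \<le> (\<Theta> (2 * pi) - \<Theta> 0) * (2 * pi)"
    using nn meas G0 \<Theta> by (subst integral_eq_nn_integral) (auto simp: sp intro!: enn2real_leI)
  finally show ?thesis by (simp add: volume_measure_warped_torus)
qed

lemma riemannian_vol_ge:
  assumes "0 \<le> a" "a \<le> b" "b < 2 * pi" "m \<ge> 0" "\<And>t. a \<le> t \<Longrightarrow> t \<le> b \<Longrightarrow> m \<le> w t"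
  shows "m * (b - a) * (2 * pi) \<le> riemannian_vol M"
proof -
  have vol: "emeasure torus_volume torus = (\<integral>\<^sup>+t. ennreal (w t) * indicator {0..<2 * pi} t \<partial>lborel) * ennreal (2 * pi)"
  proof -
    have "emeasure torus_volume torus = (\<integral>\<^sup>+q. ennreal 1 \<partial>torus_volume)"
      by (simp add: torus_volume_def)
    then show ?thesis
      using nn_integral_fibre_constant[of "\<lambda>_. 1"] by simp
  qed
  obtain c where c: "\<And>t. t \<in> {0..2 * pi} \<Longrightarrow> w t \<le> c"
  proof -
    have "\<exists>x\<in>{0..2 * pi}. \<forall>t\<in>{0..2 * pi}. w t \<le> w x"
      by (intro continuous_attains_sup continuous_coeffs) auto
    then show ?thesis using that by blast
  qed
  \<comment> \<open>Finiteness has to precede the lower bound, since \<open>measure\<close> assigns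
    0 to sets of infinite mass.\<close>
  have "(\<integral>\<^sup>+t. ennreal (w t) * indicator {0..<2 * pi} t \<partial>lborel) \<le> (\<integral>\<^sup>+t. ennreal c * indicator {0..2 * pi} t \<partial>lborel)"
    using c by (intro nn_integral_mono) (auto split: split_indicator intro!: ennreal_leI)
  also have "\<dots> < \<infinity>"
    by (simp add: nn_integral_cmult_indicator ennreal_mult_less_top)
  finally have fin: "emeasure torus_volume torus < \<infinity>"
    unfolding vol by (simp add: ennreal_mult_less_top)
  have "ennreal (m * (b - a)) = (\<integral>\<^sup>+t. ennreal m * indicator {a..b} t \<partial>lborel)"
    using assms by (simp add: nn_integral_cmult_indicator ennreal_mult)
  also have "\<dots> \<le> (\<integral>\<^sup>+t. ennreal (w t) * indicator {0..<2 * pi} t \<partial>lborel)"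
    using assms by (intro nn_integral_mono) (auto split: split_indicator intro!: ennreal_leI)
  finally have "ennreal (m * (b - a)) * ennreal (2 * pi) \<le> emeasure torus_volume torus"
    unfolding vol by (rule mult_right_mono) simp
  then have "ennreal (m * (b - a) * (2 * pi)) \<le> emeasure torus_volume torus"
    using assms by (simp add: ennreal_mult)
  then have "enn2real (ennreal (m * (b - a) * (2 * pi))) \<le> enn2real (emeasure torus_volume torus)"
    using fin by (intro enn2real_mono) auto
  then show ?thesis
    using assms by (simp add: riemannian_vol_def volume_measure_warped_torus measure_def)
qed

lemma kbar_le:
  assumes "p > 0" "riemannian_vol M \<ge> 1" "0 \<le> I"
    "(\<integral>q. rho_K M K q powr p \<partial>volume_measure M) \<le> I"
  shows "kbar p K M \<le> I powr (1 / p)"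
proof -
  let ?J = "\<integral>q. rho_K M K q powr p \<partial>volume_measure M"
  have J: "0 \<le> ?J" by (intro integral_nonneg_AE) simp
  have "1 / riemannian_vol M * ?J \<le> 1 * ?J"
    using assms(2) J by (intro mult_right_mono) auto
  then have "1 / riemannian_vol M * ?J \<le> I" using assms(4) by linarith
  then show ?thesis
    unfolding kbar_def using assms J by (intro powr_mono2) auto
qed

end

section \<open>Diameter\<close>

context smooth_warped_torus
begin

text \<open>The competitor is the image of a straight segment. Its speed is at most sqrt A |d1| +
  sqrt B |d2|, and a majorant of sqrt A with a known primitive makes the length explicit.\<close>

lemma riemannian_dist_angle_point_le:
  assumes \<psi>: "\<And>t. sqrt (A t) \<le> \<psi> t" "continuous_on UNIV \<psi>" "\<And>t. (\<Theta> has_real_derivative \<psi> t) (at t)"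
    and \<beta>: "\<And>t. sqrt (B t) \<le> \<beta>"
  shows "riemannian_dist M (angle_point x) (angle_point y)
    \<le> ennreal (\<bar>\<Theta> (y $ 1) - \<Theta> (x $ 1)\<bar> + \<beta> * \<bar>y $ 2 - x $ 2\<bar>)"
proof -
  define d where "d = y - x"
  define line where "line s = x + s *\<^sub>R d" for s :: real
  define \<gamma> where "\<gamma> s = angle_point (line s)" for s
  have cline: "continuous_on S line" for S
    unfolding line_def[abs_def] by (intro continuous_intros)
  have dline: "((\<lambda>s. line s + c) has_vector_derivative d) (at t)" for t c
    unfolding line_def[abs_def] by (auto intro!: derivative_eq_intros)
  \<comment> \<open>Near each time the chart shows the segment shifted by a fixed lattice vector,
    hence with velocity d.\<close>
  have vd: "((angles a b \<circ> \<gamma>) has_vector_derivative d) (at t)" if t: "\<gamma> t \<in> patch a b" for a b t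
  proof -
    obtain k where k: "angles a b (\<gamma> t) = line t + lattice k"
      using angles_in_square(2)[OF t] angle_point_eq_iff unfolding \<gamma>_def by blast
    define V where "V = (\<lambda>s. line s + lattice k) -` square a b"
    have "open V"
      unfolding V_def using cline[of UNIV]
      by (intro open_vimage open_square continuous_intros)
    moreover have "t \<in> V"
      using angles_in_square(1)[OF t] k by (simp add: V_def)
    moreover have "line s + lattice k = (angles a b \<circ> \<gamma>) s" if "s \<in> V" for s
      using that angles_angle_point[of "line s + lattice k" a b] by (simp add: V_def \<gamma>_def)
    ultimately show ?thesis
      using has_vector_derivative_transform_within_open[OF dline] by blast
  qed
  have "C1_curve_on M 0 1 \<gamma>"
  proof -
    have "continuous_on {0..1} \<gamma>"
      unfolding \<gamma>_def[abs_def]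
      by (rule continuous_on_compose2[OF continuous_on_angle_point cline]) auto
    then have "continuous_map (top_of_set {0..1}) (top_of_set torus) \<gamma>"
      by (auto simp: \<gamma>_def)
    moreover have "\<exists>v. continuous_on {t \<in> {0..1}. \<gamma> t \<in> patch a b} v \<and>
        (\<forall>t\<in>{0..1}. \<gamma> t \<in> patch a b \<longrightarrow> ((angles a b \<circ> \<gamma>) has_vector_derivative v t) (at t within {0..1}))" for a b
      by (rule exI[of _ "\<lambda>_. d"]) (auto intro: vd has_vector_derivative_at_within)
    ultimately show ?thesis
      by (auto simp: C1_curve_on_def torus_atlas_def)
  qed
  then have "piecewise_C1_curve M \<gamma>"
    unfolding piecewise_C1_curve_def by (intro exI[of _ "[0, 1]"]) (simp add: less_Suc_eq)
  then have "riemannian_dist M (\<gamma> 0) (\<gamma> 1) \<le> curve_length M \<gamma>"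
    unfolding riemannian_dist_def by (intro INF_lower) simp
  moreover have "\<gamma> 0 = angle_point x" "\<gamma> 1 = angle_point y"
    by (simp_all add: \<gamma>_def line_def d_def)
  moreover have "curve_length M \<gamma> \<le> ennreal (\<bar>\<Theta> (y $ 1) - \<Theta> (x $ 1)\<bar> + \<beta> * \<bar>y $ 2 - x $ 2\<bar>)"
  proof -
    have speed: "speed M \<gamma> t \<le> \<psi> (line t $ 1) * \<bar>d $ 1\<bar> + \<beta> * \<bar>d $ 2\<bar>" for t
    proof -
      obtain a b where ch: "chart_at M (\<gamma> t) = (patch a b, angles a b)" and p: "\<gamma> t \<in> patch a b"
        using chart_at_torus angle_point_in_torus unfolding \<gamma>_def by blast
      obtain k where k: "angles a b (\<gamma> t) = line t + lattice k"
        using angles_in_square(2)[OF p] angle_point_eq_iff unfolding \<gamma>_def by blast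
      let ?t = "line t $ 1"
      have "speed M \<gamma> t = sqrt (d \<bullet> (diagonal_metric A B (line t) *v d))"
        by (simp add: speed_def ch Let_def vector_derivative_at[OF vd[OF p]] k metric_lattice)
      also have "d \<bullet> (diagonal_metric A B (line t) *v d) = A ?t * (d $ 1)\<^sup>2 + B ?t * (d $ 2)\<^sup>2"
        by (simp add: inner_vec_def matrix_vector_mult_def sum_2 power2_eq_square)
      also have "sqrt (A ?t * (d $ 1)\<^sup>2 + B ?t * (d $ 2)\<^sup>2) \<le> sqrt (A ?t * (d $ 1)\<^sup>2) + sqrt (B ?t * (d $ 2)\<^sup>2)"
        using A_pos[of ?t] B_pos[of ?t] by (intro sqrt_add_le_add_sqrt) auto
      also have "\<dots> = sqrt (A ?t) * \<bar>d $ 1\<bar> + sqrt (B ?t) * \<bar>d $ 2\<bar>"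
        by (simp add: real_sqrt_mult)
      also have "\<dots> \<le> \<psi> ?t * \<bar>d $ 1\<bar> + \<beta> * \<bar>d $ 2\<bar>"
        by (intro add_mono mult_right_mono \<psi> \<beta>) auto
      finally show ?thesis .
    qed
    \<comment> \<open>The first coordinate moves monotonically along the segment, so a constant sign
      turns the derivative of \<Theta> along it into \<psi> * |d1|.\<close>
    define G where "G s = sgn (d $ 1) * \<Theta> (line s $ 1) + \<beta> * \<bar>d $ 2\<bar> * s" for s
    define g where "g s = \<psi> (line s $ 1) * \<bar>d $ 1\<bar> + \<beta> * \<bar>d $ 2\<bar>" for s
    have \<psi>0: "\<psi> t \<ge> 0" for t
      using \<psi>(1)[of t] A_pos[of t] real_sqrt_ge_zero[of "A t"] by linarith
    have \<beta>0: "\<beta> \<ge> 0"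
      using \<beta>[of 0] B_pos[of 0] real_sqrt_ge_zero[of "B 0"] by linarith
    have "curve_length M \<gamma> \<le> (\<integral>\<^sup>+s. ennreal (g s) * indicator {0..1} s \<partial>lborel)"
      unfolding curve_length_def
      by (intro nn_integral_mono mult_right_mono ennreal_leI) (auto simp: speed g_def)
    also have "\<dots> = ennreal (G 1 - G 0)"
    proof (rule nn_integral_FTC_Icc)
      have "continuous_on UNIV g"
        unfolding g_def[abs_def]
        by (intro continuous_intros continuous_on_compose2[OF \<psi>(2)] cline) auto
      then show "g \<in> borel_measurable borel"
        by (rule borel_measurable_continuous_onI)
      show "(G has_real_derivative g s) (at s)" for s
      proof -
        have "((\<lambda>s. line s $ 1) has_real_derivative d $ 1) (at s)"
          by (auto simp: line_def intro!: derivative_eq_intros)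
        from DERIV_chain2[OF \<psi>(3) this]
        have "(G has_real_derivative sgn (d $ 1) * (\<psi> (line s $ 1) * d $ 1) + \<beta> * \<bar>d $ 2\<bar>) (at s)"
          unfolding G_def[abs_def] by (auto intro!: derivative_eq_intros)
        then show ?thesis
          by (simp add: g_def abs_sgn[of "d $ 1"] mult_ac)
      qed
    qed (use \<psi>0 \<beta>0 in \<open>auto simp: g_def\<close>)
    also have "G 1 - G 0 = sgn (d $ 1) * (\<Theta> (y $ 1) - \<Theta> (x $ 1)) + \<beta> * \<bar>y $ 2 - x $ 2\<bar>"
      by (simp add: G_def line_def d_def algebra_simps)
    also have "ennreal \<dots> \<le> ennreal (\<bar>\<Theta> (y $ 1) - \<Theta> (x $ 1)\<bar> + \<beta> * \<bar>y $ 2 - x $ 2\<bar>)"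
      by (intro ennreal_leI add_right_mono) (auto simp: sgn_if)
    finally show ?thesis .
  qed
  ultimately show ?thesis by simp
qed

lemma riemannian_diam_le:
  assumes \<psi>: "\<And>t. sqrt (A t) \<le> \<psi> t" "continuous_on UNIV \<psi>" "\<And>t. (\<Theta> has_real_derivative \<psi> t) (at t)"
    and \<beta>: "\<And>t. sqrt (B t) \<le> \<beta>"
    and D: "\<And>s t. 0 \<le> s \<Longrightarrow> s < 2 * pi \<Longrightarrow> 0 \<le> t \<Longrightarrow> t < 2 * pi \<Longrightarrow> \<Theta> t - \<Theta> s \<le> D"
  shows "riemannian_diam M \<le> ennreal (D + \<beta> * (2 * pi))"
proof -
  have \<beta>0: "\<beta> \<ge> 0"
    using \<beta>[of 0] B_pos[of 0] real_sqrt_ge_zero[of "B 0"] by linarith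
  have "riemannian_dist M q r \<le> ennreal (D + \<beta> * (2 * pi))" if qr: "q \<in> torus" "r \<in> torus" for q r
  proof -
    obtain x where x: "q = angle_point x" "0 \<le> x $ 1" "x $ 1 < 2 * pi" "0 \<le> x $ 2" "x $ 2 < 2 * pi"
      by (rule torus_point_angle[OF qr(1)])
    obtain y where y: "r = angle_point y" "0 \<le> y $ 1" "y $ 1 < 2 * pi" "0 \<le> y $ 2" "y $ 2 < 2 * pi"
      by (rule torus_point_angle[OF qr(2)])
    have "riemannian_dist M q r \<le> ennreal (\<bar>\<Theta> (y $ 1) - \<Theta> (x $ 1)\<bar> + \<beta> * \<bar>y $ 2 - x $ 2\<bar>)"
      unfolding x(1) y(1) by (rule riemannian_dist_angle_point_le[OF \<psi> \<beta>])
    also have "\<dots> \<le> ennreal (D + \<beta> * (2 * pi))"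
      using D[OF x(2,3) y(2,3)] D[OF y(2,3) x(2,3)] x y \<beta>0
      by (intro ennreal_leI add_mono mult_left_mono) (auto simp: abs_le_iff)
    finally show ?thesis .
  qed
  then show ?thesis
    unfolding riemannian_diam_def by (auto intro!: SUP_least)
qed

end

section \<open>Tori with two thin necks\<close>

text \<open>In the coordinate \<open>x\<close> with \<open>dx = dt / T\<close>, the function \<open>v = sin t\<close> satisfies
  \<open>v\<^sub>x\<^sup>2 = \<Phi>(cos\<^sup>2 t)\<close> with \<open>\<Phi>(y) = y T\<^sup>2\<close>, hence \<open>v\<^sub>x\<^sub>x = - \<Phi>'(cos\<^sup>2 t) v\<close>, so it is an eigenfunction
  for \<open>e\<close> iff \<open>B = \<Phi>' / e\<close>. The coefficients below come from \<open>\<Phi>'(y) = e (1 + y / e)\<^sup>-\<^sup>3\<close>.\<close>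

definition neck_A :: "real \<Rightarrow> real \<Rightarrow> real" where
  "neck_A e t = 2 * e / ((e + (cos t)\<^sup>2) * (2 * e + (cos t)\<^sup>2))"

definition neck_B :: "real \<Rightarrow> real \<Rightarrow> real" where
  "neck_B e t = e ^ 3 / (e + (cos t)\<^sup>2) ^ 3"

definition neck_A' :: "real \<Rightarrow> real \<Rightarrow> real" where
  "neck_A' e t = 4 * e * sin t * cos t * ((e + (cos t)\<^sup>2) + (2 * e + (cos t)\<^sup>2)) /
     ((e + (cos t)\<^sup>2)\<^sup>2 * (2 * e + (cos t)\<^sup>2)\<^sup>2)"

definition neck_B' :: "real \<Rightarrow> real \<Rightarrow> real" where
  "neck_B' e t = 6 * e ^ 3 * sin t * cos t / (e + (cos t)\<^sup>2) ^ 4"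

definition neck_B'' :: "real \<Rightarrow> real \<Rightarrow> real" where
  "neck_B'' e t = e ^ 3 * (6 * ((cos t)\<^sup>2 - (sin t)\<^sup>2) / (e + (cos t)\<^sup>2) ^ 4
     + 48 * (sin t)\<^sup>2 * (cos t)\<^sup>2 / (e + (cos t)\<^sup>2) ^ 5)"

text \<open>Here q and r stand for e + cos^2 t and 2 * e + cos^2 t. With the positive factor r / (4
  * e) in front, the signs of the terms can be read off.\<close>

lemma neck_curvature_identity:
  fixes q r e S C :: real
  assumes "q > 0" "r > 0" "e > 0"
  shows "(e ^ 3 * (6 * (C\<^sup>2 - S\<^sup>2) / q ^ 4 + 48 * S\<^sup>2 * C\<^sup>2 / q ^ 5)
      - (6 * e ^ 3 * S * C / q ^ 4)\<^sup>2 / (2 * (e ^ 3 / q ^ 3))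
      - (4 * e * S * C * (q + r) / (q\<^sup>2 * r\<^sup>2)) * (6 * e ^ 3 * S * C / q ^ 4) / (2 * (2 * e / (q * r))))
      / (2 * (2 * e / (q * r)) * (e ^ 3 / q ^ 3))
    = r / (4 * e) * (6 * (C\<^sup>2 - S\<^sup>2) + 4 * S\<^sup>2 * C\<^sup>2 * (15 / (2 * q) - 3 * (q + r) / (2 * q * r)))"
  using assms
  by (simp add: divide_simps) (simp add: power2_eq_square eval_nat_numeral algebra_simps)

text \<open>The function is the continuous branch of arctan (k * tan t): the subtraction formula for
  the tangent expresses its difference from t by a quotient without poles.\<close>

lemma has_real_derivative_arctan_tan_multiple:
  fixes k :: real
  assumes "k > 0"
  shows "((\<lambda>t. t - arctan ((1 - k) * sin t * cos t / ((cos t)\<^sup>2 + k * (sin t)\<^sup>2)))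
    has_real_derivative k / ((cos t)\<^sup>2 + k\<^sup>2 * (sin t)\<^sup>2)) (at t)"
proof -
  define S C where "S = sin t" and "C = cos t"
  define D where "D = C\<^sup>2 + k * S\<^sup>2"
  define N where "N = (1 - k) * S * C"
  have SC: "C\<^sup>2 = 1 - S\<^sup>2" by (simp add: S_def C_def cos_squared_eq)
  have pos: "C\<^sup>2 + m * S\<^sup>2 > 0" if "m > 0" for m
  proof (cases "S = 0")
    case True
    then show ?thesis using SC by simp
  next
    case False
    then have "m * S\<^sup>2 > 0" using that by simp
    then show ?thesis by (simp add: add_nonneg_pos)
  qed
  have D: "D > 0" unfolding D_def by (rule pos[OF assms])
  have k2: "C\<^sup>2 + k\<^sup>2 * S\<^sup>2 > 0" using pos[of "k\<^sup>2"] assms by simp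
  have "((\<lambda>t. (1 - k) * sin t * cos t / ((cos t)\<^sup>2 + k * (sin t)\<^sup>2)) has_real_derivative
      ((1 - k) * (C\<^sup>2 - S\<^sup>2) * D - N * (2 * (k - 1) * S * C)) / D\<^sup>2) (at t)"
    using D unfolding D_def N_def S_def C_def
    by (auto intro!: derivative_eq_intros simp: power2_eq_square algebra_simps)
  from DERIV_chain2[OF DERIV_arctan this]
  have "((\<lambda>t. t - arctan ((1 - k) * sin t * cos t / ((cos t)\<^sup>2 + k * (sin t)\<^sup>2))) has_real_derivative
      1 - inverse (1 + (N / D)\<^sup>2) * (((1 - k) * (C\<^sup>2 - S\<^sup>2) * D - N * (2 * (k - 1) * S * C)) / D\<^sup>2)) (at t)"
    by (intro DERIV_diff DERIV_ident) (simp add: N_def D_def S_def C_def)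
  moreover have "inverse (1 + (N / D)\<^sup>2) * (X / D\<^sup>2) = X / (D\<^sup>2 + N\<^sup>2)" for X
    using D by (simp add: field_simps add_pos_nonneg)
  moreover have "(1 - k) * (C\<^sup>2 - S\<^sup>2) * D - N * (2 * (k - 1) * S * C) = (1 - k) * (C\<^sup>2 - k * S\<^sup>2)"
  proof -
    have "(1 - k) * (C\<^sup>2 - S\<^sup>2) * D - N * (2 * (k - 1) * S * C) =
        (1 - k) * ((C\<^sup>2 - S\<^sup>2) * (C\<^sup>2 + k * S\<^sup>2) + 2 * (1 - k) * S\<^sup>2 * C\<^sup>2)"
      by (simp add: D_def N_def power2_eq_square algebra_simps)
    also have "\<dots> = (1 - k) * (C\<^sup>2 - k * S\<^sup>2)"
      unfolding SC by (simp add: algebra_simps power2_eq_square)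
    finally show ?thesis .
  qed
  moreover have "D\<^sup>2 + N\<^sup>2 = C\<^sup>2 + k\<^sup>2 * S\<^sup>2"
    unfolding D_def N_def power_mult_distrib SC by (simp add: algebra_simps power2_eq_square)
  moreover have "1 - (1 - k) * (C\<^sup>2 - k * S\<^sup>2) / (C\<^sup>2 + k\<^sup>2 * S\<^sup>2) = k / (C\<^sup>2 + k\<^sup>2 * S\<^sup>2)"
  proof -
    have "C\<^sup>2 + k\<^sup>2 * S\<^sup>2 - (1 - k) * (C\<^sup>2 - k * S\<^sup>2) = k"
      unfolding SC by (simp add: algebra_simps power2_eq_square)
    then show ?thesis using k2 by (simp add: field_simps)
  qed
  ultimately show ?thesis by (simp add: S_def C_def)
qed

text \<open>The bound 1/40 ensures (2 * pi)^2 * e < 1, which together with B \<le> 1 is the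
  smallness condition for all eigenvalues up to e.\<close>

locale dumbbell =
  fixes e :: real
  assumes e_pos: "0 < e" and e_le: "e \<le> 1 / 40"
begin

definition \<xi> :: "real \<Rightarrow> real" where "\<xi> t = e + (cos t)\<^sup>2"

definition \<eta> :: "real \<Rightarrow> real" where "\<eta> t = 2 * e + (cos t)\<^sup>2"

lemma xi_pos: "\<xi> t > 0" and eta_pos: "\<eta> t > 0"
  using e_pos by (simp_all add: \<xi>_def \<eta>_def add_pos_nonneg)

lemma xi_le_eta: "\<xi> t \<le> \<eta> t" and eta_le_xi: "\<eta> t \<le> 2 * \<xi> t" and e_le_xi: "e \<le> \<xi> t"
  using e_pos by (simp_all add: \<xi>_def \<eta>_def)

lemma xi_deriv: "(\<xi> has_real_derivative - 2 * sin t * cos t) (at t)"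
  and eta_deriv: "(\<eta> has_real_derivative - 2 * sin t * cos t) (at t)"
  unfolding \<xi>_def[abs_def] \<eta>_def[abs_def]
  by (auto intro!: derivative_eq_intros)

lemma neck_eqs:
  "neck_A e t = 2 * e / (\<xi> t * \<eta> t)" "neck_B e t = e ^ 3 / \<xi> t ^ 3"
  "neck_A' e t = 4 * e * sin t * cos t * (\<xi> t + \<eta> t) / ((\<xi> t)\<^sup>2 * (\<eta> t)\<^sup>2)"
  "neck_B' e t = 6 * e ^ 3 * sin t * cos t / \<xi> t ^ 4"
  "neck_B'' e t = e ^ 3 * (6 * ((cos t)\<^sup>2 - (sin t)\<^sup>2) / \<xi> t ^ 4 + 48 * (sin t)\<^sup>2 * (cos t)\<^sup>2 / \<xi> t ^ 5)"
  by (simp_all add: neck_A_def neck_B_def neck_A'_def neck_B'_def neck_B''_def \<xi>_def \<eta>_def)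

sublocale warped_torus_derivs "neck_A e" "neck_B e" "neck_A' e" "deriv (neck_A' e)" "neck_B' e" "neck_B'' e"
proof
  have c: "Ck_on k UNIV (\<lambda>x::real^2. m * e + cos (x $ 1) * cos (x $ 1))" for k and m :: real
    using Ck_on_cos_sin[OF open_UNIV bounded_linear_vec_nth, of k 1]
    by (intro Ck_on_add Ck_on_mult Ck_on_const) auto
  have pos: "m * e + cos t * cos t > 0" if "m > 0" for m t
    using that e_pos by (intro add_pos_nonneg) auto
  have A: "neck_A e t = 2 * e * inverse ((1 * e + cos t * cos t) * (2 * e + cos t * cos t))" for t
    by (simp add: neck_A_def power2_eq_square divide_inverse)
  have B: "neck_B e t = e ^ 3 * inverse ((1 * e + cos t * cos t) * ((1 * e + cos t * cos t) * (1 * e + cos t * cos t)))" for t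
    by (simp add: neck_B_def power2_eq_square power3_eq_cube divide_inverse mult.assoc)
  show "smooth_on UNIV (\<lambda>x::real^2. neck_A e (x $ 1))"
    unfolding smooth_on_def A
    by (intro allI Ck_on_mult Ck_on_const Ck_on_inverse c open_UNIV mult_pos_pos[THEN less_imp_neq, THEN not_sym] pos) auto
  show "smooth_on UNIV (\<lambda>x::real^2. neck_B e (x $ 1))"
    unfolding smooth_on_def B
    by (intro allI Ck_on_mult Ck_on_const Ck_on_inverse c open_UNIV mult_pos_pos[THEN less_imp_neq, THEN not_sym] mult_pos_pos pos) auto
  show "neck_A e t > 0" "neck_B e t > 0" for t
    using e_pos xi_pos eta_pos by (simp_all add: neck_eqs)
  show "neck_A e (t + 2 * pi) = neck_A e t" "neck_B e (t + 2 * pi) = neck_B e t" for t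
    by (simp_all add: neck_A_def neck_B_def)
  show "(neck_A e has_real_derivative neck_A' e t) (at t)" for t
  proof -
    have "((\<lambda>t. 2 * e / (\<xi> t * \<eta> t)) has_real_derivative neck_A' e t) (at t)"
      unfolding neck_eqs using xi_pos[of t] eta_pos[of t]
      by (auto intro!: derivative_eq_intros xi_deriv eta_deriv simp: power2_eq_square algebra_simps)
    then show ?thesis by (simp add: neck_eqs[abs_def])
  qed
  show "(neck_B e has_real_derivative neck_B' e t) (at t)" for t
  proof -
    have "((\<lambda>t. e ^ 3 / \<xi> t ^ 3) has_real_derivative neck_B' e t) (at t)"
      unfolding neck_eqs using xi_pos[of t]
      by (auto intro!: derivative_eq_intros xi_deriv simp: divide_simps eval_nat_numeral)
    then show ?thesis by (simp add: neck_eqs[abs_def])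
  qed
  show "(neck_B' e has_real_derivative neck_B'' e t) (at t)" for t
  proof -
    have "((\<lambda>t. 6 * e ^ 3 * sin t * cos t / \<xi> t ^ 4) has_real_derivative neck_B'' e t) (at t)"
      unfolding neck_eqs using xi_pos[of t]
      by (auto intro!: derivative_eq_intros xi_deriv simp: divide_simps)
         (simp add: eval_nat_numeral algebra_simps)
    then show ?thesis by (simp add: neck_eqs[abs_def])
  qed
  show "(neck_A' e has_real_derivative deriv (neck_A' e) t) (at t)" for t
  proof -
    have "(\<lambda>t. 4 * e * sin t * cos t * (\<xi> t + \<eta> t) / ((\<xi> t)\<^sup>2 * (\<eta> t)\<^sup>2)) field_differentiable at t"
      using xi_pos[of t] eta_pos[of t] xi_deriv[of t] eta_deriv[of t]
      by (auto intro!: field_differentiable_divide field_differentiable_mult field_differentiable_add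
          field_differentiable_power field_differentiable_const
          field_differentiable_within_sin field_differentiable_within_cos
          simp: field_differentiable_def[where f = \<xi>] field_differentiable_def[where f = \<eta>])
    then show ?thesis
      by (simp add: neck_eqs[abs_def] DERIV_deriv_iff_field_differentiable)
  qed
qed

lemma T_eq: "T t = e * sqrt (\<eta> t / 2) / \<xi> t"
proof -
  have "neck_B e t / neck_A e t = (e / \<xi> t)\<^sup>2 * (\<eta> t / 2)"
    using xi_pos[of t] eta_pos[of t] e_pos
    by (simp add: neck_eqs divide_simps) (simp add: eval_nat_numeral)
  then show ?thesis
    unfolding T_def using xi_pos[of t] e_pos by (simp only: real_sqrt_mult) simp
qed

lemma w_eq: "w t = e\<^sup>2 * sqrt (2 / \<eta> t) / (\<xi> t)\<^sup>2"
proof -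
  have "neck_A e t * neck_B e t = (e\<^sup>2 / (\<xi> t)\<^sup>2)\<^sup>2 * (2 / \<eta> t)"
    using xi_pos[of t] eta_pos[of t] e_pos
    by (simp add: neck_eqs divide_simps) (simp add: eval_nat_numeral)
  then show ?thesis
    unfolding w_def using xi_pos[of t] e_pos by (simp only: real_sqrt_mult) simp
qed

lemma neck_B_le_1: "neck_B e t \<le> 1"
  using e_le_xi[of t] e_pos xi_pos[of t] by (simp add: neck_eqs power_mono)

lemma sin_eigenfunction:
  "((\<lambda>t. T t * cos t) has_real_derivative - e * w t * sin t) (at t)"
proof -
  define \<sigma> where "\<sigma> = sqrt (\<eta> t / 2)"
  have \<sigma>: "\<sigma> > 0" "\<sigma> * \<sigma> = \<eta> t / 2" using eta_pos[of t] by (simp_all add: \<sigma>_def)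
  have d: "((\<lambda>t. sqrt (\<eta> t / 2)) has_real_derivative - sin t * cos t / (2 * \<sigma>)) (at t)"
    using eta_pos[of t] unfolding \<sigma>_def
    by (auto intro!: derivative_eq_intros eta_deriv simp: divide_simps)
  have "((\<lambda>t. e * sqrt (\<eta> t / 2) / \<xi> t * cos t) has_real_derivative
      e * (- sin t * cos t / (2 * \<sigma>) * \<xi> t + \<sigma> * (2 * sin t * cos t)) / (\<xi> t * \<xi> t) * cos t
        - e * \<sigma> / \<xi> t * sin t) (at t)"
    using DERIV_mult[OF DERIV_divide[OF DERIV_cmult[OF d, of e] xi_deriv] DERIV_cos] xi_pos[of t]
    by (simp add: \<sigma>_def mult_ac right_diff_distrib)
  also have "e * (- sin t * cos t / (2 * \<sigma>) * \<xi> t + \<sigma> * (2 * sin t * cos t)) / (\<xi> t * \<xi> t) * cos t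
        - e * \<sigma> / \<xi> t * sin t = - e * (e\<^sup>2 * (1 / \<sigma>) / (\<xi> t)\<^sup>2) * sin t"
  proof -
    have "e * (- sin t * cos t / (2 * \<sigma>) * \<xi> t + \<sigma> * (2 * sin t * cos t)) / (\<xi> t * \<xi> t) * cos t
        - e * \<sigma> / \<xi> t * sin t =
        e * sin t * (- (cos t)\<^sup>2 * \<xi> t / 2 + 2 * (\<sigma> * \<sigma>) * (cos t)\<^sup>2 - \<sigma> * \<sigma> * \<xi> t) / (\<sigma> * (\<xi> t)\<^sup>2)"
      using \<sigma>(1) xi_pos[of t] by (simp add: divide_simps) (simp add: power2_eq_square algebra_simps)
    \<comment> \<open>This is where the matching of A and B enters: every term containing cos t
      cancels, leaving the constant that produces w.\<close>
    also have "- (cos t)\<^sup>2 * \<xi> t / 2 + 2 * (\<sigma> * \<sigma>) * (cos t)\<^sup>2 - \<sigma> * \<sigma> * \<xi> t = - e\<^sup>2"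
      unfolding \<sigma>(2) by (simp add: \<xi>_def \<eta>_def power2_eq_square field_simps)
    finally show ?thesis by simp
  qed
  also have "1 / \<sigma> = sqrt (2 / \<eta> t)"
    by (simp add: \<sigma>_def real_sqrt_divide)
  finally show ?thesis by (simp add: T_eq[abs_def] w_eq)
qed

lemma laplace_eigenvalue_dumbbell: "laplace_eigenvalue M e"
proof -
  define u :: "complex \<times> complex \<Rightarrow> real" where "u q = Im (fst q)" for q
  have U: "u \<circ> angle_point = (\<lambda>x. sin (x $ 1))"
    by (auto simp: u_def angle_point_def)
  have "smooth_function M u"
    using Ck_on_cos_sin[OF open_UNIV bounded_linear_vec_nth]
    unfolding smooth_function_iff U smooth_on_def by blast
  moreover have "u (angle_point (vector [pi / 2, 0])) \<noteq> 0"
    by (simp add: u_def angle_point_def)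
  moreover have "- laplacian M u q = e * u q" if q: "q \<in> torus" for q
  proof -
    obtain x where x: "q = angle_point x" by (rule torus_point_angle[OF q])
    have p: "partial 1 (\<lambda>x::real^2. sin (x $ 1)) y = cos (y $ 1)" "partial 2 (\<lambda>x::real^2. sin (x $ 1)) y = 0" for y
      using partial_component[OF DERIV_sin, where x = y and i = 1 and j = 1]
        partial_component[OF DERIV_sin, where x = y and i = 2 and j = 1] by simp_all
    have "partial 1 (\<lambda>y. T (y $ 1) * cos (y $ 1)) x = - e * w (x $ 1) * sin (x $ 1)"
      using partial_component[OF sin_eigenfunction, where x = x and i = 1 and j = 1] by simp
    then have "laplacian M u (angle_point x) = - e * sin (x $ 1)"
      using w_pos[of "x $ 1"] unfolding laplacian_angle_point U p
      by (simp add: has_derivative_imp_partial[OF has_derivative_const])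
    then show ?thesis using U x by (simp add: fun_eq_iff)
  qed
  ultimately show ?thesis
    unfolding laplace_eigenvalue_def warped_torus_simps topspace_euclidean_subtopology
    using angle_point_in_torus by blast
qed

lemma lambda1_dumbbell: "0 < lambda1 M" "lambda1 M \<le> e"
proof -
  have "(2 * pi)\<^sup>2 * (e * neck_B e t) < 1" for t
  proof -
    have "pi < 3.15" using pi_less_4 pi_approx by simp
    then have "(2 * pi)\<^sup>2 < (6.3)\<^sup>2"
      using pi_gt_zero by (intro power_strict_mono) auto
    moreover have "e * neck_B e t \<le> (1 / 40) * 1"
      using e_le neck_B_le_1[of t] B_pos[of t] by (intro mult_mono) auto
    ultimately have "(2 * pi)\<^sup>2 * (e * neck_B e t) \<le> (6.3)\<^sup>2 * (1 / 40 * 1)"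
      by (rule mult_mono[OF less_imp_le]) (use e_pos B_pos[of t] in simp_all)
    also have "\<dots> < 1" by (simp add: power2_eq_square)
    finally show ?thesis .
  qed
  then show "0 < lambda1 M" "lambda1 M \<le> e"
    using lambda1_le[OF laplace_eigenvalue_dumbbell e_pos] by auto
qed

text \<open>Dropping the terms of favourable sign and using \<eta> \<le> 2 and \<eta> \<le> 2 *
  \<xi> gives the constant 18, rounded to 20. It is essential that each remaining term keeps the
  factor cos^2 t: a bound 1 / e would be too large on the bulges, where most of the area
  lies.\<close>

lemma uminus_gauss_curvature_le: "- gauss_curvature t \<le> 20 * ((cos t)\<^sup>2 / e)"
proof -
  define S C where "S = sin t" and "C = cos t"
  have "- gauss_curvature t = \<eta> t / (4 * e) *
      (6 * (C\<^sup>2 - S\<^sup>2) + 4 * S\<^sup>2 * C\<^sup>2 * (15 / (2 * \<xi> t) - 3 * (\<xi> t + \<eta> t) / (2 * \<xi> t * \<eta> t)))"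
    unfolding gauss_curvature_def neck_eqs minus_divide_left minus_minus S_def C_def
    by (rule neck_curvature_identity[OF xi_pos eta_pos e_pos])
  also have "\<dots> \<le> \<eta> t / (4 * e) * (6 * C\<^sup>2 + 4 * 1 * C\<^sup>2 * (15 / (2 * \<xi> t)))"
  proof (intro mult_left_mono add_mono mult_mono)
    show "15 / (2 * \<xi> t) - 3 * (\<xi> t + \<eta> t) / (2 * \<xi> t * \<eta> t) \<le> 15 / (2 * \<xi> t)"
      using xi_pos[of t] eta_pos[of t] by simp
    show "0 \<le> 15 / (2 * \<xi> t) - 3 * (\<xi> t + \<eta> t) / (2 * \<xi> t * \<eta> t)"
      using xi_pos[of t] eta_pos[of t] xi_le_eta[of t] by (simp add: field_simps)
  qed (use e_pos eta_pos[of t] in \<open>auto simp: S_def abs_square_le_1\<close>)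
  also have "\<dots> = (6 * C\<^sup>2 * \<eta> t + 30 * C\<^sup>2 * (\<eta> t / \<xi> t)) / (4 * e)"
    using xi_pos[of t] by (simp add: field_simps)
  also have "\<dots> \<le> (6 * C\<^sup>2 * 2 + 30 * C\<^sup>2 * 2) / (4 * e)"
  proof (intro divide_right_mono add_mono mult_left_mono)
    have "(cos t)\<^sup>2 \<le> 1" by (simp add: abs_square_le_1)
    then show "\<eta> t \<le> 2" using e_le by (simp add: \<eta>_def)
    show "\<eta> t / \<xi> t \<le> 2" using eta_le_xi[of t] xi_pos[of t] by (simp add: divide_simps)
  qed (use e_pos in auto)
  also have "\<dots> \<le> 20 * ((cos t)\<^sup>2 / e)"
    using e_pos by (simp add: C_def divide_right_mono)
  finally show ?thesis .
qed

text \<open>A majorant of sqrt e / \<xi> with an elementary primitive (the arctangent lemma with k =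
  sqrt e); its integral over a period is 2 * pi for every e.\<close>

definition \<psi> :: "real \<Rightarrow> real" where
  "\<psi> t = sqrt e / ((cos t)\<^sup>2 + (sqrt e)\<^sup>2 * (sin t)\<^sup>2)"

definition \<Theta> :: "real \<Rightarrow> real" where
  "\<Theta> t = t - arctan ((1 - sqrt e) * sin t * cos t / ((cos t)\<^sup>2 + sqrt e * (sin t)\<^sup>2))"

lemma Theta_deriv: "(\<Theta> has_real_derivative \<psi> t) (at t)"
  unfolding \<Theta>_def[abs_def] \<psi>_def using e_pos by (intro has_real_derivative_arctan_tan_multiple) simp

lemma psi_denominator_pos: "(cos t)\<^sup>2 + e * (sin t)\<^sup>2 > 0"
proof (cases "sin t = 0")
  case True
  then show ?thesis by (simp add: cos_squared_eq)
next
  case False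
  then have "e * (sin t)\<^sup>2 > 0" using e_pos by simp
  then show ?thesis by (simp add: add_nonneg_pos)
qed

lemma continuous_on_psi: "continuous_on S \<psi>"
  unfolding \<psi>_def[abs_def] using psi_denominator_pos e_pos
  by (auto intro!: continuous_intros simp: less_imp_neq[THEN not_sym])

lemma xi_le_psi: "sqrt e / \<xi> t \<le> \<psi> t"
proof -
  have "e * (sin t)\<^sup>2 \<le> e * 1"
    using e_pos by (intro mult_left_mono) (auto simp: abs_square_le_1)
  then have "(cos t)\<^sup>2 + e * (sin t)\<^sup>2 \<le> \<xi> t"
    by (simp add: \<xi>_def)
  then show ?thesis
    using psi_denominator_pos[of t] e_pos by (simp add: \<psi>_def divide_left_mono)
qed

lemma diam_dumbbell: "riemannian_diam M \<le> ennreal (sqrt 2 * (3 * pi) + 1 * (2 * pi))"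
proof (rule riemannian_diam_le)
  show "sqrt (neck_A e t) \<le> sqrt 2 * \<psi> t" for t
  proof -
    have "neck_A e t \<le> 2 * e / (\<xi> t * \<xi> t)"
      using e_pos xi_pos[of t] xi_le_eta[of t]
      unfolding neck_eqs by (intro divide_left_mono mult_left_mono mult_pos_pos eta_pos) auto
    then have "sqrt (neck_A e t) \<le> sqrt (2 * e / (\<xi> t * \<xi> t))"
      by (rule real_sqrt_le_mono)
    also have "\<dots> = sqrt 2 * (sqrt e / \<xi> t)"
      using xi_pos[of t] by (simp add: real_sqrt_divide real_sqrt_mult)
    also have "\<dots> \<le> sqrt 2 * \<psi> t"
      by (intro mult_left_mono xi_le_psi) simp
    finally show ?thesis .
  qed
  show "continuous_on UNIV (\<lambda>t. sqrt 2 * \<psi> t)"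
    by (intro continuous_intros continuous_on_psi)
  show "((\<lambda>t. sqrt 2 * \<Theta> t) has_real_derivative sqrt 2 * \<psi> t) (at t)" for t
    by (intro DERIV_cmult Theta_deriv)
  show "sqrt (neck_B e t) \<le> 1" for t
    using neck_B_le_1 real_sqrt_le_mono[of _ 1] by simp
  show "sqrt 2 * \<Theta> t - sqrt 2 * \<Theta> s \<le> sqrt 2 * (3 * pi)"
    if "0 \<le> s" "s < 2 * pi" "0 \<le> t" "t < 2 * pi" for s t
  proof -
    \<comment> \<open>At most 2 * pi comes from t - s, and pi / 2 from each arctangent.\<close>
    have "\<Theta> t - \<Theta> s \<le> 3 * pi"
      using that arctan_bounded[of "(1 - sqrt e) * sin t * cos t / ((cos t)\<^sup>2 + sqrt e * (sin t)\<^sup>2)"]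
        arctan_bounded[of "(1 - sqrt e) * sin s * cos s / ((cos s)\<^sup>2 + sqrt e * (sin s)\<^sup>2)"]
      unfolding \<Theta>_def by linarith
    then show ?thesis
      by (simp add: right_diff_distrib[symmetric])
  qed
qed

text \<open>Part of one bulge suffices: on an interval of length sqrt e starting at pi / 2 one has
  cos^2 t \<le> e, hence w \<ge> 1 / (5 * sqrt e), and the resulting area 2 * pi / 5 exceeds
  1.\<close>

lemma vol_dumbbell: "riemannian_vol M \<ge> 1"
proof -
  have se: "0 < sqrt e" "sqrt e < 1" using e_pos e_le by auto
  have "1 / (5 * sqrt e) \<le> w t" if t: "pi / 2 \<le> t" "t \<le> pi / 2 + sqrt e" for t
  proof -
    have "\<bar>cos t\<bar> = \<bar>sin (t - pi / 2)\<bar>" by (simp add: sin_diff)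
    also have "\<dots> \<le> \<bar>t - pi / 2\<bar>" by (rule abs_sin_x_le_abs_x)
    also have "\<dots> \<le> sqrt e" using t by simp
    finally have "(cos t)\<^sup>2 \<le> e"
      using e_pos by (metis abs_le_square_iff abs_of_pos real_sqrt_pow2 less_imp_le se(1))
    then have b: "\<xi> t \<le> 2 * e" "\<eta> t \<le> 3 * e" by (simp_all add: \<xi>_def \<eta>_def)
    have "1 / (5 * sqrt e) \<le> sqrt (2 / 3) / (4 * sqrt e)"
    proof -
      have "4 / 5 \<le> sqrt (2 / 3)" by (rule real_le_rsqrt) (simp add: power2_eq_square)
      then show ?thesis using se by (simp add: field_simps)
    qed
    also have "\<dots> = e\<^sup>2 * sqrt (2 / (3 * e)) / (2 * e)\<^sup>2"
      using e_pos by (simp add: real_sqrt_divide real_sqrt_mult field_simps power2_eq_square)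
    also have "\<dots> \<le> e\<^sup>2 * sqrt (2 / \<eta> t) / (\<xi> t)\<^sup>2"
      using b e_pos xi_pos[of t] eta_pos[of t]
      by (intro frac_le mult_left_mono real_sqrt_le_mono divide_left_mono power_mono mult_nonneg_nonneg) auto
    finally show ?thesis by (simp add: w_eq)
  qed
  then have "1 / (5 * sqrt e) * (pi / 2 + sqrt e - pi / 2) * (2 * pi) \<le> riemannian_vol M"
    using se pi_gt3 by (intro riemannian_vol_ge) (auto simp del: real_sqrt_lt_1_iff)
  moreover have "1 / (5 * sqrt e) * (pi / 2 + sqrt e - pi / 2) * (2 * pi) \<ge> 1"
    using se pi_gt3 by (simp add: field_simps)
  ultimately show ?thesis by linarith
qed

lemma kbar_dumbbell:
  assumes K: "K \<ge> 0"
  shows "kbar (3 / 2) K M \<le> (sqrt 2 * (K + 20) powr (3 / 2) * (2 * pi) * (2 * pi)) powr (1 / (3 / 2))"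
proof (rule kbar_le[OF _ vol_dumbbell])
  define c where "c = sqrt 2 * (K + 20) powr (3 / 2)"
  \<comment> \<open>Replacing cos^2 t by \<xi> = e + cos^2 t absorbs K and makes the base a multiple
    of \<xi> / e, whose power 3/2 combines with the powers of \<xi> in w.\<close>
  define g where "g z = ((K + 20) * ((e + z\<^sup>2) / e)) powr (3 / 2)" for z
  have "(\<integral>q. rho_K M K q powr (3 / 2) \<partial>volume_measure M) \<le> (c * \<Theta> (2 * pi) - c * \<Theta> 0) * (2 * pi)"
  proof (rule integral_rho_K_le)
    have "e + z\<^sup>2 \<noteq> 0" for z :: real
      using add_pos_nonneg[OF e_pos zero_le_power2[of z]] by simp
    then show "continuous_on UNIV g"
      unfolding g_def[abs_def] using K e_pos by (auto intro!: continuous_intros)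
    show "0 \<le> g (cos t)" for t by (simp add: g_def)
    show "max (K - gauss_curvature t) 0 powr (3 / 2) \<le> g (cos t)" for t
      unfolding g_def
    proof (rule powr_mono2)
      have "K + 20 * ((cos t)\<^sup>2 / e) \<le> (K + 20) * ((e + (cos t)\<^sup>2) / e)"
        using K e_pos by (simp add: add_divide_distrib algebra_simps)
      then show "max (K - gauss_curvature t) 0 \<le> (K + 20) * ((e + (cos t)\<^sup>2) / e)"
        using uminus_gauss_curvature_le[of t] K e_pos
        by (auto intro!: mult_nonneg_nonneg divide_nonneg_pos)
    qed simp_all
    show "g (cos t) * w t \<le> c * \<psi> t" for t
    proof -
      have "g (cos t) = (K + 20) powr (3 / 2) * (\<xi> t / e) powr (1 + 1 / 2)"
        using K e_pos xi_pos[of t] powr_mult[of "K + 20" "\<xi> t / e" "3 / 2"]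
        by (simp add: g_def \<xi>_def[symmetric])
      also have "(\<xi> t / e) powr (1 + 1 / 2) = \<xi> t / e * sqrt (\<xi> t / e)"
        using e_pos xi_pos[of t] by (subst powr_add) (simp add: powr_half_sqrt)
      finally have g: "g (cos t) = (K + 20) powr (3 / 2) * (\<xi> t / e * sqrt (\<xi> t / e))" .
      have "w t \<le> e\<^sup>2 * sqrt (2 / \<xi> t) / (\<xi> t)\<^sup>2"
        using xi_pos[of t] eta_pos[of t] xi_le_eta[of t]
        unfolding w_eq by (intro divide_right_mono mult_left_mono real_sqrt_le_mono divide_left_mono) auto
      then have "g (cos t) * w t \<le> (K + 20) powr (3 / 2) * (\<xi> t / e * sqrt (\<xi> t / e)) * (e\<^sup>2 * sqrt (2 / \<xi> t) / (\<xi> t)\<^sup>2)"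
        unfolding g using xi_pos[of t] e_pos by (intro mult_left_mono mult_nonneg_nonneg) auto
      also have "\<dots> = c * (sqrt e / \<xi> t)"
      proof -
        let ?P = "(K + 20) powr (3 / 2)"
        have 1: "sqrt (\<xi> t / e) * sqrt (2 / \<xi> t) = sqrt 2 * (1 / sqrt e)"
          using xi_pos[of t] e_pos by (simp add: real_sqrt_mult[symmetric] real_sqrt_divide[symmetric])
        have 2: "1 / sqrt e * e = sqrt e"
          using e_pos by (simp add: real_div_sqrt)
        have 3: "\<xi> t / e * e\<^sup>2 / (\<xi> t)\<^sup>2 = e / \<xi> t"
          using xi_pos[of t] e_pos by (simp add: power2_eq_square)
        have "?P * (\<xi> t / e * sqrt (\<xi> t / e)) * (e\<^sup>2 * sqrt (2 / \<xi> t) / (\<xi> t)\<^sup>2) =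
          ?P * (sqrt (\<xi> t / e) * sqrt (2 / \<xi> t)) * (\<xi> t / e * e\<^sup>2 / (\<xi> t)\<^sup>2)"
          by simp
        also have "\<dots> = sqrt 2 * ?P * (1 / sqrt e * e) / \<xi> t"
          unfolding 1 3 by simp
        also have "\<dots> = c * (sqrt e / \<xi> t)"
          unfolding 2 by (simp add: c_def)
        finally show ?thesis .
      qed
      also have "\<dots> \<le> c * \<psi> t"
        by (intro mult_left_mono xi_le_psi) (simp add: c_def)
      finally show ?thesis .
    qed
    show "continuous_on UNIV (\<lambda>t. c * \<psi> t)"
      by (intro continuous_intros continuous_on_psi)
    show "((\<lambda>t. c * \<Theta> t) has_real_derivative c * \<psi> t) (at t)" for t
      by (intro DERIV_cmult Theta_deriv)
  qed
  then show "(\<integral>q. rho_K M K q powr (3 / 2) \<partial>volume_measure M)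
      \<le> sqrt 2 * (K + 20) powr (3 / 2) * (2 * pi) * (2 * pi)"
    by (simp add: \<Theta>_def c_def)
qed simp_all

end

theorem theorem1p1:
  fixes K :: real
  assumes "K \<ge> 0"
  shows "\<exists>(p::real) (C::real) (D::real) (\<Sigma> :: nat \<Rightarrow> surface).
           p > 1 \<and> C > 0 \<and> D > 0 \<and>
           (\<forall>i. closed_connected_riemannian (\<Sigma> i) \<and>
                riemannian_diam (\<Sigma> i) \<le> ennreal D \<and>
                kbar p K (\<Sigma> i) \<le> C) \<and>
           (\<lambda>i. lambda1 (\<Sigma> i)) \<longlonglongrightarrow> 0"
proof -
  define e where "e i = 1 / (real i + 40)" for i
  define \<Sigma> where "\<Sigma> i = warped_torus (neck_A (e i)) (neck_B (e i))" for i
  define C where "C = (sqrt 2 * (K + 20) powr (3 / 2) * (2 * pi) * (2 * pi)) powr (1 / (3 / 2))"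
  define D where "D = sqrt 2 * (3 * pi) + 1 * (2 * pi)"
  have e: "dumbbell (e i)" for i
    by standard (simp_all add: e_def divide_simps)
  have closed: "closed_connected_riemannian (\<Sigma> i)" for i
  proof -
    interpret dumbbell "e i" by (rule e)
    show ?thesis unfolding \<Sigma>_def by (rule closed_connected_warped_torus)
  qed
  have diam: "riemannian_diam (\<Sigma> i) \<le> ennreal D" for i
    unfolding \<Sigma>_def D_def by (rule dumbbell.diam_dumbbell[OF e])
  have kbar: "kbar (3 / 2) K (\<Sigma> i) \<le> C" for i
    unfolding \<Sigma>_def C_def by (rule dumbbell.kbar_dumbbell[OF e assms])
  have "(\<lambda>i. lambda1 (\<Sigma> i)) \<longlonglongrightarrow> 0"
  proof (rule tendsto_sandwich[OF _ _ tendsto_const])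
    show "e \<longlonglongrightarrow> 0"
      unfolding e_def[abs_def] using LIMSEQ_ignore_initial_segment[OF lim_1_over_n, of 40] by simp
    show "\<forall>\<^sub>F i in sequentially. 0 \<le> lambda1 (\<Sigma> i)" "\<forall>\<^sub>F i in sequentially. lambda1 (\<Sigma> i) \<le> e i"
      using dumbbell.lambda1_dumbbell[OF e] by (simp_all add: \<Sigma>_def less_imp_le)
  qed
  moreover have "D > 0"
    unfolding D_def using pi_gt_zero by (intro add_pos_pos) auto
  moreover have "C > 0"
    using assms by (simp add: C_def)
  ultimately show ?thesis
    using closed diam kbar
    by (intro exI[of _ "3 / 2"] exI[of _ C] exI[of _ D] exI[of _ \<Sigma>]) simp
qed

end
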